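(* Let $K, K'$ be fields and let $p$ be a prime number. If $K$ is algebraic over the finite field $\mathbb{F}_p$ and the Golomb spaces $G(K[X])$ and $G(K'[X])$ are homeomorphic, then $K$ and $K'$ are isomorphic as fields.
   Context: For an integral domain $R$ (commutative unitary ring without zero-divisors), write $R^\bullet := R\setminus\{0\}$. The Golomb space $G(R)$ is the topological space with underlying set $R^\bullet$ whose topology (the Golomb topology) is generated by the sets $(a+I)\cap R^\bullet$, where $a\in R^\bullet$ and $I$ is a nonzero ideal of $R$ with $\langle a, I\rangle = R$. $K[X]$ denotes the polynomial ring in one variable over $K$. *)

theory Defs
  imports
    "HOL-Analysis.Analysis"
    "HOL-Computational_Algebra.Computational_Algebra"
    "HOL-Number_Theory.Cong"
begin

text \<open>Ideals of a commutative ring are its submodules, with the ring viewed as a module over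
  itself. Accordingly \<open>module.span (*) S\<close> is the ideal generated by \<open>S\<close>.\<close>

definition ring_ideal :: "'a::comm_ring_1 set \<Rightarrow> bool" where
  "ring_ideal I \<longleftrightarrow> module.subspace (*) I"

definition ideal_generated :: "'a::comm_ring_1 set \<Rightarrow> 'a set" where
  "ideal_generated S = module.span (*) S"

lemma module_times: "module ((*) :: 'a::comm_ring_1 \<Rightarrow> 'a \<Rightarrow> 'a)"
  by unfold_locales (auto simp: algebra_simps)

lemma ring_ideal_iff:
  "ring_ideal (I :: 'a::comm_ring_1 set) \<longleftrightarrow>
     0 \<in> I \<and> (\<forall>x\<in>I. \<forall>y\<in>I. x + y \<in> I) \<and> (\<forall>r. \<forall>x\<in>I. r * x \<in> I)"
  by (auto simp: ring_ideal_def module.subspace_def[OF module_times])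

lemma ideal_generated_eq_hull: "ideal_generated S = ring_ideal hull S"
  by (simp add: ideal_generated_def ring_ideal_def [abs_def] module.span_def[OF module_times])

definition golomb_topology :: "'a::idom topology" where
  "golomb_topology = topology_generated_by
     {(+) a ` I \<inter> (UNIV - {0}) | a I.
        a \<noteq> 0 \<and> ring_ideal I \<and> I \<noteq> {0} \<and> ideal_generated (insert a I) = UNIV}"

lemma topspace_golomb_topology: "topspace (golomb_topology :: 'a::idom topology) = UNIV - {0}"
proof -
  have "ring_ideal (UNIV :: 'a set)"
    by (simp add: ring_ideal_iff)
  moreover have "ideal_generated (insert 1 (UNIV :: 'a set)) = UNIV"
    by (auto simp: ideal_generated_eq_hull hull_def)
  moreover have "(UNIV :: 'a set) \<noteq> {0}"
    by (metis UNIV_I singletonD zero_neq_one)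
  moreover have "UNIV - {0} = (+) (1::'a) ` UNIV \<inter> (UNIV - {0})"
    by simp
  ultimately have "UNIV - {0} \<in> {(+) a ` I \<inter> (UNIV - {0}) | (a::'a) I.
        a \<noteq> 0 \<and> ring_ideal I \<and> I \<noteq> {0} \<and> ideal_generated (insert a I) = UNIV}"
    using one_neq_zero by blast
  then show ?thesis
    unfolding golomb_topology_def topology_generated_by_topspace by blast
qed

definition algebraic_over :: "'a::field set \<Rightarrow> 'a \<Rightarrow> bool" where
  "algebraic_over F x \<longleftrightarrow> (\<exists>q. q \<noteq> 0 \<and> (\<forall>i. coeff q i \<in> F) \<and> poly q x = 0)"

text \<open>In a field of prime characteristic \<open>p\<close>, the image of the integers is the (unique) copy of
  the field with \<open>p\<close> elements, see the lemma below.\<close>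

definition algebraic_over_GF :: "nat \<Rightarrow> 'a::field itself \<Rightarrow> bool" where
  "algebraic_over_GF p T \<longleftrightarrow>
     CHAR('a) = p \<and> (\<forall>x::'a. algebraic_over (range of_int) x)"

lemma card_range_of_int:
  assumes "CHAR('a::field) = p" "p > 0"
  shows "card (range (of_int :: int \<Rightarrow> 'a)) = p"
proof -
  have "(of_int i :: 'a) = of_int (i mod int p)" for i
    using assms by (simp add: of_int_eq_iff_cong_CHAR cong_def)
  then have "range (of_int :: int \<Rightarrow> 'a) = of_int ` {0..<int p}"
    using assms by (force simp: image_iff)
  moreover have "inj_on (of_int :: int \<Rightarrow> 'a) {0..<int p}"
    using assms by (auto simp: inj_on_def of_int_eq_iff_cong_CHAR cong_def)
  ultimately show ?thesis
    by (simp add: card_image)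
qed

definition field_iso :: "('a::field \<Rightarrow> 'b::field) \<Rightarrow> bool" where
  "field_iso f \<longleftrightarrow>
     bij f \<and> f 1 = 1 \<and> (\<forall>x y. f (x + y) = f x + f y) \<and> (\<forall>x y. f (x * y) = f x * f y)"

end

theory Submission
  imports Defs
begin

text \<open>
  A homeomorphism \<open>h\<close> of Golomb spaces maps units to units, because of the way in which closures of
  neighbourhoods intersect, and for the same reason it respects inclusions of prime supports. It
  therefore matches the primes \<open>\<pi>\<close> of \<open>K[X]\<close> with primes \<open>\<pi>'\<close> of \<open>K'[X]\<close>. As the clopen sets among
  the elements prime to \<open>\<pi>\<close> define the \<open>\<pi>\<close>-adic topology, \<open>h\<close> is moreover continuous from the
  \<open>\<pi>\<close>-adic to the \<open>\<pi>'\<close>-adic topology.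

  For \<open>w \<noteq> 0\<close> in \<open>K'\<close>, consider the elements with no prime divisor but \<open>X\<close>, that is \<open>a X ^ k\<close>. The
  constants that are their \<open>(X - 1)\<close>-adic limits while they tend to \<open>1\<close> at \<open>X - w\<close> are the powers of
  \<open>w\<close>. On the side of \<open>K\<close> the corresponding set is a finite group of roots of unity. Hence \<open>w\<close> has
  finite order, and \<open>K\<close> and \<open>K'\<close> have as many roots of \<open>v ^ q = v\<close> as a subfield with \<open>q\<close> elements
  of either of them predicts. Among fields of the same characteristic this determines the
  isomorphism class, by compactness.

  If \<open>K\<close> is infinite of characteristic \<open>p\<close>, equality of the characteristics is shown by counting. Cover
  \<open>K\<close> by \<open>p + 1\<close> additive subgroups \<open>H\<^sub>i\<close> of finite index with common pairwise intersection. The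
  polynomials \<open>z\<close> with \<open>z(0) \<noteq> 0\<close> and \<open>z'(0) / z(0) \<in> H\<^sub>i\<close> are the \<open>X\<close>-adic closure of those whose prime
  divisors all divide some \<open>1 + b X\<close> with \<open>b \<in> H\<^sub>i\<close>, and such closures are transported by \<open>h\<close>. So
  the elements prime to some \<open>\<rho>\<close> in \<open>K'[X]\<close> are covered by \<open>p + 1\<close> open submonoids with common pairwise
  intersection, which forces the characteristic of \<open>K'\<close> to be at most \<open>p\<close>.
\<close>

text \<open>A homeomorphism respects neither sums nor products. All that is known to survive is
  which elements are units, which primes divide an element (without multiplicity), and adic
  closeness at elements prime to the given prime. Algebraic facts about K' are therefore read off
  sets defined by these data alone, such as \<open>unit_limits\<close> and
  \<open>lin_smooth\<close>; products enter because a product has no primes beyond those of its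
  factors.

  Counting roots of unity only sees multiplication, so for infinite fields the characteristic is
  taken from the additive group of K, by way of the logarithmic derivative at 0, which turns
  products into sums. The number p + 1 is the number of lines in a plane over the prime field: K is
  the sum of a subgroup H and such a plane, and each covering subgroup is H plus one line.
  Conversely, a partition modulo N as in \<open>adic_partition_bound\<close> has more than CHAR(K')
  parts. Applying this to h and to its inverse gives equality.

  The field with two elements stands apart: its polynomial ring has a single unit, and units are
  detected in pairs.\<close>

section \<open>Comaximality, Bezout relations and prime factors of polynomials\<close>

text \<open>For principal I = (b) this is the condition \<langle>a, I\<rangle> = R in the definition
  of the Golomb topology.\<close>

definition comaximal :: "'a::comm_ring_1 \<Rightarrow> 'a \<Rightarrow> bool" where
  "comaximal a b \<longleftrightarrow> (\<exists>s t. s * a + t * b = 1)"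

lemma comaximal_commute: "comaximal a b \<longleftrightarrow> comaximal b a"
  unfolding comaximal_def by (metis add.commute)

lemma comaximal_unit_left: "a dvd 1 \<Longrightarrow> comaximal a b"
  unfolding comaximal_def by (metis add.right_neutral dvdE mult.commute mult_zero_left)

lemma comaximal_mult_right:
  assumes "comaximal a b" "comaximal a c"
  shows "comaximal a (b * c)"
proof -
  obtain s t u v where "s * a + t * b = 1" "u * a + v * c = 1"
    using assms unfolding comaximal_def by blast
  moreover have "((s * a + t * b) * u + s * v * c) * a + (t * v) * (b * c) =
      (s * a + t * b) * (u * a + v * c)"
    by (simp only: distrib_left distrib_right) (simp add: ac_simps)
  ultimately have "((s * a + t * b) * u + s * v * c) * a + (t * v) * (b * c) = 1" by simp
  then show ?thesis unfolding comaximal_def by blast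
qed

lemma comaximal_mult_left: "comaximal a c \<Longrightarrow> comaximal b c \<Longrightarrow> comaximal (a * b) c"
  using comaximal_mult_right comaximal_commute by metis

lemma comaximal_power_right: "comaximal a b \<Longrightarrow> comaximal a (b ^ n)"
  by (induction n) (auto intro: comaximal_mult_right comaximal_unit_left simp: comaximal_commute[of a 1])

lemma comaximal_power_left: "comaximal a b \<Longrightarrow> comaximal (a ^ n) b"
  using comaximal_power_right comaximal_commute by metis

lemma comaximal_dvd_right: "comaximal a c \<Longrightarrow> b dvd c \<Longrightarrow> comaximal a b"
  unfolding comaximal_def by (metis dvdE mult.assoc mult.commute)

lemma comaximal_dvd_left: "comaximal a c \<Longrightarrow> b dvd a \<Longrightarrow> comaximal b c"
  using comaximal_dvd_right comaximal_commute by metis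

lemma comaximal_cong:
  assumes "comaximal x b" "b dvd y - x"
  shows "comaximal y b"
proof -
  obtain s t r where "s * x + t * b = 1" "y = x + b * r"
    using assms unfolding comaximal_def by (metis add.commute diff_add_cancel dvdE)
  moreover have "s * (x + b * r) + (t - s * r) * b = s * x + t * b" by (simp add: algebra_simps)
  ultimately have "s * y + (t - s * r) * b = 1" by simp
  then show ?thesis unfolding comaximal_def by blast
qed

lemma comaximal_dvd_multD:
  assumes "comaximal a b" "a dvd b * c"
  shows "a dvd c"
proof -
  obtain s t where "s * a + t * b = 1" using assms unfolding comaximal_def by blast
  moreover have "a * (s * c) + t * (b * c) = (s * a + t * b) * c" by (simp add: algebra_simps)
  ultimately have "c = a * (s * c) + t * (b * c)" by simp
  then show ?thesis using assms(2) by (metis dvd_add dvd_mult dvd_triv_left)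
qed

lemma comaximal_mult_dvd:
  assumes "comaximal a b" "a dvd c" "b dvd c"
  shows "a * b dvd c"
proof -
  obtain r where r: "c = b * r" using assms by blast
  have "a dvd r" using comaximal_dvd_multD assms r by blast
  then show ?thesis using r by (metis mult.commute dvd_refl mult_dvd_mono)
qed

lemma comaximal_chinese_remainder:
  fixes b c :: "'a::idom"
  assumes "comaximal b c" "b \<noteq> 0" "c \<noteq> 0"
  obtains w where "w \<noteq> 0" "b dvd w - x" "c dvd w - y"
proof -
  obtain s t where st: "s * b + t * c = 1" using assms unfolding comaximal_def by blast
  define w where "w = x * (t * c) + y * (s * b)"
  have tc: "t * c = 1 - s * b" using st by (metis add_diff_cancel_left')
  have "w - x = b * (s * (y - x))" unfolding w_def tc by (simp add: algebra_simps)
  moreover have sb: "s * b = 1 - t * c" using st by (metis add_diff_cancel_right')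
  have "w - y = c * (t * (x - y))" unfolding w_def sb by (simp add: algebra_simps)
  ultimately have w: "b dvd w - x" "c dvd w - y" by auto
  \<comment> \<open>Points of the Golomb space are nonzero. If the usual combination happens to be
    0, the nonzero element \<open>b * c\<close> is congruent to it modulo both moduli.\<close>
  show ?thesis
  proof (cases "w = 0")
    case True
    have "b dvd b * c - x" "c dvd b * c - y"
      using dvd_diff[OF dvd_triv_left, of b x c] dvd_diff[OF dvd_triv_right, of c y b] w
      unfolding True by simp_all
    then show ?thesis using assms that[of "b * c"] by auto
  qed (use w that in blast)
qed

lemma prime_power_factor:
  fixes \<pi> c :: "'a::field poly"
  assumes "c \<noteq> 0" "degree \<pi> > 0"
  obtains n c' where "c = \<pi> ^ n * c'" "\<not> \<pi> dvd c'"
  using assms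
proof (induction "degree c" arbitrary: c thesis rule: less_induct)
  case less
  show ?case
  proof (cases "\<pi> dvd c")
    case False
    then show ?thesis using less(2)[of 0 c] by simp
  next
    case True
    then obtain d where d: "c = \<pi> * d" by blast
    then have "d \<noteq> 0" "\<pi> \<noteq> 0" using less(3) by auto
    then have "degree d < degree c" using d less(4) by (simp add: degree_mult_eq)
    then obtain n c' where "d = \<pi> ^ n * c'" "\<not> \<pi> dvd c'"
      using less(1)[of d] \<open>d \<noteq> 0\<close> less(4) by metis
    then show ?thesis using less(2)[of "Suc n" c'] d by (simp add: mult.assoc)
  qed
qed

lemma poly_ideal_principal:
  fixes I :: "'a::field poly set"
  assumes "ring_ideal I"
  obtains d where "\<And>x. x \<in> I \<longleftrightarrow> d dvd x"
proof (cases "I \<subseteq> {0}")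
  case True
  then have "I = {0}" using assms by (auto simp: ring_ideal_iff)
  then show ?thesis using that[of 0] by auto
next
  case False
  define d where "d = arg_min degree (\<lambda>x. x \<in> I \<and> x \<noteq> 0)"
  from False obtain e where "e \<in> I \<and> e \<noteq> 0" by auto
  then have "(d \<in> I \<and> d \<noteq> 0) \<and> (\<forall>y. y \<in> I \<and> y \<noteq> 0 \<longrightarrow> degree d \<le> degree y)"
    unfolding d_def by (rule arg_min_nat_lemma)
  then have d: "d \<in> I" "d \<noteq> 0" and least: "\<And>y. y \<in> I \<Longrightarrow> y \<noteq> 0 \<Longrightarrow> degree d \<le> degree y"
    by blast+
  have "d dvd x" if "x \<in> I" for x
  proof -
    have "x mod d = x + (- (x div d)) * d" by (simp add: minus_div_mult_eq_mod[symmetric])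
    also have "\<dots> \<in> I" using assms d that unfolding ring_ideal_iff by blast
    finally show ?thesis using least[of "x mod d"] degree_mod_less[OF d(2), of x]
      by (metis mod_eq_0_iff_dvd linorder_not_less)
  qed
  moreover have "x \<in> I" if "d dvd x" for x
    using that d assms unfolding ring_ideal_iff by (metis dvdE mult.commute)
  ultimately have "x \<in> I \<longleftrightarrow> d dvd x" for x by blast
  then show ?thesis by (rule that)
qed

lemma poly_bezout:
  fixes a b :: "'a::field poly"
  obtains d s t where "d dvd a" "d dvd b" "d = s * a + t * b"
proof -
  define I where "I = {x. \<exists>s t. x = s * a + t * b}"
  have "ring_ideal I"
    unfolding ring_ideal_iff I_def
  proof (safe)
    show "\<exists>s t. 0 = s * a + t * b" by (rule exI[of _ 0], rule exI[of _ 0]) simp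
  next
    fix s t s' t'
    show "\<exists>sa ta. s * a + t * b + (s' * a + t' * b) = sa * a + ta * b"
      by (rule exI[of _ "s + s'"], rule exI[of _ "t + t'"]) (simp add: algebra_simps)
  next
    fix r s t
    show "\<exists>sa ta. r * (s * a + t * b) = sa * a + ta * b"
      by (rule exI[of _ "r * s"], rule exI[of _ "r * t"]) (simp add: algebra_simps)
  qed
  then obtain d where d: "\<And>x. x \<in> I \<longleftrightarrow> d dvd x" using poly_ideal_principal by blast
  have "a = 1 * a + 0 * b" "b = 0 * a + 1 * b" by auto
  then have "a \<in> I" "b \<in> I" unfolding I_def by blast+
  moreover have "d \<in> I" using d[of d] by simp
  ultimately have "d dvd a" "d dvd b" "\<exists>s t. d = s * a + t * b"
    using d[of a] d[of b] unfolding I_def by simp_all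
  then show ?thesis using that by blast
qed

lemma poly_irreducible_factor:
  fixes d :: "'a::field poly"
  assumes "d \<noteq> 0" "\<not> d dvd 1"
  obtains \<pi> where "irreducible \<pi>" "\<pi> dvd d"
  using assms
proof (induction "degree d" arbitrary: d thesis rule: less_induct)
  case less
  show ?case
  proof (cases "irreducible d")
    case True
    then show ?thesis using less(2) dvd_refl by blast
  next
    case False
    then obtain a b where ab: "d = a * b" "\<not> a dvd 1" "\<not> b dvd 1"
      using less(3,4) unfolding irreducible_def by blast
    then have "a \<noteq> 0" "b \<noteq> 0" using less(3) by auto
    moreover have "degree b > 0" using ab \<open>b \<noteq> 0\<close> is_unit_iff_degree by blast
    ultimately have "degree a < degree d" using ab by (simp add: degree_mult_eq)
    then obtain \<pi> where "irreducible \<pi>" "\<pi> dvd a"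
      using less(1)[of a] \<open>a \<noteq> 0\<close> ab by metis
    then show ?thesis using less(2) ab by simp
  qed
qed

lemma comaximal_irreducible_iff:
  fixes \<pi> :: "'a::field poly"
  assumes "irreducible \<pi>"
  shows "comaximal x \<pi> \<longleftrightarrow> \<not> \<pi> dvd x"
proof
  assume "comaximal x \<pi>"
  then obtain s t where st: "s * x + t * \<pi> = 1" unfolding comaximal_def by blast
  show "\<not> \<pi> dvd x"
  proof
    assume "\<pi> dvd x"
    then have "\<pi> dvd s * x + t * \<pi>" by (intro dvd_add dvd_mult) auto
    then show False using st assms irreducible_not_unit by metis
  qed
next
  assume *: "\<not> \<pi> dvd x"
  obtain d s t where d: "d dvd x" "d dvd \<pi>" "d = s * x + t * \<pi>" by (rule poly_bezout)
  then obtain e where e: "\<pi> = d * e" by blast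
  then have "d dvd 1 \<or> e dvd 1" using assms unfolding irreducible_def by blast
  moreover have "\<not> e dvd 1"
  proof
    assume "e dvd 1"
    then have "\<pi> dvd d" unfolding e by (simp add: mult_unit_dvd_iff)
    then show False using * d(1) dvd_trans by blast
  qed
  ultimately obtain r where "1 = d * r" by blast
  then have "(r * s) * x + (r * t) * \<pi> = 1" using d by (simp add: algebra_simps)
  then show "comaximal x \<pi>" unfolding comaximal_def by blast
qed

lemma not_comaximal_common_factor:
  fixes b c :: "'a::field poly"
  assumes "\<not> comaximal b c" "c \<noteq> 0"
  obtains \<pi> where "irreducible \<pi>" "\<pi> dvd b" "\<pi> dvd c"
proof -
  obtain d s t where d: "d dvd b" "d dvd c" "d = s * b + t * c" by (rule poly_bezout)
  have "\<not> d dvd 1"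
  proof
    assume "d dvd 1"
    then obtain r where "1 = d * r" by blast
    then have "(r * s) * b + (r * t) * c = 1" using d by (simp add: algebra_simps)
    then show False using assms unfolding comaximal_def by blast
  qed
  moreover have "d \<noteq> 0" using d(2) assms(2) by auto
  ultimately obtain \<pi> where "irreducible \<pi>" "\<pi> dvd d" using poly_irreducible_factor by blast
  then show ?thesis using that d dvd_trans by blast
qed

lemma irreducible_poly_prime:
  fixes \<pi> :: "'a::field poly"
  assumes "irreducible \<pi>" "\<pi> dvd a * b"
  shows "\<pi> dvd a \<or> \<pi> dvd b"
  using assms comaximal_irreducible_iff comaximal_commute comaximal_dvd_multD by metis

lemma irreducible_poly_dvd_power:
  fixes \<pi> :: "'a::field poly"
  assumes "irreducible \<pi>" "\<pi> dvd a ^ n"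
  shows "\<pi> dvd a"
  using assms(2) by (induction n) (use assms(1) irreducible_poly_prime irreducible_not_unit in auto)

lemma irreducible_poly_degree: "irreducible (\<pi> :: 'a::field poly) \<Longrightarrow> degree \<pi> > 0"
  unfolding irreducible_def using is_unit_iff_degree by blast

lemma irreducible_poly_nonzero: "irreducible (\<pi> :: 'a::field poly) \<Longrightarrow> \<pi> \<noteq> 0"
  unfolding irreducible_def by blast

text \<open>The exponent depends on the degree of \<open>a\<close> but not on the prime, so one
  power can serve for all prime divisors of a modulus at once.\<close>

lemma high_power_not_dvd:
  fixes \<pi> a :: "'a::field poly"
  assumes "degree \<pi> > 0" "a \<noteq> 0" "degree a < n"
  shows "\<not> \<pi> ^ n dvd a"
proof
  assume "\<pi> ^ n dvd a"
  then have "degree (\<pi> ^ n) \<le> degree a" using assms dvd_imp_degree_le by blast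
  moreover have "degree (\<pi> ^ n) = n * degree \<pi>" using assms by (intro degree_power_eq) auto
  moreover have "n \<le> n * degree \<pi>" using assms by simp
  ultimately show False using assms by linarith
qed

section \<open>The Golomb topology\<close>

abbreviation golomb :: "'a::field poly topology" where "golomb \<equiv> golomb_topology"

text \<open>Ideals are principal, and the class of \<open>z\<close> modulo \<open>b * c\<close> lies
  in those modulo \<open>b\<close> and modulo \<open>c\<close>. Hence residue classes whose modulus
  is comaximal to the point form a neighbourhood base, and the ideals of the definition can be
  forgotten.\<close>

lemma openin_golomb_iff:
  fixes O' :: "'a::field poly set"
  shows "openin golomb O' \<longleftrightarrow>
     0 \<notin> O' \<and> (\<forall>z\<in>O'. \<exists>b. b \<noteq> 0 \<and> comaximal z b \<and> (\<forall>y. y \<noteq> 0 \<longrightarrow> b dvd y - z \<longrightarrow> y \<in> O'))"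
    (is "_ \<longleftrightarrow> ?P O'")
proof
  let ?S = "{(+) a ` I \<inter> (UNIV - {0}) | (a :: 'a poly) I.
        a \<noteq> 0 \<and> ring_ideal I \<and> I \<noteq> {0} \<and> ideal_generated (insert a I) = UNIV}"
  assume "openin golomb O'"
  then have "generate_topology_on ?S O'"
    unfolding golomb_topology_def openin_topology_generated_by_iff .
  then show "?P O'"
  proof induction
    case Empty
    then show ?case by simp
  next
    case (Int U V)
    show ?case
    proof (intro conjI ballI)
      show "0 \<notin> U \<inter> V" using Int.IH by blast
      fix z assume z: "z \<in> U \<inter> V"
      obtain b where b: "b \<noteq> 0" "comaximal z b" "\<forall>y. y \<noteq> 0 \<longrightarrow> b dvd y - z \<longrightarrow> y \<in> U"
        using Int.IH(1) z by auto
      obtain c where c: "c \<noteq> 0" "comaximal z c" "\<forall>y. y \<noteq> 0 \<longrightarrow> c dvd y - z \<longrightarrow> y \<in> V"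
        using Int.IH(2) z by auto
      have "b * c \<noteq> 0 \<and> comaximal z (b * c) \<and> (\<forall>y. y \<noteq> 0 \<longrightarrow> b * c dvd y - z \<longrightarrow> y \<in> U \<inter> V)"
        using b c comaximal_mult_right by (metis IntI dvd_mult_left dvd_mult_right no_zero_divisors)
      then show "\<exists>b. b \<noteq> 0 \<and> comaximal z b \<and> (\<forall>y. y \<noteq> 0 \<longrightarrow> b dvd y - z \<longrightarrow> y \<in> U \<inter> V)"
        by blast
    qed
  next
    case (UN K)
    show ?case
    proof (intro conjI ballI)
      show "0 \<notin> \<Union> K" using UN by blast
      fix z assume "z \<in> \<Union> K"
      then obtain k where k: "k \<in> K" "z \<in> k" by (rule UnionE)
      from bspec[OF conjunct2[OF UN.IH[OF k(1)]] k(2)]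
      obtain b where b: "b \<noteq> 0" "comaximal z b" "\<And>y. y \<noteq> 0 \<Longrightarrow> b dvd y - z \<Longrightarrow> y \<in> k"
        by meson
      show "\<exists>b. b \<noteq> 0 \<and> comaximal z b \<and> (\<forall>y. y \<noteq> 0 \<longrightarrow> b dvd y - z \<longrightarrow> y \<in> \<Union> K)"
        by (rule exI[of _ b]) (simp add: b(1,2), metis b(3) k(1))
    qed
  next
    case (Basis s)
    then obtain a I where aI: "s = (+) a ` I \<inter> (UNIV - {0})" "ring_ideal I" "I \<noteq> {0}"
      "ideal_generated (insert a I) = UNIV" by blast
    obtain d where d: "\<And>x. x \<in> I \<longleftrightarrow> d dvd x"
      using poly_ideal_principal[OF aI(2)] by metis
    have "d \<noteq> 0"
    proof
      assume "d = 0"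
      then have "I = {0}" using d by auto
      then show False using aI(3) by simp
    qed
    \<comment> \<open>An explicit ideal containing \<open>a\<close> and \<open>I\<close>. As the
      ideal generated by them is everything, 1 lies in \<open>J\<close>, which is the Bezout
      relation between \<open>a\<close> and \<open>d\<close>.\<close>
    define J where "J = {x. \<exists>r t. x = r * a + t * d}"
    have "ring_ideal J"
      unfolding ring_ideal_iff J_def
    proof (safe)
      show "\<exists>r t. 0 = r * a + t * d" by (rule exI[of _ 0], rule exI[of _ 0]) simp
    next
      fix s t s' t'
      show "\<exists>sa ta. s * a + t * d + (s' * a + t' * d) = sa * a + ta * d"
        by (rule exI[of _ "s + s'"], rule exI[of _ "t + t'"]) (simp add: algebra_simps)
    next
      fix r s t
      show "\<exists>sa ta. r * (s * a + t * d) = sa * a + ta * d"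
        by (rule exI[of _ "r * s"], rule exI[of _ "r * t"]) (simp add: algebra_simps)
    qed
    moreover have "insert a I \<subseteq> J"
    proof -
      have "a = 1 * a + 0 * d" by simp
      then have "a \<in> J" unfolding J_def by blast
      moreover have "x \<in> J" if "d dvd x" for x
      proof -
        from that obtain t where "x = 0 * a + t * d" by (metis add_0 dvdE mult.commute mult_zero_left)
        then show ?thesis unfolding J_def by blast
      qed
      ultimately show ?thesis using d by (metis insert_subset subsetI)
    qed
    ultimately have "ideal_generated (insert a I) \<subseteq> J"
      unfolding ideal_generated_eq_hull by (rule hull_minimal[rotated])
    then have "1 \<in> J" using aI(4) by blast
    then obtain r t where "1 = r * a + t * d" unfolding J_def by blast
    then have co: "comaximal a d" unfolding comaximal_def by metis
    have s_eq: "x \<in> s \<longleftrightarrow> x \<noteq> 0 \<and> d dvd x - a" for x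
    proof -
      have "x \<in> (+) a ` I \<longleftrightarrow> x - a \<in> I"
      proof
        assume "x - a \<in> I"
        then show "x \<in> (+) a ` I" by (rule image_eqI[rotated]) simp
      qed auto
      then show ?thesis unfolding aI(1) by (simp add: d conj_commute)
    qed
    show ?case
    proof (intro conjI ballI)
      show "0 \<notin> s" using s_eq by blast
      fix z assume z: "z \<in> s"
      have "comaximal z d" using z s_eq co comaximal_cong by metis
      moreover have "y \<in> s" if "y \<noteq> 0" "d dvd y - z" for y
      proof -
        have "y - a = (y - z) + (z - a)" by simp
        then show ?thesis using that z s_eq dvd_add by metis
      qed
      ultimately show "\<exists>b. b \<noteq> 0 \<and> comaximal z b \<and> (\<forall>y. y \<noteq> 0 \<longrightarrow> b dvd y - z \<longrightarrow> y \<in> s)"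
        using \<open>d \<noteq> 0\<close> by blast
    qed
  qed
next
  let ?S = "{(+) a ` I \<inter> (UNIV - {0}) | (a :: 'a poly) I.
        a \<noteq> 0 \<and> ring_ideal I \<and> I \<noteq> {0} \<and> ideal_generated (insert a I) = UNIV}"
  assume P: "?P O'"
  have "\<exists>T. openin golomb T \<and> z \<in> T \<and> T \<subseteq> O'" if "z \<in> O'" for z
  proof -
    have z: "z \<noteq> 0" using P that by blast
    from bspec[OF conjunct2[OF P] that]
    obtain b where b: "b \<noteq> 0" "comaximal z b" "\<And>y. y \<noteq> 0 \<Longrightarrow> b dvd y - z \<Longrightarrow> y \<in> O'"
      by meson
    define I where "I = {x. b dvd x}"
    have I: "ring_ideal I" unfolding I_def ring_ideal_iff by auto
    have "b \<in> I" unfolding I_def by simp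
    then have I0: "I \<noteq> {0}" using b by blast
    have gen: "ideal_generated (insert z I) = UNIV"
    proof -
      have "UNIV \<subseteq> J" if J: "insert z I \<subseteq> J" "ring_ideal J" for J
      proof
        fix x
        obtain s t where st: "s * z + t * b = 1" using b unfolding comaximal_def by blast
        have "s * z + t * b \<in> J" using J \<open>b \<in> I\<close> unfolding ring_ideal_iff by blast
        then have "x * 1 \<in> J" using J(2) st unfolding ring_ideal_iff by metis
        then show "x \<in> J" by simp
      qed
      then show ?thesis unfolding ideal_generated_eq_hull hull_def by blast
    qed
    let ?T = "(+) z ` I \<inter> (UNIV - {0})"
    have "?T \<in> ?S" using z I I0 gen by auto
    then have "openin golomb ?T"
      unfolding golomb_topology_def openin_topology_generated_by_iff by (rule generate_topology_on.Basis)
    moreover have "z \<in> ?T" using z unfolding I_def by (auto intro!: image_eqI[of _ _ 0])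
    moreover have "?T \<subseteq> O'"
    proof
      fix y assume "y \<in> ?T"
      then obtain r where "y = z + r" "b dvd r" "y \<noteq> 0" unfolding I_def by auto
      then show "y \<in> O'" using b(3)[of y] by simp
    qed
    ultimately show ?thesis by blast
  qed
  then show "openin golomb O'" by (subst openin_subopen) blast
qed

lemma openin_golomb_residue_class:
  assumes "b \<noteq> 0" "comaximal z b"
  shows "openin golomb {y. y \<noteq> 0 \<and> b dvd y - z}"
  unfolding openin_golomb_iff
proof (intro conjI ballI)
  fix y assume y: "y \<in> {y. y \<noteq> 0 \<and> b dvd y - z}"
  have "b dvd w - z" if "b dvd w - y" for w
    using dvd_add[OF that, of "y - z"] y by simp
  then show "\<exists>b'. b' \<noteq> 0 \<and> comaximal y b' \<and>
      (\<forall>w. w \<noteq> 0 \<longrightarrow> b' dvd w - y \<longrightarrow> w \<in> {y. y \<noteq> 0 \<and> b dvd y - z})"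
    using assms comaximal_cong[of z b y] y by (intro exI[of _ b]) auto
qed auto

lemma golomb_neighbourhood:
  assumes "openin golomb U" "x \<in> U"
  obtains b where "b \<noteq> 0" "comaximal x b" "\<And>y. y \<noteq> 0 \<Longrightarrow> b dvd y - x \<Longrightarrow> y \<in> U"
proof -
  from bspec[OF conjunct2[OF assms(1)[unfolded openin_golomb_iff]] assms(2)] that show thesis
    by meson
qed

lemma in_closure_of_golomb_iff:
  fixes y :: "'a::field poly"
  shows "y \<in> golomb closure_of A \<longleftrightarrow>
     y \<noteq> 0 \<and> (\<forall>d. d \<noteq> 0 \<longrightarrow> comaximal y d \<longrightarrow> (\<exists>w\<in>A. w \<noteq> 0 \<and> d dvd w - y))"
proof
  assume y: "y \<in> golomb closure_of A"
  then have "y \<in> topspace golomb" by (simp add: in_closure_of)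
  then have "y \<noteq> 0" by (simp add: topspace_golomb_topology)
  moreover have "\<exists>w\<in>A. w \<noteq> 0 \<and> d dvd w - y" if "d \<noteq> 0" "comaximal y d" for d
  proof -
    let ?T = "{w. w \<noteq> 0 \<and> d dvd w - y}"
    have "openin golomb ?T" "y \<in> ?T" using openin_golomb_residue_class[OF that] \<open>y \<noteq> 0\<close> by auto
    then obtain w where "w \<in> A" "w \<in> ?T" using y unfolding in_closure_of by meson
    then show ?thesis by auto
  qed
  ultimately show "y \<noteq> 0 \<and> (\<forall>d. d \<noteq> 0 \<longrightarrow> comaximal y d \<longrightarrow> (\<exists>w\<in>A. w \<noteq> 0 \<and> d dvd w - y))" by simp
next
  assume R: "y \<noteq> 0 \<and> (\<forall>d. d \<noteq> 0 \<longrightarrow> comaximal y d \<longrightarrow> (\<exists>w\<in>A. w \<noteq> 0 \<and> d dvd w - y))"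
  show "y \<in> golomb closure_of A"
    unfolding in_closure_of topspace_golomb_topology
  proof (intro conjI allI impI)
    show "y \<in> UNIV - {0}" using R by simp
    fix T assume "y \<in> T \<and> openin golomb T"
    then obtain b where b: "b \<noteq> 0" "comaximal y b" "\<And>w. w \<noteq> 0 \<Longrightarrow> b dvd w - y \<Longrightarrow> w \<in> T"
      using golomb_neighbourhood by metis
    then show "\<exists>w. w \<in> A \<and> w \<in> T" using R by meson
  qed
qed

lemma dvd_power_diff_imp:
  fixes \<pi> y z :: "'a::idom"
  assumes "\<pi> ^ n dvd y - z" "n > 0"
  shows "\<pi> dvd y \<longleftrightarrow> \<pi> dvd z"
proof -
  have *: "\<pi> dvd y - z" using assms dvd_power dvd_trans by metis
  have "\<pi> dvd (y - z) + z \<longleftrightarrow> \<pi> dvd z" using * by (rule dvd_add_right_iff)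
  then show ?thesis by simp
qed

text \<open>Passing to the closure of a residue class loses the congruence only at primes dividing
  the limit point; it persists modulo every divisor of \<open>b\<close> comaximal to
  \<open>z\<close>. Most later arguments about closures rest on this.\<close>

lemma in_closure_of_residue_class:
  fixes x z :: "'a::field poly"
  assumes "z \<in> golomb closure_of {w. w \<noteq> 0 \<and> b dvd w - x}" "c dvd b" "c \<noteq> 0" "comaximal z c"
  shows "c dvd z - x"
proof -
  obtain w where "b dvd w - x" "c dvd w - z"
    using assms(1,3,4) unfolding in_closure_of_golomb_iff by auto
  then have "c dvd (w - x) - (w - z)" using assms(2) dvd_trans dvd_diff by metis
  then show ?thesis by simp
qed

text \<open>Two topological relations that detect divisibility in a polynomial ring over a field: the first
  one holds for distinct points iff both are units; the second one holds for a unit \<open>u\<close> and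
  nonunits \<open>x\<close>, \<open>y\<close> iff every prime divisor of \<open>y\<close> divides \<open>x\<close>.\<close>

definition closures_meet_deep :: "'a topology \<Rightarrow> 'a \<Rightarrow> 'a \<Rightarrow> bool" where
  "closures_meet_deep X x y \<longleftrightarrow> (\<forall>A. openin X A \<longrightarrow> A \<noteq> {} \<longrightarrow>
     (\<exists>U V. openin X U \<and> openin X V \<and> x \<in> U \<and> y \<in> V \<and>
        X closure_of U \<inter> X closure_of V \<subseteq> X closure_of A))"

definition closures_refine :: "'a topology \<Rightarrow> 'a \<Rightarrow> 'a \<Rightarrow> 'a \<Rightarrow> bool" where
  "closures_refine X u x y \<longleftrightarrow> (\<forall>U V. openin X U \<longrightarrow> openin X V \<longrightarrow> u \<in> U \<longrightarrow> x \<in> V \<longrightarrow>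
     (\<exists>U' V'. openin X U' \<and> openin X V' \<and> u \<in> U' \<and> y \<in> V' \<and>
        X closure_of U' \<inter> X closure_of V' \<subseteq> X closure_of U \<inter> X closure_of V))"

section \<open>Transport of the closure relations by homeomorphisms\<close>

lemma homeomorphic_maps_closure_of:
  assumes "homeomorphic_maps X Y f g" "openin X U"
  shows "openin Y (f ` U)" "Y closure_of (f ` U) = f ` (X closure_of U)"
proof -
  have hom: "homeomorphic_map X Y f" using assms(1) homeomorphic_map_maps by blast
  have sub: "U \<subseteq> topspace X" using assms(2) openin_subset by blast
  show "openin Y (f ` U)" using homeomorphic_map_openness[OF hom sub] assms(2) by blast
  show "Y closure_of (f ` U) = f ` (X closure_of U)"
    using homeomorphic_map_closure_of[OF hom sub] .
qed

lemma homeomorphic_maps_image_inverse: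
  assumes "homeomorphic_maps X Y f g" "openin Y V"
  shows "f ` (g ` V) = V" "openin X (g ` V)" "X closure_of (g ` V) = g ` (Y closure_of V)"
    "f ` (X closure_of (g ` V)) = Y closure_of V"
proof -
  have sym: "homeomorphic_maps Y X g f" using assms(1) homeomorphic_maps_sym by blast
  have fg: "f (g y) = y" if "y \<in> topspace Y" for y
    using assms(1) that unfolding homeomorphic_maps_def by blast
  have "f ` (g ` S) = S" if "S \<subseteq> topspace Y" for S
    using fg that by (force simp: image_image)
  then show "f ` (g ` V) = V" "f ` (X closure_of (g ` V)) = Y closure_of V"
    using assms(2) openin_subset homeomorphic_maps_closure_of(2)[OF sym assms(2)]
      closure_of_subset_topspace by metis+
  show "openin X (g ` V)" "X closure_of (g ` V) = g ` (Y closure_of V)"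
    using homeomorphic_maps_closure_of[OF sym assms(2)] by auto
qed

lemma closures_meet_deep_image:
  assumes hom: "homeomorphic_maps X Y f g" and "x \<in> topspace X" "y \<in> topspace X"
    and c: "closures_meet_deep X x y"
  shows "closures_meet_deep Y (f x) (f y)"
  unfolding closures_meet_deep_def
proof (intro allI impI)
  fix A assume A: "openin Y A" "A \<noteq> {}"
  note inv = homeomorphic_maps_image_inverse[OF hom A(1)]
  have "g ` A \<noteq> {}" using A by simp
  then obtain U V where UV: "openin X U" "openin X V" "x \<in> U" "y \<in> V"
      "X closure_of U \<inter> X closure_of V \<subseteq> X closure_of (g ` A)"
    using c inv(2) unfolding closures_meet_deep_def by meson
  have inj: "inj_on f (topspace X)"
    using hom unfolding homeomorphic_maps_def by (metis inj_on_inverseI)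
  have "Y closure_of (f ` U) \<inter> Y closure_of (f ` V) = f ` (X closure_of U \<inter> X closure_of V)"
    using homeomorphic_maps_closure_of(2)[OF hom] UV(1,2)
      inj_on_image_Int[OF inj closure_of_subset_topspace closure_of_subset_topspace] by metis
  also have "\<dots> \<subseteq> Y closure_of A" using UV(5) inv(4) by (metis image_mono)
  finally show "\<exists>U V. openin Y U \<and> openin Y V \<and> f x \<in> U \<and> f y \<in> V \<and>
      Y closure_of U \<inter> Y closure_of V \<subseteq> Y closure_of A"
    using homeomorphic_maps_closure_of(1)[OF hom] UV by (metis imageI)
qed

lemma closures_refine_image:
  assumes hom: "homeomorphic_maps X Y f g"
    and "u \<in> topspace X" "x \<in> topspace X" "y \<in> topspace X"
    and c: "closures_refine X u x y"
  shows "closures_refine Y (f u) (f x) (f y)"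
  unfolding closures_refine_def
proof (intro allI impI)
  fix A B assume AB: "openin Y A" "openin Y B" "f u \<in> A" "f x \<in> B"
  note invA = homeomorphic_maps_image_inverse[OF hom AB(1)]
  note invB = homeomorphic_maps_image_inverse[OF hom AB(2)]
  have gf: "g (f z) = z" if "z \<in> topspace X" for z
    using hom that unfolding homeomorphic_maps_def by blast
  have "u \<in> g ` A" "x \<in> g ` B" using gf assms AB by (metis imageI)+
  then obtain U V where UV: "openin X U" "openin X V" "u \<in> U" "y \<in> V"
      "X closure_of U \<inter> X closure_of V \<subseteq> X closure_of (g ` A) \<inter> X closure_of (g ` B)"
    using c invA(2) invB(2) unfolding closures_refine_def by meson
  have inj: "inj_on f (topspace X)"
    using gf by (metis inj_on_inverseI)
  have img: "f ` (X closure_of S \<inter> X closure_of T) = f ` (X closure_of S) \<inter> f ` (X closure_of T)" for S T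
    using inj_on_image_Int[OF inj closure_of_subset_topspace closure_of_subset_topspace] by metis
  have "Y closure_of (f ` U) \<inter> Y closure_of (f ` V) = f ` (X closure_of U \<inter> X closure_of V)"
    using homeomorphic_maps_closure_of(2)[OF hom] UV(1,2) img by metis
  also have "\<dots> \<subseteq> f ` (X closure_of (g ` A) \<inter> X closure_of (g ` B))" using UV(5) by (rule image_mono)
  also have "\<dots> = Y closure_of A \<inter> Y closure_of B" using img invA(4) invB(4) by metis
  finally show "\<exists>U V. openin Y U \<and> openin Y V \<and> f u \<in> U \<and> f y \<in> V \<and>
      Y closure_of U \<inter> Y closure_of V \<subseteq> Y closure_of A \<inter> Y closure_of B"
    using homeomorphic_maps_closure_of(1)[OF hom] UV by (metis imageI)
qed

section \<open>The closure relations in a polynomial ring\<close>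

lemma unit_poly_diff:
  fixes u v :: "'a::field poly"
  assumes "u dvd 1" "v dvd 1" "u \<noteq> v"
  shows "u - v dvd 1"
proof -
  have "degree u = 0" "degree v = 0" using assms(1,2) is_unit_iff_degree by (metis dvd_0_left_iff zero_neq_one)+
  then have "degree (u - v) = 0" using degree_diff_le_max[of u v] by simp
  then show ?thesis using assms(3) is_unit_iff_degree[of "u - v"] by simp
qed

text \<open>Use the modulus \<open>b\<close> of a class inside \<open>A\<close> around both units.
  At a common closure point \<open>z\<close>, a prime of \<open>b\<close> not dividing
  \<open>z\<close> would divide the unit \<open>u - v\<close>. So all primes of \<open>b\<close>
  divide \<open>z\<close>, every modulus comaximal to \<open>z\<close> is comaximal to
  \<open>b\<close>, and the Chinese remainder theorem reaches \<open>A\<close>.\<close>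

lemma closures_meet_deep_units:
  fixes u v :: "'a::field poly"
  assumes "u dvd 1" "v dvd 1" "u \<noteq> v"
  shows "closures_meet_deep golomb u v"
  unfolding closures_meet_deep_def
proof (intro allI impI)
  fix A :: "'a poly set" assume A: "openin golomb A" "A \<noteq> {}"
  then obtain a where a: "a \<in> A" by blast
  obtain b where b: "b \<noteq> 0" "comaximal a b" "\<And>y. y \<noteq> 0 \<Longrightarrow> b dvd y - a \<Longrightarrow> y \<in> A"
    using golomb_neighbourhood[OF A(1) a] by metis
  let ?U = "\<lambda>x. {w. w \<noteq> 0 \<and> b dvd w - x}"
  have "golomb closure_of ?U u \<inter> golomb closure_of ?U v \<subseteq> golomb closure_of A"
  proof
    fix z assume z: "z \<in> golomb closure_of ?U u \<inter> golomb closure_of ?U v"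
    have "\<exists>w\<in>A. w \<noteq> 0 \<and> d dvd w - z" if d: "d \<noteq> 0" "comaximal z d" for d
    proof -
      have "comaximal b d"
      proof (rule ccontr)
        assume "\<not> comaximal b d"
        then obtain \<pi> where \<pi>: "irreducible \<pi>" "\<pi> dvd b" "\<pi> dvd d"
          using not_comaximal_common_factor d(1) by metis
        have "comaximal z \<pi>" using d(2) \<pi>(3) comaximal_dvd_right by metis
        then have "\<pi> dvd z - u" "\<pi> dvd z - v"
          using in_closure_of_residue_class[OF _ \<pi>(2) irreducible_poly_nonzero[OF \<pi>(1)]] z by auto
        then have "\<pi> dvd (z - v) - (z - u)" by (rule dvd_diff[rotated])
        then have "\<pi> dvd u - v" by simp
        then show False using unit_poly_diff[OF assms] \<pi>(1) irreducible_not_unit dvd_trans by metis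
      qed
      then obtain w where "w \<noteq> 0" "b dvd w - a" "d dvd w - z"
        using comaximal_chinese_remainder b(1) d(1) by metis
      then show ?thesis using b(3) by auto
    qed
    moreover have "z \<noteq> 0" using z in_closure_of_golomb_iff by auto
    ultimately show "z \<in> golomb closure_of A" unfolding in_closure_of_golomb_iff by simp
  qed
  moreover have "openin golomb (?U u)" "openin golomb (?U v)"
    using openin_golomb_residue_class[OF b(1)] comaximal_unit_left assms by metis+
  moreover have "u \<in> ?U u" "v \<in> ?U v" using assms by auto
  ultimately show "\<exists>U V. openin golomb U \<and> openin golomb V \<and> u \<in> U \<and> v \<in> V \<and>
      golomb closure_of U \<inter> golomb closure_of V \<subseteq> golomb closure_of A" by meson
qed

text \<open>The obstruction used against nonunits: if a prime \<pi> divides \<open>x\<close>,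
  closures of neighbourhoods of \<open>x\<close> and \<open>y\<close> always share a point with a
  prescribed residue at \<pi>. Divisibility by the parts of both moduli prime to \<pi> puts
  \<open>z\<close> into the closures; at \<pi> only the class around \<open>y\<close> can impose a
  condition.\<close>

lemma common_closure_point:
  fixes \<pi> x y y0 :: "'a::field poly"
  assumes \<pi>: "irreducible \<pi>" "\<pi> dvd x" "\<not> \<pi> dvd y0" "\<pi> dvd y \<or> y0 = y"
    and UV: "openin golomb U" "openin golomb V" "x \<in> U" "y \<in> V"
  obtains z where "z \<in> golomb closure_of U" "z \<in> golomb closure_of V" "\<pi> ^ 2 dvd z - y0"
proof -
  obtain b where b: "b \<noteq> 0" "comaximal x b" "\<And>w. w \<noteq> 0 \<Longrightarrow> b dvd w - x \<Longrightarrow> w \<in> U"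
    using golomb_neighbourhood UV by metis
  obtain c where c: "c \<noteq> 0" "comaximal y c" "\<And>w. w \<noteq> 0 \<Longrightarrow> c dvd w - y \<Longrightarrow> w \<in> V"
    using golomb_neighbourhood UV by metis
  obtain f c' where fc: "c = \<pi> ^ f * c'" "\<not> \<pi> dvd c'"
    using prime_power_factor[OF c(1) irreducible_poly_degree[OF \<pi>(1)]] by metis
  have c'0: "c' \<noteq> 0" using c(1) fc(1) by auto
  have \<pi>0: "\<pi> \<noteq> 0" using \<pi>(1) irreducible_poly_nonzero by blast
  have co_b: "comaximal \<pi> b" using b(2) \<pi>(2) comaximal_dvd_left by metis
  have co_c': "comaximal \<pi> c'" using fc(2) \<pi>(1) comaximal_irreducible_iff comaximal_commute by metis
  \<comment> \<open>The exponent \<open>f\<close> meets the condition modulo \<open>c\<close> at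
    \<pi>, and 2 meets the conclusion.\<close>
  have "comaximal (\<pi> ^ (f + 2)) (b * c')"
    by (intro comaximal_power_left comaximal_mult_right co_b co_c')
  then obtain z where z: "z \<noteq> 0" "\<pi> ^ (f + 2) dvd z - y0" "b * c' dvd z - 0"
    using comaximal_chinese_remainder[of "\<pi> ^ (f + 2)" "b * c'" y0 0] \<pi>0 b(1) c'0 by auto
  have bz: "b dvd z" "c' dvd z" using z(3) dvd_mult_left dvd_mult_right by auto
  have "z \<in> golomb closure_of U"
    unfolding in_closure_of_golomb_iff
  proof (intro conjI allI impI)
    fix d assume d: "d \<noteq> 0" "comaximal z d"
    then have "comaximal b d" using bz comaximal_dvd_left by metis
    then obtain w where "w \<noteq> 0" "b dvd w - x" "d dvd w - z"
      using comaximal_chinese_remainder b(1) d(1) by metis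
    then show "\<exists>w\<in>U. w \<noteq> 0 \<and> d dvd w - z" using b(3) by metis
  qed (rule z(1))
  moreover have "z \<in> golomb closure_of V"
    unfolding in_closure_of_golomb_iff
  proof (intro conjI allI impI)
    fix d assume d: "d \<noteq> 0" "comaximal z d"
    have co_d: "comaximal c' d" using d(2) bz comaximal_dvd_left by metis
    show "\<exists>w\<in>V. w \<noteq> 0 \<and> d dvd w - z"
    proof (cases "\<pi> dvd y")
      case True
      then have "comaximal \<pi> c" using c(2) comaximal_dvd_left by metis
      then have "\<not> \<pi> dvd c" using \<pi>(1) comaximal_irreducible_iff comaximal_commute by metis
      then have "f = 0" using fc(1) by (cases f) auto
      then have "comaximal c d" using co_d fc(1) by simp
      then obtain w where "w \<noteq> 0" "c dvd w - y" "d dvd w - z"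
        using comaximal_chinese_remainder c(1) d(1) by metis
      then show ?thesis using c(3) by metis
    next
      case False
      then have y0: "y0 = y" using \<pi>(4) by blast
      \<comment> \<open>\<pi> may divide \<open>d\<close>, so the congruences modulo
        \<open>d\<close> and modulo \<open>\<pi> ^ f\<close> are imposed together through
        \<open>z\<close>, which is already congruent to \<open>y\<close> modulo
        \<open>\<pi> ^ f\<close>.\<close>
      have "comaximal (d * \<pi> ^ f) c'"
        using co_d co_c' by (intro comaximal_mult_left comaximal_power_left) (simp_all add: comaximal_commute)
      then obtain w where w: "w \<noteq> 0" "d * \<pi> ^ f dvd w - z" "c' dvd w - y"
        using comaximal_chinese_remainder[of "d * \<pi> ^ f" c' z y] d(1) \<pi>0 c'0 by auto
      have "\<pi> ^ f dvd z - y" using z(2) unfolding y0 power_add by (rule dvd_mult_left)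
      then have "\<pi> ^ f dvd (w - z) + (z - y)" using w(2) dvd_mult_right dvd_add by metis
      then have "\<pi> ^ f dvd w - y" by simp
      then have "c dvd w - y"
        unfolding fc(1) using w(3) co_c' by (intro comaximal_mult_dvd comaximal_power_left)
      then show ?thesis using w c(3) dvd_mult_left by metis
    qed
  qed (rule z(1))
  moreover have "\<pi> ^ 2 dvd z - y0" using z(2) unfolding power_add by (rule dvd_mult_right)
  ultimately show ?thesis using that by metis
qed

text \<open>For a prime \<pi> dividing \<open>x\<close>, take as test set the class of
  \<open>y0 * (1 + \<pi>)\<close> modulo \<open>\<pi> ^ 2\<close>. Its closure misses every point
  congruent to \<open>y0\<close> modulo \<open>\<pi> ^ 2\<close>, yet such a point lies in both
  closures.\<close>

lemma closures_meet_deep_imp_unit: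
  fixes x y :: "'a::field poly"
  assumes "closures_meet_deep golomb x y" "x \<noteq> 0"
  shows "x dvd 1"
proof (rule ccontr)
  assume "\<not> x dvd 1"
  then obtain \<pi> where \<pi>: "irreducible \<pi>" "\<pi> dvd x"
    using poly_irreducible_factor assms(2) by metis
  have \<pi>0: "\<pi> \<noteq> 0" "\<not> \<pi> dvd 1" using \<pi>(1) irreducible_poly_nonzero irreducible_not_unit by auto
  \<comment> \<open>If \<pi> divides \<open>y\<close>, neither neighbourhood restricts the residue
    at \<pi>, and 1 is chosen as a residue prime to \<pi>.\<close>
  define y0 where "y0 = (if \<pi> dvd y then 1 else y)"
  have y0: "\<not> \<pi> dvd y0" "\<pi> dvd y \<or> y0 = y" using \<pi>0 unfolding y0_def by auto
  define a where "a = y0 * (1 + \<pi>)"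
  have "\<not> \<pi> dvd 1 + \<pi>" using \<pi>0(2) by (simp add: dvd_add_left_iff)
  then have "\<not> \<pi> dvd a" unfolding a_def using y0(1) \<pi>(1) irreducible_poly_prime by metis
  then have a: "comaximal a (\<pi> ^ 2)" "a \<noteq> 0"
    using \<pi>(1) comaximal_irreducible_iff comaximal_power_right by (metis, metis dvd_0_right)
  let ?A = "{w. w \<noteq> 0 \<and> \<pi> ^ 2 dvd w - a}"
  have "openin golomb ?A" using openin_golomb_residue_class a(1) \<pi>0(1) by (metis power_not_zero)
  moreover have "?A \<noteq> {}" using a(2) by (auto intro!: exI[of _ a])
  ultimately obtain U V where UV: "openin golomb U" "openin golomb V" "x \<in> U" "y \<in> V"
      "golomb closure_of U \<inter> golomb closure_of V \<subseteq> golomb closure_of ?A"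
    using assms(1) unfolding closures_meet_deep_def by meson
  obtain z where z: "z \<in> golomb closure_of U" "z \<in> golomb closure_of V" "\<pi> ^ 2 dvd z - y0"
    using common_closure_point[OF \<pi> y0 UV(1-4)] by metis
  have "\<not> \<pi> dvd z" using dvd_power_diff_imp[OF z(3)] y0(1) by simp
  then have "comaximal z (\<pi> ^ 2)" using \<pi>(1) comaximal_irreducible_iff comaximal_power_right by metis
  then have "\<pi> ^ 2 dvd z - a"
    using in_closure_of_residue_class[of z "\<pi> ^ 2" a "\<pi> ^ 2"] z UV(5) \<pi>0(1) by auto
  then have "\<pi> ^ 2 dvd (z - y0) - (z - a)" using z(3) dvd_diff by metis
  then have "\<pi> * \<pi> dvd y0 * \<pi>" unfolding a_def by (simp add: algebra_simps power2_eq_square)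
  then show False using y0(1) \<pi>0(1) by simp
qed

text \<open>If \<pi> divides \<open>y\<close> but not \<open>x\<close>, classes of \<open>u\<close>
  and \<open>x\<close> modulo a high power of \<pi> have no common closure point prime to \<pi>,
  while neighbourhoods of \<open>u\<close> and \<open>y\<close> do. Conversely, if the primes of
  \<open>y\<close> all divide \<open>x\<close>, a modulus \<open>c\<close> at \<open>x\<close> may
  also be used at \<open>y\<close>, and with high powers of \<open>c\<close> every common closure
  point near \<open>u\<close> and \<open>y\<close> is divisible by all primes of \<open>c\<close>,
  hence lies in the closure of the class of \<open>x\<close>.\<close>

lemma closures_refine_golomb_iff:
  fixes u x y :: "'a::field poly"
  assumes u: "u dvd 1" and x: "x \<noteq> 0" "\<not> x dvd 1" and y: "y \<noteq> 0" "\<not> y dvd 1"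
  shows "closures_refine golomb u x y \<longleftrightarrow> (\<forall>\<pi>. irreducible \<pi> \<longrightarrow> \<pi> dvd y \<longrightarrow> \<pi> dvd x)"
proof (intro iffI allI impI)
  fix \<pi> assume c: "closures_refine golomb u x y" and \<pi>: "irreducible \<pi>" "\<pi> dvd y"
  show "\<pi> dvd x"
  proof (rule ccontr)
    assume nd: "\<not> \<pi> dvd x"
    define k where "k = degree (u - x) + 1"
    have "u - x \<noteq> 0" using u x by auto
    then have nk: "\<not> \<pi> ^ k dvd u - x"
      unfolding k_def by (rule high_power_not_dvd[OF irreducible_poly_degree[OF \<pi>(1)]]) simp
    have \<pi>u: "\<not> \<pi> dvd u" using u \<pi>(1) irreducible_not_unit dvd_trans by metis
    have pk: "\<pi> ^ k \<noteq> 0" using irreducible_poly_nonzero[OF \<pi>(1)] by simp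
    let ?U = "\<lambda>x. {w. w \<noteq> 0 \<and> \<pi> ^ k dvd w - x}"
    have "openin golomb (?U u)" "openin golomb (?U x)"
      using pk nd \<pi>u \<pi>(1) by (intro openin_golomb_residue_class comaximal_power_right;
        simp add: comaximal_irreducible_iff)+
    moreover have "u \<in> ?U u" "x \<in> ?U x" using u x by auto
    ultimately obtain U' V' where UV: "openin golomb U'" "openin golomb V'" "u \<in> U'" "y \<in> V'"
      "golomb closure_of U' \<inter> golomb closure_of V' \<subseteq> golomb closure_of (?U u) \<inter> golomb closure_of (?U x)"
      using c unfolding closures_refine_def by meson
    \<comment> \<open>Here \<open>y\<close> is the point divisible by \<pi>, and the residue
      prescribed at \<pi> is that of the unit \<open>u\<close>.\<close>
    have "\<pi> dvd u \<or> u = u" by simp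
    then obtain z where z: "z \<in> golomb closure_of V'" "z \<in> golomb closure_of U'" "\<pi> ^ 2 dvd z - u"
      using common_closure_point[OF \<pi> \<pi>u _ UV(2,1,4,3)] by metis
    have "\<not> \<pi> dvd z" using dvd_power_diff_imp[OF z(3)] \<pi>u by simp
    then have "comaximal z (\<pi> ^ k)" using \<pi>(1) comaximal_irreducible_iff comaximal_power_right by metis
    then have "\<pi> ^ k dvd z - u" "\<pi> ^ k dvd z - x"
      using in_closure_of_residue_class[OF _ dvd_refl pk] z UV(5) by auto
    then have "\<pi> ^ k dvd (z - x) - (z - u)" by (rule dvd_diff[rotated])
    then show False using nk by simp
  qed
next
  assume R: "\<forall>\<pi>. irreducible \<pi> \<longrightarrow> \<pi> dvd y \<longrightarrow> \<pi> dvd x"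
  show "closures_refine golomb u x y"
    unfolding closures_refine_def
  proof (intro allI impI)
    fix U V :: "'a poly set"
    assume UV: "openin golomb U" "openin golomb V" "u \<in> U" "x \<in> V"
    obtain b where b: "b \<noteq> 0" "comaximal u b" "\<And>w. w \<noteq> 0 \<Longrightarrow> b dvd w - u \<Longrightarrow> w \<in> U"
      using golomb_neighbourhood UV by metis
    obtain c where c: "c \<noteq> 0" "comaximal x c" "\<And>w. w \<noteq> 0 \<Longrightarrow> c dvd w - x \<Longrightarrow> w \<in> V"
      using golomb_neighbourhood UV by metis
    \<comment> \<open>With this exponent no prime power \<open>\<pi> ^ k\<close> divides
      \<open>u - y\<close>, whichever prime \<pi> of \<open>c\<close> is considered.\<close>
    define k where "k = degree (u - y) + 1"
    have uy: "u - y \<noteq> 0" using u y by auto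
    let ?U = "{w. w \<noteq> 0 \<and> b * c ^ k dvd w - u}"
    let ?V = "{w. w \<noteq> 0 \<and> c ^ k dvd w - y}"
    have co_y: "comaximal y c"
    proof (rule ccontr)
      assume "\<not> comaximal y c"
      then obtain \<pi> where \<pi>: "irreducible \<pi>" "\<pi> dvd y" "\<pi> dvd c"
        using not_comaximal_common_factor c(1) by metis
      then have "comaximal x \<pi>" using c(2) comaximal_dvd_right by metis
      then show False using R \<pi> comaximal_irreducible_iff by metis
    qed
    have "openin golomb ?U" "openin golomb ?V"
      using b(1) c(1) comaximal_power_right[OF co_y] comaximal_unit_left[OF u]
      by (intro openin_golomb_residue_class; simp)+
    moreover have "u \<in> ?U" "y \<in> ?V" using u y by auto
    moreover have "golomb closure_of ?U \<inter> golomb closure_of ?V \<subseteq> golomb closure_of U \<inter> golomb closure_of V"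
    proof
      fix z assume z: "z \<in> golomb closure_of ?U \<inter> golomb closure_of ?V"
      have "?U \<subseteq> U" using b(3) dvd_mult_left by blast
      then have zU: "z \<in> golomb closure_of U" using z closure_of_mono by blast
      have "z \<in> golomb closure_of V"
        unfolding in_closure_of_golomb_iff
      proof (intro conjI allI impI)
        show "z \<noteq> 0" using z in_closure_of_golomb_iff by blast
        fix d assume d: "d \<noteq> 0" "comaximal z d"
        have "comaximal c d"
        proof (rule ccontr)
          assume "\<not> comaximal c d"
          then obtain \<pi> where \<pi>: "irreducible \<pi>" "\<pi> dvd c" "\<pi> dvd d"
            using not_comaximal_common_factor d(1) by metis
          have co: "comaximal z (\<pi> ^ k)"
            using d(2) \<pi>(3) comaximal_dvd_right comaximal_power_right by metis
          have pk: "\<pi> ^ k dvd c ^ k" "\<pi> ^ k dvd b * c ^ k" "\<pi> ^ k \<noteq> 0"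
            using \<pi>(2) irreducible_poly_nonzero[OF \<pi>(1)] by (simp_all add: dvd_power_same)
          have "\<pi> ^ k dvd z - u"
            using in_closure_of_residue_class[OF IntD1[OF z] pk(2,3) co] .
          moreover have "\<pi> ^ k dvd z - y"
            using in_closure_of_residue_class[OF IntD2[OF z] pk(1,3) co] .
          ultimately have "\<pi> ^ k dvd (z - y) - (z - u)" by (rule dvd_diff[rotated])
          then show False
            using high_power_not_dvd[OF irreducible_poly_degree[OF \<pi>(1)] uy, of k] by (simp add: k_def)
        qed
        then obtain w where "w \<noteq> 0" "c dvd w - x" "d dvd w - z"
          using comaximal_chinese_remainder c(1) d(1) by metis
        then show "\<exists>w\<in>V. w \<noteq> 0 \<and> d dvd w - z" using c(3) by metis
      qed
      then show "z \<in> golomb closure_of U \<inter> golomb closure_of V" using zU by blast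
    qed
    ultimately show "\<exists>U' V'. openin golomb U' \<and> openin golomb V' \<and> u \<in> U' \<and> y \<in> V' \<and>
       golomb closure_of U' \<inter> golomb closure_of V' \<subseteq> golomb closure_of U \<inter> golomb closure_of V"
      by meson
  qed
qed

section \<open>The adic topologies inside the Golomb topology\<close>

definition non_multiples :: "'a::idom \<Rightarrow> 'a set" where
  "non_multiples \<pi> = {z. z \<noteq> 0 \<and> \<not> \<pi> dvd z}"

lemma openin_golomb_padic_class:
  fixes \<pi> a :: "'a::field poly"
  assumes \<pi>: "irreducible \<pi>" "\<not> \<pi> dvd a" "n > 0"
  shows "openin golomb {w. \<pi> ^ n dvd w - a}" "openin golomb (non_multiples \<pi> - {w. \<pi> ^ n dvd w - a})"
proof -
  have \<pi>0: "\<pi> ^ n \<noteq> 0" using \<pi> irreducible_poly_nonzero by simp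
  have ndvd: "\<not> \<pi> dvd w" if "\<pi> ^ n dvd w - z" "\<not> \<pi> dvd z" for w z
    using that dvd_power_diff_imp \<pi>(3) by metis
  have eq: "{w. \<pi> ^ n dvd w - a} = {w. w \<noteq> 0 \<and> \<pi> ^ n dvd w - a}" using ndvd \<pi>(2) by fastforce
  have co: "comaximal z (\<pi> ^ n)" if "\<not> \<pi> dvd z" for z
    using that \<pi>(1) comaximal_irreducible_iff comaximal_power_right by metis
  show "openin golomb {w. \<pi> ^ n dvd w - a}"
    unfolding eq using openin_golomb_residue_class[OF \<pi>0 co[OF \<pi>(2)]] .
  show "openin golomb (non_multiples \<pi> - {w. \<pi> ^ n dvd w - a})"
    unfolding openin_golomb_iff
  proof (intro conjI ballI)
    show "0 \<notin> non_multiples \<pi> - {w. \<pi> ^ n dvd w - a}" by (simp add: non_multiples_def)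
    fix z assume z: "z \<in> non_multiples \<pi> - {w. \<pi> ^ n dvd w - a}"
    have "y \<in> non_multiples \<pi> - {w. \<pi> ^ n dvd w - a}" if "y \<noteq> 0" "\<pi> ^ n dvd y - z" for y
    proof -
      have "\<not> \<pi> dvd y" using ndvd that z by (simp add: non_multiples_def)
      moreover have "\<not> \<pi> ^ n dvd y - a"
      proof
        assume "\<pi> ^ n dvd y - a"
        then have "\<pi> ^ n dvd (y - a) - (y - z)" using that(2) by (rule dvd_diff)
        then show False using z by simp
      qed
      ultimately show ?thesis using that by (simp add: non_multiples_def)
    qed
    then show "\<exists>b. b \<noteq> 0 \<and> comaximal z b \<and>
      (\<forall>y. y \<noteq> 0 \<longrightarrow> b dvd y - z \<longrightarrow> y \<in> non_multiples \<pi> - {w. \<pi> ^ n dvd w - a})"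
      using z co \<pi>0 by (intro exI[of _ "\<pi> ^ n"]) (simp add: non_multiples_def)
  qed
qed

text \<open>This places \<open>q\<close> in the closure of the class of \<open>z\<close> modulo
  \<open>b\<close>: since \<open>b'\<close> divides \<open>q\<close>, only the congruence at \<pi>
  remains.\<close>

lemma common_congruent_point:
  fixes \<pi> z y q :: "'a::field poly"
  assumes \<pi>: "irreducible \<pi>" and b: "b = \<pi> ^ n * b'" "\<not> \<pi> dvd b'" "b \<noteq> 0"
    and q: "b' dvd q" "\<pi> ^ n dvd q - z" and d: "d \<noteq> 0" "comaximal q d"
  obtains w where "w \<noteq> 0" "b dvd w - z" "d dvd w - q"
proof -
  have b'0: "b' \<noteq> 0" "\<pi> \<noteq> 0" using b(1,3) \<pi> irreducible_poly_nonzero by auto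
  have co: "comaximal \<pi> b'" using b(2) \<pi> comaximal_irreducible_iff comaximal_commute by metis
  moreover have "comaximal d b'" using d(2) q(1) comaximal_dvd_left comaximal_commute by metis
  ultimately have "comaximal (d * \<pi> ^ n) b'" by (intro comaximal_mult_left comaximal_power_left)
  then obtain w where w: "w \<noteq> 0" "d * \<pi> ^ n dvd w - q" "b' dvd w - z"
    using comaximal_chinese_remainder[of "d * \<pi> ^ n" b' q z] d(1) b'0 by auto
  have "\<pi> ^ n dvd (w - q) + (q - z)" using w(2) q(2) dvd_mult_right dvd_add by metis
  then have "\<pi> ^ n dvd w - z" by simp
  then have "b dvd w - z" unfolding b(1) using w(3) co by (intro comaximal_mult_dvd comaximal_power_left)
  then show ?thesis using w that dvd_mult_left by metis
qed

text \<open>The clopen subsets of the complement of a prime ideal generate its adic topology there,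
  so that this topology can be recovered from the Golomb topology.\<close>

lemma relatively_clopen_padic_open:
  fixes \<pi> z :: "'a::field poly"
  assumes \<pi>: "irreducible \<pi>" and W: "openin golomb W" "openin golomb (non_multiples \<pi> - W)"
    and z: "z \<in> W" "\<not> \<pi> dvd z"
  obtains n where "n > 0" "\<And>y. \<pi> ^ n dvd y - z \<Longrightarrow> y \<in> W"
proof -
  note deg = irreducible_poly_degree[OF \<pi>]
  obtain b0 where b0: "b0 \<noteq> 0" "comaximal z b0" "\<And>w. w \<noteq> 0 \<Longrightarrow> b0 dvd w - z \<Longrightarrow> w \<in> W"
    using golomb_neighbourhood W(1) z(1) by metis
  \<comment> \<open>The extra factor \<pi> makes the exponent \<open>n\<close> of \<pi> in the
    modulus positive.\<close>
  define b where "b = b0 * \<pi>"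
  have b: "b \<noteq> 0" "\<And>w. w \<noteq> 0 \<Longrightarrow> b dvd w - z \<Longrightarrow> w \<in> W"
    unfolding b_def using b0(1,3) irreducible_poly_nonzero[OF \<pi>] dvd_mult_left by auto
  obtain n b' where nb: "b = \<pi> ^ n * b'" "\<not> \<pi> dvd b'"
    using prime_power_factor[OF b(1) deg] by metis
  have n: "n > 0"
  proof (rule ccontr)
    assume "\<not> n > 0"
    then have "b = b'" using nb by simp
    then have "\<pi> dvd b'" unfolding b_def by (metis dvd_triv_right)
    then show False using nb(2) by blast
  qed
  have "y \<in> W" if y: "\<pi> ^ n dvd y - z" for y
  proof (rule ccontr)
    assume yW: "y \<notin> W"
    have "\<not> \<pi> dvd y" using dvd_power_diff_imp[OF y n] z(2) by simp
    then have "y \<in> non_multiples \<pi> - W" using yW by (auto simp: non_multiples_def)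
    then obtain c where c: "c \<noteq> 0" "comaximal y c" "\<And>w. w \<noteq> 0 \<Longrightarrow> c dvd w - y \<Longrightarrow> w \<in> non_multiples \<pi> - W"
      using golomb_neighbourhood W(2) by metis
    obtain m c' where mc: "c = \<pi> ^ m * c'" "\<not> \<pi> dvd c'"
      using prime_power_factor[OF c(1) deg] by metis
    have "\<not> \<pi> dvd b' * c'" using nb(2) mc(2) irreducible_poly_prime \<pi> by metis
    then have "comaximal (\<pi> ^ (n + m)) (b' * c')"
      using comaximal_irreducible_iff[OF \<pi>] comaximal_commute comaximal_power_left by metis
    moreover have "b' * c' \<noteq> 0" "\<pi> ^ (n + m) \<noteq> 0" using b(1) c(1) nb(1) mc(1) irreducible_poly_nonzero[OF \<pi>] by auto
    \<comment> \<open>\<open>q\<close> lies in the closure of a class around \<open>z\<close> inside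
      \<open>W\<close> and of a class around \<open>y\<close> outside \<open>W\<close>. It belongs
      to one of the two open sets \<open>W\<close> and \<open>non_multiples \<pi> - W\<close>, which
      then meets the class on the other side.\<close>
    ultimately obtain q where q: "q \<noteq> 0" "\<pi> ^ (n + m) dvd q - y" "b' * c' dvd q - 0"
      using comaximal_chinese_remainder by metis
    have q': "b' dvd q" "c' dvd q" "\<pi> ^ n dvd q - y" "\<pi> ^ m dvd q - y"
      using q(2,3) by (auto simp: power_add dest: dvd_mult_left dvd_mult_right)
    have "\<pi> ^ n dvd (q - y) + (y - z)" using q'(3) y by (rule dvd_add)
    then have qz: "\<pi> ^ n dvd q - z" by simp
    have "\<not> \<pi> dvd q" using dvd_power_diff_imp[OF qz n] z(2) by simp
    then have "q \<in> non_multiples \<pi>" using q(1) by (simp add: non_multiples_def)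
    then consider "q \<in> W" | "q \<in> non_multiples \<pi> - W" by blast
    then show False
    proof cases
      case 1
      then obtain d where d: "d \<noteq> 0" "comaximal q d" "\<And>w. w \<noteq> 0 \<Longrightarrow> d dvd w - q \<Longrightarrow> w \<in> W"
        using golomb_neighbourhood W(1) by metis
      obtain w where "w \<noteq> 0" "c dvd w - y" "d dvd w - q"
        using common_congruent_point[OF \<pi> mc c(1) q'(2,4) d(1,2)] by metis
      then show False using c(3) d(3) by blast
    next
      case 2
      then obtain d where d: "d \<noteq> 0" "comaximal q d" "\<And>w. w \<noteq> 0 \<Longrightarrow> d dvd w - q \<Longrightarrow> w \<in> non_multiples \<pi> - W"
        using golomb_neighbourhood W(2) by metis
      obtain w where "w \<noteq> 0" "b dvd w - z" "d dvd w - q"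
        using common_congruent_point[OF \<pi> nb b(1) q'(1) qz d(1,2)] by metis
      then show False using b(2) d(3) by blast
    qed
  qed
  then show ?thesis using that n by blast
qed

section \<open>From a homeomorphism to matched primes\<close>

text \<open>Continuity is asked only at elements prime to \<pi>: there the clopen sets recover the
  adic topology.\<close>

definition adically_continuous :: "('a::field poly \<Rightarrow> 'b::field poly) \<Rightarrow> 'a poly \<Rightarrow> 'b poly \<Rightarrow> bool" where
  "adically_continuous h \<pi> \<rho> \<longleftrightarrow> irreducible \<pi> \<and> irreducible \<rho> \<and>
     (\<forall>z. z \<noteq> 0 \<longrightarrow> (\<pi> dvd z \<longleftrightarrow> \<rho> dvd h z)) \<and>
     (\<forall>z n. \<not> \<pi> dvd z \<longrightarrow> (\<exists>k>0. \<forall>y. \<pi> ^ k dvd y - z \<longrightarrow> \<rho> ^ n dvd h y - h z))"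

text \<open>The interface through which a homeomorphism is used from here on. It is symmetric in
  \<open>h\<close> and \<open>g\<close> and leaves their values at 0 open.\<close>

definition golomb_equivalence :: "('a::field poly \<Rightarrow> 'b::field poly) \<Rightarrow> ('b poly \<Rightarrow> 'a poly) \<Rightarrow> bool" where
  "golomb_equivalence h g \<longleftrightarrow>
     (\<forall>x. x \<noteq> 0 \<longrightarrow> h x \<noteq> 0 \<and> g (h x) = x) \<and> (\<forall>y. y \<noteq> 0 \<longrightarrow> g y \<noteq> 0 \<and> h (g y) = y) \<and>
     (\<forall>x. x \<noteq> 0 \<longrightarrow> (h x dvd 1 \<longleftrightarrow> x dvd 1)) \<and>
     (\<forall>\<pi>. irreducible \<pi> \<longrightarrow> (\<exists>\<rho>. adically_continuous h \<pi> \<rho> \<and> adically_continuous g \<rho> \<pi>)) \<and>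
     (\<forall>\<rho>. irreducible \<rho> \<longrightarrow> (\<exists>\<pi>. adically_continuous h \<pi> \<rho> \<and> adically_continuous g \<rho> \<pi>))"

lemma golomb_equivalence_sym: "golomb_equivalence h g \<Longrightarrow> golomb_equivalence g h"
  unfolding golomb_equivalence_def by metis

text \<open>A unit \<open>x\<close> needs a second unit as partner, here \<open>[:c:] * x\<close>.
  Over the field with two elements there is none, which is why \<open>c\<close> appears.\<close>

lemma unit_iff_closures_meet_deep:
  fixes x :: "'a::field poly"
  assumes "(c :: 'a) \<noteq> 0" "c \<noteq> 1" "x \<noteq> 0"
  shows "x dvd 1 \<longleftrightarrow> (\<exists>y. y \<noteq> 0 \<and> y \<noteq> x \<and> closures_meet_deep golomb x y)"
proof
  assume x: "x dvd 1"
  have c: "[:c:] dvd 1" using assms(1) is_unit_iff_degree[of "[:c:]"] by simp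
  have "[:c:] \<noteq> 1" using assms(2) by (simp add: one_pCons)
  then have "[:c:] * x \<noteq> 1 * x" using assms(3) mult_right_cancel by blast
  then have ne: "x \<noteq> [:c:] * x" by (simp only: mult_1) (rule not_sym)
  have "[:c:] * x dvd 1" using mult_dvd_mono[OF c x] by (simp only: mult_1)
  then have "closures_meet_deep golomb x ([:c:] * x)" using closures_meet_deep_units[OF x _ ne] by blast
  moreover have "[:c:] * x \<noteq> 0" using assms by simp
  ultimately show "\<exists>y. y \<noteq> 0 \<and> y \<noteq> x \<and> closures_meet_deep golomb x y" using ne by metis
qed (use closures_meet_deep_imp_unit assms in blast)

lemma golomb_homeomorphism_units:
  fixes h :: "'a::field poly \<Rightarrow> 'b::field poly"
  assumes hom: "homeomorphic_maps golomb golomb h g"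
    and c: "(c :: 'a) \<noteq> 0" "c \<noteq> 1" and x: "x \<noteq> 0" "x dvd 1"
  shows "h x dvd 1"
proof -
  have top: "z \<in> topspace golomb \<longleftrightarrow> z \<noteq> 0" for z :: "'z::field poly"
    by (simp add: topspace_golomb_topology)
  obtain y where y: "y \<noteq> 0" "closures_meet_deep golomb x y"
    using unit_iff_closures_meet_deep[OF c] x by blast
  then have "closures_meet_deep golomb (h x) (h y)"
    using closures_meet_deep_image[OF hom] x(1) top by blast
  moreover have "h x \<in> topspace golomb"
    using hom x(1) top unfolding homeomorphic_maps_def continuous_map_def by blast
  ultimately show ?thesis using closures_meet_deep_imp_unit top by blast
qed

text \<open>A class modulo a power of \<rho> is clopen among the non-multiples of \<rho>. Its image
  under \<open>g\<close> is clopen among those of \<pi>, and therefore contains a \<pi>-adic ball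
  around each of its points.\<close>

lemma golomb_homeomorphism_adically_continuous:
  fixes h :: "'a::field poly \<Rightarrow> 'b::field poly"
  assumes hom: "homeomorphic_maps golomb golomb h g"
    and irr: "irreducible \<pi>" "irreducible \<rho>"
    and dvd: "\<And>z. z \<noteq> 0 \<Longrightarrow> \<pi> dvd z \<longleftrightarrow> \<rho> dvd h z"
  shows "adically_continuous h \<pi> \<rho>"
  unfolding adically_continuous_def
proof (intro conjI irr allI impI)
  fix z :: "'a poly" assume "z \<noteq> 0" then show "\<pi> dvd z \<longleftrightarrow> \<rho> dvd h z" by (rule dvd)
next
  fix z :: "'a poly" and n assume z: "\<not> \<pi> dvd z"
  have sym: "homeomorphic_maps golomb golomb g h" using hom homeomorphic_maps_sym by blast
  have h: "h w \<noteq> 0" "g (h w) = w" if "w \<noteq> 0" for w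
    using hom that unfolding homeomorphic_maps_def continuous_map_def
    by (auto simp: topspace_golomb_topology)
  have g: "g w \<noteq> 0" "h (g w) = w" if "w \<noteq> 0" for w
    using hom that unfolding homeomorphic_maps_def continuous_map_def
    by (auto simp: topspace_golomb_topology)
  have z0: "z \<noteq> 0" using z by auto
  \<comment> \<open>\<open>Suc n\<close> keeps the exponent positive when
    \<open>n = 0\<close>.\<close>
  define W where "W = {w. \<rho> ^ Suc n dvd w - h z}"
  have nh: "\<not> \<rho> dvd h z" using z z0 dvd by blast
  note W = openin_golomb_padic_class[OF irr(2) nh, of "Suc n", folded W_def, simplified]
  have W0: "w \<noteq> 0" if "w \<in> W" for w using openin_subset[OF W(1)] that by (auto simp: topspace_golomb_topology)
  have gA: "g ` non_multiples \<rho> = non_multiples \<pi>"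
  proof (intro equalityI subsetI)
    fix w assume "w \<in> g ` non_multiples \<rho>"
    then show "w \<in> non_multiples \<pi>" using g dvd by (auto simp: non_multiples_def)
  next
    fix w assume w: "w \<in> non_multiples \<pi>"
    then show "w \<in> g ` non_multiples \<rho>"
      using h dvd by (intro image_eqI[of _ _ "h w"]) (auto simp: non_multiples_def)
  qed
  have "inj_on g (non_multiples \<rho> \<union> W)"
    using g W0 by (intro inj_on_inverseI[of _ h]) (auto simp: non_multiples_def)
  then have "g ` (non_multiples \<rho> - W) = non_multiples \<pi> - g ` W"
    unfolding gA[symmetric] by (intro inj_on_image_set_diff[of g "non_multiples \<rho> \<union> W"]) auto
  then have op: "openin golomb (g ` W)" "openin golomb (non_multiples \<pi> - g ` W)"
    using homeomorphic_maps_closure_of(1)[OF sym W(1)] homeomorphic_maps_closure_of(1)[OF sym W(2)]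
    by auto
  have "h z \<in> W" unfolding W_def by simp
  then have "z \<in> g ` W" using h[OF z0] by (metis imageI)
  then obtain k where k: "k > 0" "\<And>y. \<pi> ^ k dvd y - z \<Longrightarrow> y \<in> g ` W"
    using relatively_clopen_padic_open[OF irr(1) op _ z] by metis
  have "\<rho> ^ n dvd h y - h z" if "\<pi> ^ k dvd y - z" for y
  proof -
    obtain w where "w \<in> W" "y = g w" using k(2)[OF \<open>\<pi> ^ k dvd y - z\<close>] by blast
    then have "h y \<in> W" using g(2) W0 by metis
    then have "\<rho> * \<rho> ^ n dvd h y - h z" unfolding W_def by simp
    then show ?thesis by (rule dvd_mult_right)
  qed
  then show "\<exists>k>0. \<forall>y. \<pi> ^ k dvd y - z \<longrightarrow> \<rho> ^ n dvd h y - h z" using k(1) by blast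
qed

text \<open>By \<open>closures_refine\<close> with the unit 1, \<open>h\<close> preserves the
  inclusion of prime supports among nonunits. Choosing a prime \<rho> of \<open>h \<pi>\<close>, the
  support of \<open>g \<rho>\<close> lies inside that of \<pi>, and minimality of the latter makes
  the supports of \<open>h \<pi>\<close> and \<rho> equal.\<close>

lemma golomb_homeomorphism_irreducible:
  fixes h :: "'a::field poly \<Rightarrow> 'b::field poly"
  assumes hom: "homeomorphic_maps golomb golomb h g"
    and un: "\<And>x. x \<noteq> 0 \<Longrightarrow> h x dvd 1 \<longleftrightarrow> x dvd 1"
    and \<pi>: "irreducible \<pi>"
  obtains \<rho> where "adically_continuous h \<pi> \<rho>" "adically_continuous g \<rho> \<pi>"
proof -
  have top: "z \<in> topspace golomb \<longleftrightarrow> z \<noteq> 0" for z :: "'z::field poly"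
    by (simp add: topspace_golomb_topology)
  have sym: "homeomorphic_maps golomb golomb g h" using hom homeomorphic_maps_sym by blast
  have h: "h w \<noteq> 0" "g (h w) = w" if "w \<noteq> 0" for w
    using hom that unfolding homeomorphic_maps_def continuous_map_def by (auto simp: top)
  have g: "g w \<noteq> 0" "h (g w) = w" if "w \<noteq> 0" for w
    using hom that unfolding homeomorphic_maps_def continuous_map_def by (auto simp: top)
  have refine: "closures_refine golomb 1 x y \<longleftrightarrow> closures_refine golomb (h 1) (h x) (h y)"
    if "x \<noteq> 0" "y \<noteq> 0" for x y
  proof
    assume "closures_refine golomb 1 x y"
    then show "closures_refine golomb (h 1) (h x) (h y)"
      by (intro closures_refine_image[OF hom]) (use that in \<open>auto simp: top\<close>)
  next
    assume "closures_refine golomb (h 1) (h x) (h y)"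
    then have "closures_refine golomb (g (h 1)) (g (h x)) (g (h y))"
      by (intro closures_refine_image[OF sym]) (use that h in \<open>auto simp: top\<close>)
    then show "closures_refine golomb 1 x y" using h that by simp
  qed
  have supp: "(\<forall>\<sigma>. irreducible \<sigma> \<longrightarrow> \<sigma> dvd y \<longrightarrow> \<sigma> dvd x) \<longleftrightarrow>
      (\<forall>\<sigma>. irreducible \<sigma> \<longrightarrow> \<sigma> dvd h y \<longrightarrow> \<sigma> dvd h x)"
    if "x \<noteq> 0" "y \<noteq> 0" "\<not> x dvd 1" "\<not> y dvd 1" for x y
    using closures_refine_golomb_iff[of 1 x y] closures_refine_golomb_iff[of "h 1" "h x" "h y"]
      refine[OF that(1,2)] un h that by (metis dvd_refl one_neq_zero)
  have \<pi>0: "\<pi> \<noteq> 0" "\<not> \<pi> dvd 1" using \<pi> irreducible_poly_nonzero irreducible_not_unit by auto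
  then obtain \<rho> where \<rho>: "irreducible \<rho>" "\<rho> dvd h \<pi>"
    using poly_irreducible_factor h un by metis
  have \<rho>0: "\<rho> \<noteq> 0" "\<not> \<rho> dvd 1" using \<rho> irreducible_poly_nonzero irreducible_not_unit by auto
  have g\<rho>: "g \<rho> \<noteq> 0" "\<not> g \<rho> dvd 1" "h (g \<rho>) = \<rho>" using g \<rho>0 un by metis+
  have assoc: "\<pi> dvd \<sigma>" if "irreducible \<sigma>" "\<sigma> dvd \<pi>" for \<sigma>
  proof -
    obtain \<tau> where \<tau>: "\<pi> = \<sigma> * \<tau>" using \<open>\<sigma> dvd \<pi>\<close> by blast
    then have "\<tau> dvd 1" using \<pi> \<open>irreducible \<sigma>\<close> irreducible_not_unit unfolding irreducible_def by metis
    then show ?thesis unfolding \<tau> by (simp add: mult_unit_dvd_iff)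
  qed
  have "\<sigma> dvd h \<pi>" if "irreducible \<sigma>" "\<sigma> dvd \<rho>" for \<sigma>
    using that \<rho>(2) dvd_trans by blast
  then have *: "\<forall>\<sigma>. irreducible \<sigma> \<longrightarrow> \<sigma> dvd g \<rho> \<longrightarrow> \<sigma> dvd \<pi>"
    using supp[OF \<pi>0(1) g\<rho>(1) \<pi>0(2) g\<rho>(2)] g\<rho>(3) by metis
  obtain \<sigma> where \<sigma>: "irreducible \<sigma>" "\<sigma> dvd g \<rho>" using poly_irreducible_factor g\<rho> by metis
  then have "\<pi> dvd g \<rho>" using * assoc dvd_trans by metis
  then have "\<forall>\<tau>. irreducible \<tau> \<longrightarrow> \<tau> dvd \<pi> \<longrightarrow> \<tau> dvd g \<rho>" using dvd_trans by blast
  then have **: "\<forall>\<tau>. irreducible \<tau> \<longrightarrow> \<tau> dvd h \<pi> \<longrightarrow> \<tau> dvd \<rho>"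
    using supp[OF g\<rho>(1) \<pi>0(1) g\<rho>(2) \<pi>0(2)] g\<rho>(3) by metis
  have key: "\<pi> dvd z \<longleftrightarrow> \<rho> dvd h z" if z: "z \<noteq> 0" for z
  proof (cases "z dvd 1")
    case True
    then show ?thesis using un[OF z] \<pi>0 \<rho>0 dvd_trans by metis
  next
    case False
    have "\<pi> dvd z \<longleftrightarrow> (\<forall>\<tau>. irreducible \<tau> \<longrightarrow> \<tau> dvd \<pi> \<longrightarrow> \<tau> dvd z)"
      using \<pi> dvd_trans dvd_refl by metis
    also have "\<dots> \<longleftrightarrow> (\<forall>\<tau>. irreducible \<tau> \<longrightarrow> \<tau> dvd h \<pi> \<longrightarrow> \<tau> dvd h z)"
      by (rule supp[OF z \<pi>0(1) False \<pi>0(2)])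
    also have "\<dots> \<longleftrightarrow> \<rho> dvd h z"
      using ** \<rho> dvd_trans by metis
    finally show ?thesis .
  qed
  have key': "\<rho> dvd y \<longleftrightarrow> \<pi> dvd g y" if "y \<noteq> 0" for y
    using key[of "g y"] g that by metis
  show ?thesis
    using that[OF golomb_homeomorphism_adically_continuous[OF hom \<pi> \<rho>(1) key]
      golomb_homeomorphism_adically_continuous[OF sym \<rho>(1) \<pi> key']] .
qed

lemma golomb_homeomorphism_equivalence:
  fixes h :: "'a::field poly \<Rightarrow> 'b::field poly"
  assumes hom: "homeomorphic_maps golomb golomb h g"
    and c: "(c :: 'a) \<noteq> 0" "c \<noteq> 1" and d: "(d :: 'b) \<noteq> 0" "d \<noteq> 1"
  shows "golomb_equivalence h g"
proof -
  have sym: "homeomorphic_maps golomb golomb g h" using hom homeomorphic_maps_sym by blast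
  have h: "h w \<noteq> 0" "g (h w) = w" if "w \<noteq> 0" for w
    using hom that unfolding homeomorphic_maps_def continuous_map_def
    by (auto simp: topspace_golomb_topology)
  have g: "g w \<noteq> 0" "h (g w) = w" if "w \<noteq> 0" for w
    using hom that unfolding homeomorphic_maps_def continuous_map_def
    by (auto simp: topspace_golomb_topology)
  have un: "h x dvd 1 \<longleftrightarrow> x dvd 1" if "x \<noteq> 0" for x
    using golomb_homeomorphism_units[OF hom c that] golomb_homeomorphism_units[OF sym d h(1)[OF that]]
      h(2)[OF that] by auto
  have un': "g x dvd 1 \<longleftrightarrow> x dvd 1" if "x \<noteq> 0" for x
    using un[of "g x"] g[OF that] by simp
  show ?thesis unfolding golomb_equivalence_def
    using h g un golomb_homeomorphism_irreducible[OF hom un]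
      golomb_homeomorphism_irreducible[OF sym un'] by (intro conjI allI impI; metis)
qed

section \<open>Cyclicity of torsion groups modulo a prime\<close>

text \<open>The bound on the number of roots over the quotient domain by \<pi>, with congruences in
  place of quotient elements: a root \<open>s0\<close> is split off, and primality passes the other
  roots to the quotient polynomial.\<close>

lemma card_roots_modulo_prime_le:
  fixes \<pi> :: "'a::idom" and f :: "'a poly"
  assumes prime: "\<And>a b. \<pi> dvd a * b \<Longrightarrow> \<pi> dvd a \<or> \<pi> dvd b"
    and "\<not> \<pi> dvd lead_coeff f" "finite S"
    and "\<And>s. s \<in> S \<Longrightarrow> \<pi> dvd poly f s"
    and "\<And>s t. s \<in> S \<Longrightarrow> t \<in> S \<Longrightarrow> s \<noteq> t \<Longrightarrow> \<not> \<pi> dvd s - t"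
  shows "card S \<le> degree f"
  using assms(2-)
proof (induction "degree f" arbitrary: f S)
  case 0
  then obtain c where "f = [:c:]" using degree_eq_zeroE by metis
  then have "S = {}" using 0(2,4) by auto
  then show ?case by simp
next
  case (Suc d)
  show ?case
  proof (cases "S = {}")
    case False
    then obtain s0 where s0: "s0 \<in> S" by blast
    define q where "q = synthetic_div f s0"
    have f: "[:- s0, 1:] * q + [:poly f s0:] = f" unfolding q_def by (rule synthetic_div_correct')
    have dq: "degree q = d" unfolding q_def using Suc(2) by (metis degree_synthetic_div diff_Suc_1)
    have "coeff f (Suc d) = coeff q d"
      by (subst f[symmetric]) (simp add: coeff_eq_0 dq)
    then have lc: "\<not> \<pi> dvd lead_coeff q" using Suc(2,3) dq by simp
    have "\<pi> dvd poly q s" if "s \<in> S - {s0}" for s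
    proof -
      have "poly f s = (s - s0) * poly q s + poly f s0"
        by (subst f[symmetric]) (simp add: algebra_simps)
      then have "\<pi> dvd (s - s0) * poly q s"
        using Suc(5)[of s] Suc(5)[OF s0] that by (metis DiffD1 dvd_add_left_iff)
      then show ?thesis using prime Suc(6) s0 that by blast
    qed
    then have "card (S - {s0}) \<le> degree q"
      using Suc(1)[of q "S - {s0}"] dq lc Suc(4,6) by simp
    then show ?thesis using Suc(2,4) s0 dq by simp
  qed simp
qed

lemma dvd_diff_mult_cong:
  fixes \<pi> :: "'a::comm_ring_1"
  assumes "\<pi> dvd a - b" "\<pi> dvd c - d"
  shows "\<pi> dvd a * c - b * d"
proof -
  have "a * c - b * d = a * (c - d) + (a - b) * d" by (simp add: algebra_simps)
  then show ?thesis using assms by (metis dvd_add dvd_mult dvd_mult2)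
qed

lemma dvd_diff_power_cong:
  fixes \<pi> :: "'a::comm_ring_1"
  shows "\<pi> dvd a - b \<Longrightarrow> \<pi> dvd a ^ n - b ^ n"
  by (induction n) (auto intro: dvd_diff_mult_cong)

lemma dvd_diff_trans:
  fixes \<pi> :: "'a::comm_ring_1"
  assumes "\<pi> dvd a - b" "\<pi> dvd b - c"
  shows "\<pi> dvd a - c"
  using dvd_add[OF assms] by simp

lemma dvd_diff_sym: "\<pi> dvd a - b \<Longrightarrow> \<pi> dvd b - a" for \<pi> :: "'a::comm_ring_1"
  by (metis dvd_minus_iff minus_diff_eq)

text \<open>The case \<open>\<pi> = 0\<close> is the cyclicity of finite groups of roots of unity in an integral domain.\<close>

lemma torsion_modulo_prime_cyclic:
  fixes \<pi> :: "'a::idom"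
  assumes prime: "\<And>a b. \<pi> dvd a * b \<Longrightarrow> \<pi> dvd a \<or> \<pi> dvd b" "\<not> \<pi> dvd 1"
    and T: "1 \<in> T" "\<And>x y. x \<in> T \<Longrightarrow> y \<in> T \<Longrightarrow> x * y \<in> T"
    and e: "e > 0" "\<And>x. x \<in> T \<Longrightarrow> \<pi> dvd x ^ e - 1"
  obtains g where "g \<in> T" "\<And>x. x \<in> T \<Longrightarrow> \<exists>s. \<pi> dvd x - g ^ s"
proof -
  define od where "od x = (LEAST d. d > 0 \<and> \<pi> dvd x ^ d - 1)" for x
  have Tpow: "x ^ i \<in> T" if "x \<in> T" for x i by (induction i) (use that T in auto)
  have od: "od x > 0" "\<pi> dvd x ^ od x - 1" if "x \<in> T" for x
    unfolding od_def using LeastI[of "\<lambda>d. d > 0 \<and> \<pi> dvd x ^ d - 1" e] e(1) e(2)[OF that] by auto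
  have od_le: "od x \<le> m" if "m > 0" "\<pi> dvd x ^ m - 1" for x m
    unfolding od_def by (rule Least_le) (use that in simp)
  have od_dvd: "\<pi> dvd x ^ m - 1 \<longleftrightarrow> od x dvd m" if x: "x \<in> T" for x m
  proof
    assume m: "\<pi> dvd x ^ m - 1"
    define q r where "q = m div od x" and "r = m mod od x"
    have "m = od x * q + r" unfolding q_def r_def by simp
    then have eq: "x ^ m = (x ^ od x) ^ q * x ^ r" by (simp add: power_add power_mult)
    have "\<pi> dvd (x ^ od x) ^ q * x ^ r - 1 ^ q * x ^ r"
      by (intro dvd_diff_mult_cong dvd_diff_power_cong od(2)[OF x]) simp
    then have "\<pi> dvd x ^ m - x ^ r" unfolding eq by simp
    then have "\<pi> dvd x ^ r - x ^ m" by (rule dvd_diff_sym)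
    then have "\<pi> dvd x ^ r - 1" using m dvd_diff_trans by blast
    moreover have "r < od x" unfolding r_def using od(1)[OF x] by simp
    ultimately have "r = 0" using od_le[of r x] by (cases "r = 0") auto
    then show "od x dvd m" unfolding r_def by auto
  next
    assume "od x dvd m"
    then obtain q where "m = od x * q" by blast
    then show "\<pi> dvd x ^ m - 1"
      using dvd_diff_power_cong[OF od(2)[OF x], of q] by (simp add: power_mult)
  qed
  have ndvd: "\<not> \<pi> dvd x" if "x \<in> T" for x
  proof
    assume "\<pi> dvd x"
    then have "\<pi> dvd x ^ e" using e(1) by (metis dvd_power dvd_trans)
    then have "\<pi> dvd x ^ e - (x ^ e - 1)" using e(2)[OF that] by (rule dvd_diff)
    then show False using prime(2) by simp
  qed
  have "od ` T \<subseteq> {..e}" using od_le e by auto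
  then have fin: "finite (od ` T)" using finite_subset by blast
  then have "Max (od ` T) \<in> od ` T" using T(1) by (intro Max_in) auto
  then obtain g where g: "g \<in> T" "Max (od ` T) = od g" by auto
  have max: "od x \<le> od g" if "x \<in> T" for x
    using Max_ge[OF fin, of "od x"] that g(2) by simp
  define n where "n = od g"
  have n0: "n > 0" unfolding n_def using od(1)[OF g(1)] .
  \<comment> \<open>If the order \<open>f\<close> of \<open>x\<close> did not divide the maximal
    order \<open>n\<close>, some prime \<open>r\<close> would have a larger exponent
    \<open>k\<close> in \<open>f\<close> than its exponent \<open>v\<close> in \<open>n\<close>.
    Then \<open>g ^ (r ^ v)\<close> and \<open>x ^ f1\<close> have coprime orders \<open>n1\<close>
    and \<open>r ^ k\<close>, and the order of their product exceeds \<open>n\<close>.\<close>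
  have all: "\<pi> dvd x ^ n - 1" if x: "x \<in> T" for x
  proof (rule ccontr)
    assume "\<not> \<pi> dvd x ^ n - 1"
    then have nd: "\<not> od x dvd n" using od_dvd[OF x] by blast
    define f where "f = od x"
    have f0: "f > 0" unfolding f_def using od(1)[OF x] .
    obtain r where r: "prime r" "multiplicity r n < multiplicity r f"
      using nd multiplicity_le_imp_dvd[of f n] f0 unfolding f_def by (metis not_le neq0_conv)
    define v k where "v = multiplicity r n" and "k = multiplicity r f"
    obtain n1 where n1: "n = r ^ v * n1" "\<not> r dvd n1"
      using multiplicity_decompose'[of n r] n0 r(1) unfolding v_def
      by (metis not_prime_unit neq0_conv)
    obtain f1 where f1: "f = r ^ k * f1" "\<not> r dvd f1"
      using multiplicity_decompose'[of f r] f0 r(1) unfolding k_def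
      by (metis not_prime_unit neq0_conv)
    have cop: "coprime (r ^ k) n1" using r(1) n1(2) by (simp add: prime_imp_coprime)
    define a b where "a = g ^ (r ^ v)" and "b = x ^ f1"
    have aT: "a \<in> T" and bT: "b \<in> T" unfolding a_def b_def using Tpow g(1) x by auto
    have a: "\<pi> dvd a ^ m - 1 \<longleftrightarrow> n1 dvd m" for m
      using od_dvd[OF g(1), of "r ^ v * m"] n1 r(1) unfolding n_def[symmetric] a_def
      by (simp add: power_mult prime_gt_0_nat)
    have b: "\<pi> dvd b ^ m - 1 \<longleftrightarrow> r ^ k dvd m" for m
    proof -
      have "f1 > 0" using f1(1) f0 by (cases f1) auto
      then show ?thesis using od_dvd[OF x, of "f1 * m"] f1(1) unfolding f_def[symmetric] b_def
        by (simp add: power_mult mult.commute)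
    qed
    have key: "n1 * r ^ k dvd m" if m: "\<pi> dvd (a * b) ^ m - 1" for m
    proof -
      have "\<pi> dvd (a * b) ^ (m * n1) - 1" "\<pi> dvd (a * b) ^ (m * r ^ k) - 1"
        using dvd_diff_power_cong[OF m] by (simp_all add: power_mult)
      moreover have "\<pi> dvd a ^ (m * n1) - 1" "\<pi> dvd b ^ (m * r ^ k) - 1" using a b by auto
      ultimately have *: "\<pi> dvd 1 * b ^ (m * n1) - 1" "\<pi> dvd a ^ (m * r ^ k) * 1 - 1"
      proof -
        assume A: "\<pi> dvd (a * b) ^ (m * n1) - 1" "\<pi> dvd (a * b) ^ (m * r ^ k) - 1"
          "\<pi> dvd a ^ (m * n1) - 1" "\<pi> dvd b ^ (m * r ^ k) - 1"
        have "\<pi> dvd 1 * b ^ (m * n1) - a ^ (m * n1) * b ^ (m * n1)"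
          by (intro dvd_diff_mult_cong dvd_diff_sym[OF A(3)]) simp
        then show "\<pi> dvd 1 * b ^ (m * n1) - 1"
          using A(1) dvd_diff_trans by (metis power_mult_distrib)
        have "\<pi> dvd a ^ (m * r ^ k) * 1 - a ^ (m * r ^ k) * b ^ (m * r ^ k)"
          by (intro dvd_diff_mult_cong dvd_diff_sym[OF A(4)]) simp
        then show "\<pi> dvd a ^ (m * r ^ k) * 1 - 1"
          using A(2) dvd_diff_trans by (metis power_mult_distrib)
      qed
      then have "r ^ k dvd m * n1" "n1 dvd m * r ^ k" using a b by auto
      then have "r ^ k dvd m" "n1 dvd m"
        using cop by (auto simp: coprime_dvd_mult_left_iff coprime_commute)
      then show ?thesis using cop divides_mult coprime_commute by metis
    qed
    have abT: "a * b \<in> T" using T(2) aT bT by blast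
    have "n1 * r ^ k dvd od (a * b)" using key od(2)[OF abT] by blast
    then have "n1 * r ^ k \<le> od (a * b)" by (rule dvd_imp_le[OF _ od(1)[OF abT]])
    then have "n1 * r ^ k \<le> n" using max[OF abT] unfolding n_def by simp
    moreover have "n1 > 0" using n1(1) n0 by (cases n1) auto
    then have "n1 * r ^ v < n1 * r ^ k"
      using r(2) power_strict_increasing[OF r(2) prime_gt_1_nat[OF r(1)]]
      unfolding v_def k_def by simp
    ultimately show False using n1(1) by (simp add: mult.commute)
  qed
  have inc: "\<not> \<pi> dvd g ^ i - g ^ j" if "i < j" "j < n" for i j
  proof
    assume "\<pi> dvd g ^ i - g ^ j"
    moreover have "g ^ j = g ^ i * g ^ (j - i)" using that(1) by (simp add: power_add[symmetric])
    ultimately have "\<pi> dvd g ^ i * (1 - g ^ (j - i))" by (simp add: right_diff_distrib)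
    then have "\<pi> dvd 1 - g ^ (j - i)" using prime(1) ndvd[OF Tpow[OF g(1)]] by blast
    then have "\<pi> dvd g ^ (j - i) - 1" by (rule dvd_diff_sym)
    then have "n dvd j - i" using od_dvd[OF g(1)] unfolding n_def by simp
    then show False using that by (auto dest: dvd_imp_le)
  qed
  \<comment> \<open>The powers of \<open>g\<close> already provide \<open>n\<close> incongruent
    roots of X^n - 1, so there is no room for another one.\<close>
  have "\<exists>s. \<pi> dvd x - g ^ s" if x: "x \<in> T" for x
  proof (rule ccontr)
    assume no: "\<nexists>s. \<pi> dvd x - g ^ s"
    define G where "G = (\<lambda>i. g ^ i) ` {..<n}"
    have xG: "x \<notin> G" using no unfolding G_def by (metis diff_self dvd_0_right imageE)
    have "inj_on (\<lambda>i. g ^ i) {..<n}"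
    proof (rule inj_onI)
      fix i j assume ij: "i \<in> {..<n}" "j \<in> {..<n}" "g ^ i = g ^ j"
      then have "\<pi> dvd g ^ i - g ^ j" "\<pi> dvd g ^ j - g ^ i" by auto
      then show "i = j" using inc[of i j] inc[of j i] ij by (metis lessThan_iff linorder_neqE_nat)
    qed
    then have cG: "card G = n" unfolding G_def by (simp add: card_image)
    have finG: "finite G" unfolding G_def by simp
    define f :: "'a poly" where "f = monom 1 n - 1"
    have df: "degree f = n" "lead_coeff f = 1"
    proof -
      have "degree f = degree (monom (1 :: 'a) n)" unfolding f_def
        using n0 by (metis degree_1 degree_add_eq_left degree_minus degree_monom_eq diff_conv_add_uminus one_neq_zero)
      then show "degree f = n" by (simp add: degree_monom_eq)
      then show "lead_coeff f = 1" unfolding f_def using n0 by simp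
    qed
    have "card (insert x G) \<le> degree f"
    proof (rule card_roots_modulo_prime_le[OF prime(1)])
      fix s assume "s \<in> insert x G"
      then have "s \<in> T" using x Tpow[OF g(1)] unfolding G_def by auto
      then show "\<pi> dvd poly f s" using all unfolding f_def by (simp add: poly_monom)
    next
      fix s t assume st: "s \<in> insert x G" "t \<in> insert x G" "s \<noteq> t"
      show "\<not> \<pi> dvd s - t"
      proof
        assume d: "\<pi> dvd s - t"
        consider "s = x" "t \<in> G" | "s \<in> G" "t = x" | "s \<in> G" "t \<in> G" using st by auto
        then show False
        proof cases
          case 3
          then obtain i j where "s = g ^ i" "t = g ^ j" "i < n" "j < n" unfolding G_def by auto
          then show False using inc[of i j] inc[of j i] d dvd_diff_sym[OF d] st(3)
            by (metis linorder_neqE_nat)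
        qed (use no d dvd_diff_sym[OF d] in \<open>auto simp: G_def\<close>)
      qed
    qed (use df finG prime(2) in auto)
    then show False using xG finG cG df by simp
  qed
  then show ?thesis using that g(1) by blast
qed

section \<open>Fields all of whose units have finite order\<close>

text \<open>Being algebraic over a finite prime field, put in a form that names no characteristic:
  for K' the property is obtained long before the characteristic is known.\<close>

definition torsion_field :: "'a::field itself \<Rightarrow> bool" where
  "torsion_field _ \<longleftrightarrow> (\<forall>x::'a. x \<noteq> 0 \<longrightarrow> (\<exists>n>0. x ^ n = 1))"

text \<open>The finite subrings of a field are its finite subfields, so closure under inverses is
  not asked for.\<close>

definition subring_set :: "'a::comm_ring_1 set \<Rightarrow> bool" where
  "subring_set F \<longleftrightarrow> 1 \<in> F \<and> (\<forall>x\<in>F. \<forall>y\<in>F. x - y \<in> F \<and> x * y \<in> F)"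

lemma subring_setD:
  assumes "subring_set F"
  shows "1 \<in> F" "0 \<in> F" "x \<in> F \<Longrightarrow> y \<in> F \<Longrightarrow> x - y \<in> F" "x \<in> F \<Longrightarrow> y \<in> F \<Longrightarrow> x * y \<in> F"
    "x \<in> F \<Longrightarrow> - x \<in> F" "x \<in> F \<Longrightarrow> y \<in> F \<Longrightarrow> x + y \<in> F" "x \<in> F \<Longrightarrow> x ^ n \<in> F"
proof -
  show 1: "1 \<in> F" and 2: "\<And>x y. x \<in> F \<Longrightarrow> y \<in> F \<Longrightarrow> x - y \<in> F"
    and 3: "\<And>x y. x \<in> F \<Longrightarrow> y \<in> F \<Longrightarrow> x * y \<in> F"
    using assms unfolding subring_set_def by auto
  show 0: "0 \<in> F" using 2[OF 1 1] by simp
  show 4: "\<And>x. x \<in> F \<Longrightarrow> - x \<in> F" using 2[OF 0] by simp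
  show "\<And>x y. x \<in> F \<Longrightarrow> y \<in> F \<Longrightarrow> x + y \<in> F" using 2 4 by (metis diff_minus_eq_add)
  show "x \<in> F \<Longrightarrow> x ^ n \<in> F" by (induction n) (use 1 3 in auto)
qed

lemma subring_set_sum: "subring_set F \<Longrightarrow> (\<And>i. i \<in> A \<Longrightarrow> f i \<in> F) \<Longrightarrow> (\<Sum>i\<in>A. f i) \<in> F"
  by (induction A rule: infinite_finite_induct) (auto intro: subring_setD)

lemma subring_set_range_of_int: "subring_set (range (of_int :: int \<Rightarrow> 'a::comm_ring_1))"
  unfolding subring_set_def by (metis (no_types, lifting) imageE of_int_1 of_int_diff of_int_mult rangeI)

lemma finite_powers_imp_torsion:
  fixes x :: "'a::field"
  assumes "finite F" "\<And>n. x ^ n \<in> F" "x \<noteq> 0"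
  obtains n where "n > 0" "x ^ n = 1"
proof -
  have "\<not> inj (\<lambda>n. x ^ n)"
  proof
    assume "inj (\<lambda>n. x ^ n)"
    then have "infinite (range (\<lambda>n. x ^ n))" by (simp add: range_inj_infinite)
    then show False using assms(1,2) finite_subset[of "range (\<lambda>n. x ^ n)" F] by auto
  qed
  then obtain i j where "i \<noteq> j" "x ^ i = x ^ j" unfolding inj_def by blast
  then have "\<exists>i j. i < j \<and> x ^ i = x ^ j" by (metis linorder_neqE_nat)
  then obtain i j where ij: "i < j" "x ^ i = x ^ j" by blast
  have "x ^ j = x ^ i * x ^ (j - i)" using ij(1) by (metis le_add_diff_inverse less_imp_le power_add)
  then have "x ^ i * x ^ (j - i) = x ^ i * 1" using ij(2) by simp
  then have "x ^ (j - i) = 1" using assms(3) by simp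
  then show ?thesis using that[of "j - i"] ij(1) by simp
qed

lemma coeff_mod_monic_in_subring:
  fixes f z :: "'a::field poly"
  assumes F: "subring_set F" and f: "lead_coeff f = 1" "\<And>i. coeff f i \<in> F"
    and z: "\<And>i. coeff z i \<in> F"
  shows "coeff (z mod f) i \<in> F"
  using z
proof (induction "degree z" arbitrary: z rule: less_induct)
  case less
  have f0: "f \<noteq> 0" using f(1) by auto
  consider "degree z < degree f" | "degree f = 0" | "degree f \<le> degree z" "degree f > 0" by linarith
  then show ?case
  proof cases
    case 1
    then show ?thesis using less(2) by (simp add: mod_poly_less)
  next
    case 2
    then have "f = 1" using f(1) by (metis degree_eq_zeroE lead_coeff_pCons(2) one_pCons coeff_pCons_0)
    then show ?thesis using subring_setD(2)[OF F] by simp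
  next
    case 3
    define k where "k = degree z - degree f"
    define m where "m = monom (lead_coeff z) k * f"
    have dz: "degree z > 0" using 3 by linarith
    then have "lead_coeff z \<noteq> 0" by auto
    then have "degree m = degree z" unfolding m_def k_def using f0 3
      by (simp add: degree_mult_eq degree_monom_eq)
    moreover have "coeff m (degree z) = lead_coeff z"
      unfolding m_def k_def using 3 f(1) by (simp add: coeff_monom_mult)
    ultimately have "degree (z - m) < degree z"
      using dz by (metis degree_diff_le_max degree_0 diff_self coeff_diff le_neq_implies_less
          leading_coeff_0_iff max.idem)
    moreover have "coeff (z - m) j \<in> F" for j
      unfolding m_def coeff_diff coeff_monom_mult
      using less(2) f(2) subring_setD[OF F] by simp
    ultimately have "coeff ((z - m) mod f) i \<in> F" using less(1) by blast
    moreover have "(z - m) mod f = z mod f" unfolding m_def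
      by (metis add_diff_cancel_left' add_diff_eq diff_add_cancel mod_mult_self2 mult.commute)
    ultimately show ?thesis by simp
  qed
qed

lemma finite_bounded_polys:
  assumes "finite F"
  shows "finite {r :: 'a::field poly. degree r \<le> d \<and> (\<forall>i. coeff r i \<in> F)}"
proof -
  have "{r :: 'a poly. degree r \<le> d \<and> (\<forall>i. coeff r i \<in> F)} \<subseteq>
      Poly ` {xs. set xs \<subseteq> F \<and> length xs \<le> Suc d}"
  proof
    fix r :: "'a poly" assume r: "r \<in> {r. degree r \<le> d \<and> (\<forall>i. coeff r i \<in> F)}"
    have "set (coeffs r) \<subseteq> F" using r by (auto simp: coeffs_def)
    moreover have "length (coeffs r) \<le> Suc d" using r by (cases "r = 0") (auto simp: length_coeffs)
    ultimately show "r \<in> Poly ` {xs. set xs \<subseteq> F \<and> length xs \<le> Suc d}"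
      by (intro image_eqI[of _ _ "coeffs r"]) auto
  qed
  then show ?thesis using finite_lists_length_le[OF assms] finite_subset by blast
qed

text \<open>The set is the ring F[x]. Dividing by the monic \<open>f\<close> stays over
  \<open>F\<close>, so only the finitely many polynomials over \<open>F\<close> of degree at most
  \<open>degree f\<close> contribute values.\<close>

lemma algebraic_over_finite_subring_powers:
  fixes x :: "'a::field"
  assumes F: "subring_set F" "finite F" and f: "lead_coeff f = 1" "\<And>i. coeff f i \<in> F" "poly f x = 0"
  shows "finite {poly g x | g. \<forall>i. coeff g i \<in> F}"
proof -
  let ?R = "{r :: 'a poly. degree r \<le> degree f \<and> (\<forall>i. coeff r i \<in> F)}"
  have "{poly g x | g. \<forall>i. coeff g i \<in> F} \<subseteq> (\<lambda>r. poly r x) ` ?R"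
  proof
    fix y assume "y \<in> {poly g x | g. \<forall>i. coeff g i \<in> F}"
    then obtain g where g: "y = poly g x" "\<And>i. coeff g i \<in> F" by blast
    have "poly (g div f * f + g mod f) x = poly (g mod f) x"
      using f(3) by (simp only: poly_add poly_mult) simp
    then have "y = poly (g mod f) x" using g(1) by simp
    moreover have "f \<noteq> 0" using f(1) by auto
    then have "degree (g mod f) \<le> degree f" using degree_mod_less[of f g] by force
    ultimately show "y \<in> (\<lambda>r. poly r x) ` ?R"
      using coeff_mod_monic_in_subring[OF F(1) f(1,2) g(2)] by blast
  qed
  then show ?thesis using finite_bounded_polys[OF F(2)] finite_subset by blast
qed

lemma subring_set_poly_values:
  assumes F: "subring_set F"
  shows "subring_set {poly g x | g. \<forall>i. coeff g i \<in> F}" (is "subring_set ?R")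
    "F \<subseteq> {poly g x | g. \<forall>i. coeff g i \<in> F}" "x \<in> {poly g x | g. \<forall>i. coeff g i \<in> F}"
proof -
  have const: "\<And>i. coeff [:c:] i \<in> F" if "c \<in> F" for c
    using that subring_setD(2)[OF F] by (simp add: coeff_pCons split: nat.splits)
  show "F \<subseteq> ?R"
  proof
    fix c assume "c \<in> F"
    then show "c \<in> ?R" using const[of c] by (intro CollectI exI[of _ "[:c:]"]) simp
  qed
  then have "1 \<in> ?R" using subring_setD(1)[OF F] by blast
  moreover have "poly g x - poly h x \<in> ?R" "poly g x * poly h x \<in> ?R"
    if "\<forall>i. coeff g i \<in> F" "\<forall>i. coeff h i \<in> F" for g h
  proof -
    have *: "\<forall>i. coeff (g - h) i \<in> F" "\<forall>i. coeff (g * h) i \<in> F"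
      using that by (auto simp: coeff_mult intro!: subring_set_sum[OF F] subring_setD[OF F])
    show "poly g x - poly h x \<in> ?R" using *(1) by (intro CollectI exI[of _ "g - h"]) simp
    show "poly g x * poly h x \<in> ?R" using *(2) by (intro CollectI exI[of _ "g * h"]) simp
  qed
  ultimately show "subring_set ?R" unfolding subring_set_def by auto
  have "coeff [:0, 1:] i \<in> F" for i
    using subring_setD(1,2)[OF F] by (auto simp: coeff_pCons split: nat.splits)
  then show "x \<in> ?R" by (intro CollectI exI[of _ "[:0, 1:]"]) simp
qed

lemma algebraic_over_GF_torsion:
  assumes "algebraic_over_GF p TYPE('a::field)" "p > 0"
  shows "torsion_field TYPE('a)"
  unfolding torsion_field_def
proof (intro allI impI)
  fix x :: 'a assume x: "x \<noteq> 0"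
  let ?F = "range (of_int :: int \<Rightarrow> 'a)"
  have char: "CHAR('a) = p" using assms unfolding algebraic_over_GF_def by blast
  have F: "subring_set ?F" by (rule subring_set_range_of_int)
  have "card ?F > 0" using card_range_of_int[OF char assms(2)] assms(2) by simp
  then have fin: "finite ?F" by (rule card_ge_0_finite)
  have "algebraic_over ?F x" using assms(1) unfolding algebraic_over_GF_def by simp
  then obtain q where q: "q \<noteq> 0" "\<forall>i. coeff q i \<in> ?F" "poly q x = 0"
    unfolding algebraic_over_def by auto
  have q2: "coeff q i \<in> ?F" for i using q(2) by simp
  have lc: "lead_coeff q \<noteq> 0" using q(1) by simp
  obtain n where n: "n > 0" "lead_coeff q ^ n = 1"
    by (rule finite_powers_imp_torsion[OF fin subring_setD(7)[OF F q2] lc])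
  \<comment> \<open>The inverse of the leading coefficient is a power of it, so the monic multiple
    keeps its coefficients in the prime field.\<close>
  define f where "f = smult (lead_coeff q ^ (n - 1)) q"
  have "lead_coeff q ^ (n - 1) * lead_coeff q = 1" using n by (metis power_minus_mult)
  then have "lead_coeff f = 1" by (simp only: f_def lead_coeff_smult)
  moreover have "\<And>i. coeff f i \<in> ?F" unfolding f_def coeff_smult
    by (intro subring_setD(4,7)[OF F] q2)
  moreover have "poly f x = 0" unfolding f_def using q(3) by simp
  ultimately have fin': "finite {poly g x | g. \<forall>i. coeff g i \<in> ?F}"
    by (rule algebraic_over_finite_subring_powers[OF F fin])
  show "\<exists>n>0. x ^ n = 1"
    using finite_powers_imp_torsion[OF fin'
      subring_setD(7)[OF subring_set_poly_values(1)[OF F] subring_set_poly_values(3)[OF F]] x]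
    by metis
qed

text \<open>In characteristic 0 the element 2 would be a root of unity.\<close>

lemma torsion_field_char_pos:
  assumes "torsion_field TYPE('a::field)"
  shows "CHAR('a) > 0"
proof (rule ccontr)
  assume "\<not> CHAR('a) > 0"
  then have char: "CHAR('a) = 0" by simp
  then have "(of_nat 2 :: 'a) \<noteq> 0" by (simp only: of_nat_eq_0_iff_char_dvd) simp
  then obtain n where n: "n > 0" "(of_nat 2 :: 'a) ^ n = 1"
    using assms unfolding torsion_field_def by blast
  then have "(of_nat (2 ^ n) :: 'a) = of_nat 1" by simp
  then have "[2 ^ n = (1 :: nat)] (mod 0)" using of_nat_eq_iff_cong_CHAR[where 'a='a, of "2 ^ n" 1] char by simp
  then show False using n(1) by (simp add: cong_def)
qed

lemma torsion_field_prime_char: "torsion_field TYPE('a::field) \<Longrightarrow> prime CHAR('a)"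
  using torsion_field_char_pos prime_CHAR_semidom by blast

text \<open>Elements are adjoined one at a time to the prime field; a nonzero \<open>x\<close> is a
  root of the monic polynomial X^n - 1.\<close>

lemma torsion_field_finite_subring:
  assumes K: "torsion_field TYPE('a::field)" and "finite (S :: 'a set)"
  obtains F where "finite F" "subring_set F" "S \<subseteq> F"
  using assms(2)
proof (induction S arbitrary: thesis)
  case empty
  have "card (range (of_int :: int \<Rightarrow> 'a)) > 0"
    using card_range_of_int torsion_field_char_pos[OF K] by metis
  then have "finite (range (of_int :: int \<Rightarrow> 'a))" by (rule card_ge_0_finite)
  then show ?case using empty subring_set_range_of_int by blast
next
  case (insert x S)
  obtain F where F: "finite F" "subring_set F" "S \<subseteq> F" using insert.IH by blast
  show ?case
  proof (cases "x = 0")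
    case True
    then show ?thesis using insert.prems[of F] F subring_setD(2)[OF F(2)] by blast
  next
    case False
    then obtain n where n: "n > 0" "x ^ n = 1" using K unfolding torsion_field_def by blast
    define f :: "'a poly" where "f = monom 1 n - 1"
    have "degree f = degree (monom (1 :: 'a) n)" unfolding f_def
      using n by (metis degree_1 degree_add_eq_left degree_minus degree_monom_eq diff_conv_add_uminus one_neq_zero)
    then have "lead_coeff f = 1" unfolding f_def using n by (simp add: degree_monom_eq)
    moreover have "\<And>i. coeff f i \<in> F" unfolding f_def using subring_setD[OF F(2)] by simp
    moreover have "poly f x = 0" unfolding f_def using n by (simp add: poly_monom)
    ultimately have "finite {poly g x | g. \<forall>i. coeff g i \<in> F}"
      by (rule algebraic_over_finite_subring_powers[OF F(2,1)])
    moreover have "insert x S \<subseteq> {poly g x | g. \<forall>i. coeff g i \<in> F}"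
      using subring_set_poly_values(2,3)[OF F(2)] F(3) by blast
    ultimately show ?thesis using insert.prems subring_set_poly_values(1)[OF F(2)] by blast
  qed
qed

text \<open>\<open>z\<close> and the monic multiple of \<open>f\<close> have coefficients in a
  common finite subring, so the powers of \<open>z\<close> have finitely many remainders;
  comaximality cancels the smaller of two congruent powers.\<close>

lemma torsion_field_residue_torsion:
  fixes f z :: "'a::field poly"
  assumes K: "torsion_field TYPE('a)" and f: "f \<noteq> 0" and co: "comaximal z f"
  obtains e where "e > 0" "f dvd z ^ e - 1"
proof -
  define f' where "f' = smult (inverse (lead_coeff f)) f"
  have f': "lead_coeff f' = 1" "f' \<noteq> 0" unfolding f'_def using f by auto
  have ff': "f dvd f'" "f' dvd f" unfolding f'_def using f by (auto simp: dvd_smult_iff smult_dvd_iff)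
  have "finite (range (coeff f') \<union> range (coeff z))"
    by (metis finite_UnI range_coeff finite_insert finite_set)
  then obtain F where F: "finite F" "subring_set F" "range (coeff f') \<union> range (coeff z) \<subseteq> F"
    using torsion_field_finite_subring[OF K] by metis
  let ?R = "{r :: 'a poly. degree r \<le> degree f' \<and> (\<forall>i. coeff r i \<in> F)}"
  have zF: "coeff (z ^ n) i \<in> F" for n i
  proof (induction n arbitrary: i)
    case 0
    then show ?case using subring_setD(1,2)[OF F(2)] by simp
  next
    case (Suc n)
    then show ?case using F(3)
      by (auto simp: coeff_mult intro!: subring_set_sum[OF F(2)] subring_setD(4)[OF F(2)])
  qed
  have f'F: "coeff f' i \<in> F" for i using F(3) by auto
  have "z ^ n mod f' \<in> ?R" for n
  proof (intro CollectI conjI allI)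
    show "degree (z ^ n mod f') \<le> degree f'" using degree_mod_less[OF f'(2), of "z ^ n"] by auto
    show "coeff (z ^ n mod f') i \<in> F" for i
      by (rule coeff_mod_monic_in_subring[OF F(2) f'(1) f'F zF])
  qed
  then have "range (\<lambda>n. z ^ n mod f') \<subseteq> ?R" by blast
  then have "finite (range (\<lambda>n. z ^ n mod f'))" using finite_bounded_polys[OF F(1)] finite_subset by blast
  then have "\<not> inj (\<lambda>n. z ^ n mod f')" using range_inj_infinite by blast
  then obtain i j where "i \<noteq> j" "z ^ i mod f' = z ^ j mod f'" unfolding inj_def by blast
  then have "\<exists>i j. i < j \<and> z ^ i mod f' = z ^ j mod f'" by (metis linorder_neqE_nat)
  then obtain i j where ij: "i < j" "z ^ i mod f' = z ^ j mod f'" by blast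
  have "f' dvd z ^ j - z ^ i" using ij(2) by (metis mod_eq_dvd_iff)
  moreover have "z ^ j - z ^ i = z ^ i * (z ^ (j - i) - 1)"
    using ij(1) by (simp add: right_diff_distrib power_add[symmetric])
  ultimately have "f dvd z ^ i * (z ^ (j - i) - 1)" using ff' dvd_trans by metis
  moreover have "comaximal f (z ^ i)" using co comaximal_commute comaximal_power_left by metis
  ultimately have "f dvd z ^ (j - i) - 1" using comaximal_dvd_multD by blast
  then show ?thesis using that[of "j - i"] ij(1) by simp
qed

section \<open>Roots of unity as limits\<close>

lemma irreducible_poly_degree_1:
  fixes f :: "'a::field poly"
  assumes "degree f = 1"
  shows "irreducible f"
  unfolding irreducible_def
proof (intro conjI allI impI)
  show f0: "f \<noteq> 0" using assms by auto
  show "\<not> f dvd 1" using assms f0 is_unit_iff_degree[of f] by simp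
  fix a b assume ab: "f = a * b"
  then have "a \<noteq> 0" "b \<noteq> 0" using f0 by auto
  then have "degree a + degree b = 1" using assms ab by (simp add: degree_mult_eq)
  then have "degree a = 0 \<or> degree b = 0" by linarith
  then show "a dvd 1 \<or> b dvd 1" using \<open>a \<noteq> 0\<close> \<open>b \<noteq> 0\<close> is_unit_iff_degree by blast
qed

lemma irreducible_poly_dvd_irreducible:
  fixes \<sigma> \<pi> :: "'a::field poly"
  assumes "irreducible \<sigma>" "irreducible \<pi>" "\<sigma> dvd \<pi>"
  shows "\<pi> dvd \<sigma>"
proof -
  obtain \<tau> where \<tau>: "\<pi> = \<sigma> * \<tau>" using assms(3) by blast
  then have "\<sigma> dvd 1 \<or> \<tau> dvd 1" using assms(2) unfolding irreducible_def by simp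
  then have "\<tau> dvd 1" using irreducible_not_unit[OF assms(1)] by simp
  then show ?thesis unfolding \<tau> by (simp add: mult_unit_dvd_iff)
qed

text \<open>Multiplication by \<open>v\<close> permutes \<open>T\<close>; compare the products of
  all elements before and after.\<close>

lemma finite_mult_closed_power_card:
  fixes T :: "'a::idom set"
  assumes fin: "finite T" and nz: "0 \<notin> T" and mult: "\<And>v w. v \<in> T \<Longrightarrow> w \<in> T \<Longrightarrow> v * w \<in> T"
    and v: "v \<in> T"
  shows "v ^ card T = 1"
proof -
  have "v \<noteq> 0" using v nz by auto
  then have inj: "inj_on ((*) v) T" by (auto intro: inj_onI)
  have "(*) v ` T = T"
    using endo_inj_surj[OF fin _ inj] mult[OF v] by blast
  then have "\<Prod>T = prod (\<lambda>w. w) ((*) v ` T)" by simp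
  also have "\<dots> = prod ((*) v) T" using prod.reindex[OF inj, of "\<lambda>w. w"] by (simp add: comp_def)
  also have "\<dots> = v ^ card T * \<Prod>T" by (simp add: prod.distrib)
  finally have "1 * \<Prod>T = v ^ card T * \<Prod>T" by simp
  moreover have "\<Prod>T \<noteq> 0" using fin nz by auto
  ultimately show ?thesis using mult_right_cancel by metis
qed

text \<open>The units that are \<sigma>-adic limits of elements with the support of \<open>x\<close>
  tending to \<open>u\<close> at \<pi>. Only units, supports and adic closeness occur, so
  \<open>h\<close> carries such sets to sets of the same kind.\<close>

definition unit_limits :: "'a::field poly \<Rightarrow> 'a poly \<Rightarrow> 'a poly \<Rightarrow> 'a poly \<Rightarrow> 'a poly set" where
  "unit_limits u x \<pi> \<sigma> = {v. v dvd 1 \<and> (\<forall>n. \<exists>z. z \<noteq> 0 \<and>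
     (\<forall>\<rho>. irreducible \<rho> \<longrightarrow> (\<rho> dvd z \<longleftrightarrow> \<rho> dvd x)) \<and> \<pi> ^ n dvd z - u \<and> \<sigma> ^ n dvd z - v)}"

lemma unit_limitsE:
  assumes "v \<in> unit_limits u x \<pi> \<sigma>"
  obtains z where "z \<noteq> 0" "\<forall>\<rho>. irreducible \<rho> \<longrightarrow> (\<rho> dvd z \<longleftrightarrow> \<rho> dvd x)"
    "\<pi> ^ n dvd z - u" "\<sigma> ^ n dvd z - v"
proof -
  from assms have "\<exists>z. z \<noteq> 0 \<and> (\<forall>\<rho>. irreducible \<rho> \<longrightarrow> (\<rho> dvd z \<longleftrightarrow> \<rho> dvd x)) \<and>
      \<pi> ^ n dvd z - u \<and> \<sigma> ^ n dvd z - v" unfolding unit_limits_def by simp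
  then show ?thesis using that by (elim exE conjE)
qed

lemma adically_continuousD:
  assumes "adically_continuous h \<pi> \<rho>"
  shows "irreducible \<pi>" "irreducible \<rho>" "z \<noteq> 0 \<Longrightarrow> \<rho> dvd h z \<longleftrightarrow> \<pi> dvd z"
    "\<not> \<pi> dvd z \<Longrightarrow> \<exists>k>0. \<forall>y. \<pi> ^ k dvd y - z \<longrightarrow> \<rho> ^ n dvd h y - h z"
  using assms unfolding adically_continuous_def by simp_all

lemma golomb_equivalenceD:
  assumes "golomb_equivalence h g"
  shows "x \<noteq> 0 \<Longrightarrow> h x \<noteq> 0" "x \<noteq> 0 \<Longrightarrow> g (h x) = x" "y \<noteq> 0 \<Longrightarrow> g y \<noteq> 0" "y \<noteq> 0 \<Longrightarrow> h (g y) = y"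
    "x \<noteq> 0 \<Longrightarrow> h x dvd 1 \<longleftrightarrow> x dvd 1"
    "irreducible \<pi> \<Longrightarrow> \<exists>\<rho>. adically_continuous h \<pi> \<rho> \<and> adically_continuous g \<rho> \<pi>"
    "irreducible \<rho> \<Longrightarrow> \<exists>\<pi>. adically_continuous h \<pi> \<rho> \<and> adically_continuous g \<rho> \<pi>"
  using assms unfolding golomb_equivalence_def by simp_all

text \<open>Matching the primes \<open>x\<close> and \<open>y\<close> fixes only the support of
  \<open>h x\<close>, which may be a unit times a higher power of \<open>y\<close>.\<close>

lemma golomb_equivalence_dvd_image:
  assumes eq: "golomb_equivalence h g" and x: "adically_continuous h x y" and \<sigma>: "irreducible \<sigma>"
  shows "\<sigma> dvd h x \<longleftrightarrow> \<sigma> dvd y"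
proof -
  obtain \<pi> where \<pi>: "adically_continuous h \<pi> \<sigma>" using golomb_equivalenceD(7)[OF eq \<sigma>] by blast
  have x0: "x \<noteq> 0" and y0: "y \<noteq> 0" using adically_continuousD[OF x] irreducible_poly_nonzero by auto
  have gy: "g y \<noteq> 0" "h (g y) = y" using golomb_equivalenceD[OF eq] y0 by auto
  have "x dvd g y" using adically_continuousD(3)[OF x gy(1)] gy by simp
  moreover have "\<pi> dvd x \<longleftrightarrow> \<sigma> dvd h x" using adically_continuousD(3)[OF \<pi> x0] by simp
  moreover have "\<pi> dvd g y \<longleftrightarrow> \<sigma> dvd y" using adically_continuousD(3)[OF \<pi> gy(1)] gy by simp
  moreover have "y dvd h x" using adically_continuousD(3)[OF x x0] by simp
  ultimately show ?thesis using dvd_trans by metis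
qed

lemma unit_limits_image:
  fixes h :: "'a::field poly \<Rightarrow> 'b::field poly"
  assumes eq: "golomb_equivalence h g"
    and x: "adically_continuous h x y" and \<pi>: "adically_continuous h \<pi> \<rho>"
    and \<sigma>: "adically_continuous h \<sigma> \<tau>"
    and u: "u dvd 1" and v: "v \<in> unit_limits u x \<pi> \<sigma>"
  shows "h v \<in> unit_limits (h u) y \<rho> \<tau>"
  unfolding unit_limits_def
proof (intro CollectI conjI allI)
  have v1: "v dvd 1" using v unfolding unit_limits_def by simp
  have uv0: "u \<noteq> 0" "v \<noteq> 0" using u v1 by auto
  show "h v dvd 1" using golomb_equivalenceD(5)[OF eq uv0(2)] v1 by simp
  fix n
  have nd: "\<not> \<pi> dvd u" "\<not> \<sigma> dvd v"
    using irreducible_not_unit[OF adically_continuousD(1)[OF \<pi>]] u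
      irreducible_not_unit[OF adically_continuousD(1)[OF \<sigma>]] v1 dvd_trans by metis+
  obtain k where k: "\<And>y. \<pi> ^ k dvd y - u \<Longrightarrow> \<rho> ^ n dvd h y - h u"
    using adically_continuousD(4)[OF \<pi> nd(1)] by metis
  obtain l where l: "\<And>y. \<sigma> ^ l dvd y - v \<Longrightarrow> \<tau> ^ n dvd h y - h v"
    using adically_continuousD(4)[OF \<sigma> nd(2)] by metis
  obtain z where z: "z \<noteq> 0" "\<forall>\<rho>. irreducible \<rho> \<longrightarrow> (\<rho> dvd z \<longleftrightarrow> \<rho> dvd x)"
      "\<pi> ^ (max k l) dvd z - u" "\<sigma> ^ (max k l) dvd z - v"
    by (rule unit_limitsE[OF v])
  have "\<pi> ^ k dvd z - u" "\<sigma> ^ l dvd z - v"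
    using z(3,4) le_imp_power_dvd[of k "max k l" \<pi>] le_imp_power_dvd[of l "max k l" \<sigma>] dvd_trans
    by (metis max.cobounded1, metis max.cobounded2)
  then have "\<rho> ^ n dvd h z - h u" "\<tau> ^ n dvd h z - h v" using k l by auto
  moreover have "\<kappa> dvd h z \<longleftrightarrow> \<kappa> dvd y" if \<kappa>: "irreducible \<kappa>" for \<kappa>
  proof -
    obtain \<mu> where \<mu>: "adically_continuous h \<mu> \<kappa>" using golomb_equivalenceD(7)[OF eq \<kappa>] by blast
    have "x \<noteq> 0" using adically_continuousD(1)[OF x] irreducible_poly_nonzero by blast
    then have "\<kappa> dvd h z \<longleftrightarrow> \<kappa> dvd h x"
      using adically_continuousD(3)[OF \<mu>] z(1) z(2)[rule_format, OF adically_continuousD(1)[OF \<mu>]] by simp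
    then show ?thesis using golomb_equivalence_dvd_image[OF eq x \<kappa>] by simp
  qed
  ultimately show "\<exists>z. z \<noteq> 0 \<and> (\<forall>\<rho>. irreducible \<rho> \<longrightarrow> (\<rho> dvd z \<longleftrightarrow> \<rho> dvd y)) \<and>
      \<rho> ^ n dvd z - h u \<and> \<tau> ^ n dvd z - h v"
    using golomb_equivalenceD(1)[OF eq z(1)] by (intro exI[of _ "h z"]) simp
qed

lemma unit_limits_bij:
  fixes h :: "'a::field poly \<Rightarrow> 'b::field poly"
  assumes eq: "golomb_equivalence h g"
    and x: "adically_continuous h x y" "adically_continuous g y x"
    and \<pi>: "adically_continuous h \<pi> \<rho>" "adically_continuous g \<rho> \<pi>"
    and \<sigma>: "adically_continuous h \<sigma> \<tau>" "adically_continuous g \<tau> \<sigma>"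
    and u: "u dvd 1"
  shows "bij_betw h (unit_limits u x \<pi> \<sigma>) (unit_limits (h u) y \<rho> \<tau>)"
proof (rule bij_betwI[of _ _ _ g])
  have u0: "u \<noteq> 0" using u by auto
  have unz: "v \<noteq> 0" if "v \<in> unit_limits a b c d" for v a b c d :: "'c::field poly"
    using that unfolding unit_limits_def by auto
  show "h \<in> unit_limits u x \<pi> \<sigma> \<rightarrow> unit_limits (h u) y \<rho> \<tau>"
    using unit_limits_image[OF eq x(1) \<pi>(1) \<sigma>(1) u] by blast
  have "h u dvd 1" using golomb_equivalenceD(5)[OF eq u0] u by simp
  then have "g v \<in> unit_limits (g (h u)) x \<pi> \<sigma>" if "v \<in> unit_limits (h u) y \<rho> \<tau>" for v
    using unit_limits_image[OF golomb_equivalence_sym[OF eq] x(2) \<pi>(2) \<sigma>(2) _ that] by blast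
  then show "g \<in> unit_limits (h u) y \<rho> \<tau> \<rightarrow> unit_limits u x \<pi> \<sigma>"
    using golomb_equivalenceD(2)[OF eq u0] by auto
  show "g (h v) = v" if "v \<in> unit_limits u x \<pi> \<sigma>" for v
    using golomb_equivalenceD(2)[OF eq unz[OF that]] .
  show "h (g v) = v" if "v \<in> unit_limits (h u) y \<rho> \<tau>" for v
    using golomb_equivalenceD(4)[OF eq unz[OF that]] .
qed

lemma unit_times_prime_power:
  fixes x z :: "'a::field poly"
  assumes x: "irreducible x" and z: "z \<noteq> 0" "\<And>\<rho>. irreducible \<rho> \<Longrightarrow> \<rho> dvd z \<longleftrightarrow> \<rho> dvd x"
  obtains a k where "a dvd 1" "k > 0" "z = a * x ^ k"
proof -
  obtain k c where kc: "z = x ^ k * c" "\<not> x dvd c"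
    using prime_power_factor[OF z(1) irreducible_poly_degree[OF x]] by metis
  have "c dvd 1"
  proof (rule ccontr)
    assume "\<not> c dvd 1"
    moreover have "c \<noteq> 0" using kc(2) by auto
    ultimately obtain \<rho> where \<rho>: "irreducible \<rho>" "\<rho> dvd c" using poly_irreducible_factor by metis
    then have "\<rho> dvd z" unfolding kc(1) by simp
    then have "\<rho> dvd x" using z(2)[OF \<rho>(1)] by simp
    then have "x dvd \<rho>" by (rule irreducible_poly_dvd_irreducible[OF \<rho>(1) x])
    then show False using kc(2) \<rho>(2) dvd_trans by blast
  qed
  moreover have "x dvd z" using z(2)[OF x] by simp
  then have "k > 0" using kc by (cases k) auto
  ultimately show ?thesis using that[of c k] kc(1) by (simp add: mult.commute)
qed

lemma unit_polys_cong_imp_eq: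
  fixes u v :: "'a::field poly"
  assumes "u dvd 1" "v dvd 1" "irreducible \<pi>" "\<pi> dvd u - v"
  shows "u = v"
  using unit_poly_diff[OF assms(1,2)] irreducible_not_unit[OF assms(3)] dvd_trans[OF assms(4)] by blast

lemma irreducible_dvd_mult_power_iff:
  fixes \<rho> x :: "'a::field poly"
  assumes "irreducible \<rho>" "k > 0" "a dvd 1"
  shows "\<rho> dvd a * x ^ k \<longleftrightarrow> \<rho> dvd x"
proof
  assume "\<rho> dvd a * x ^ k"
  then have "\<rho> dvd a \<or> \<rho> dvd x ^ k" using irreducible_poly_prime[OF assms(1)] by blast
  moreover have "\<not> \<rho> dvd a" using assms(3) irreducible_not_unit[OF assms(1)] dvd_trans by blast
  ultimately show "\<rho> dvd x" using irreducible_poly_dvd_power[OF assms(1)] by blast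
next
  assume "\<rho> dvd x"
  moreover have "x dvd a * x ^ k" using assms(2) by (simp add: dvd_power)
  ultimately show "\<rho> dvd a * x ^ k" by (rule dvd_trans)
qed

text \<open>1 is a limit because \<open>x\<close> has finite order modulo every power of
  \<open>\<pi> * \<sigma>\<close>, and products of approximants approximate products. For
  finiteness, an approximant is a constant \<open>a\<close> times a power of \<open>x\<close> with
  exponent \<open>r\<close> modulo \<open>e\<close>: given \<open>r\<close>, the residue 1 at \<pi>
  fixes \<open>a\<close>, and then the residue at \<sigma> fixes \<open>v\<close>.\<close>

lemma unit_limits_torsion:
  fixes x \<pi> \<sigma> :: "'a::field poly"
  assumes K: "torsion_field TYPE('a)" and irr: "irreducible x" "irreducible \<pi>" "irreducible \<sigma>"
    and nd: "\<not> \<pi> dvd x" "\<not> \<sigma> dvd x"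
  shows "1 \<in> unit_limits 1 x \<pi> \<sigma>" "finite (unit_limits 1 x \<pi> \<sigma>)"
    "v \<in> unit_limits 1 x \<pi> \<sigma> \<Longrightarrow> v ^ card (unit_limits 1 x \<pi> \<sigma>) = 1"
proof -
  let ?L = "unit_limits 1 x \<pi> \<sigma>"
  have co: "comaximal x (\<pi> * \<sigma>)"
    using nd irr by (intro comaximal_mult_right) (simp_all add: comaximal_irreducible_iff)
  have nz: "\<pi> * \<sigma> \<noteq> 0" using irr irreducible_poly_nonzero by auto
  show one: "1 \<in> ?L"
    unfolding unit_limits_def
  proof (intro CollectI conjI allI)
    fix n
    obtain e where e: "e > 0" "(\<pi> * \<sigma>) ^ n dvd x ^ e - 1"
      using torsion_field_residue_torsion[OF K _ comaximal_power_right[OF co]] nz by (metis power_not_zero)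
    have "\<pi> ^ n dvd x ^ e - 1" "\<sigma> ^ n dvd x ^ e - 1"
      using e(2) unfolding power_mult_distrib by (auto dest: dvd_mult_left dvd_mult_right)
    moreover have "\<rho> dvd x ^ e \<longleftrightarrow> \<rho> dvd x" if "irreducible \<rho>" for \<rho>
      using irreducible_dvd_mult_power_iff[OF that e(1), of 1 x] by simp
    ultimately show "\<exists>z. z \<noteq> 0 \<and> (\<forall>\<rho>. irreducible \<rho> \<longrightarrow> (\<rho> dvd z \<longleftrightarrow> \<rho> dvd x)) \<and>
        \<pi> ^ n dvd z - 1 \<and> \<sigma> ^ n dvd z - 1"
      using irreducible_poly_nonzero[OF irr(1)] by (intro exI[of _ "x ^ e"]) simp
  qed simp
  have mult: "v * w \<in> ?L" if vw: "v \<in> ?L" "w \<in> ?L" for v w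
    unfolding unit_limits_def
  proof (intro CollectI conjI allI)
    have "v dvd 1" "w dvd 1" using vw unfolding unit_limits_def by auto
    then show "v * w dvd 1" using mult_dvd_mono[of v 1 w 1] by simp
    fix n
    obtain y where y: "y \<noteq> 0" "\<forall>\<rho>. irreducible \<rho> \<longrightarrow> (\<rho> dvd y \<longleftrightarrow> \<rho> dvd x)"
        "\<pi> ^ n dvd y - 1" "\<sigma> ^ n dvd y - v" by (rule unit_limitsE[OF vw(1)])
    obtain z where z: "z \<noteq> 0" "\<forall>\<rho>. irreducible \<rho> \<longrightarrow> (\<rho> dvd z \<longleftrightarrow> \<rho> dvd x)"
        "\<pi> ^ n dvd z - 1" "\<sigma> ^ n dvd z - w" by (rule unit_limitsE[OF vw(2)])
    have "\<pi> ^ n dvd y * z - 1 * 1" "\<sigma> ^ n dvd y * z - v * w"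
      using dvd_diff_mult_cong[OF y(3) z(3)] dvd_diff_mult_cong[OF y(4) z(4)] .
    moreover have "\<rho> dvd y * z \<longleftrightarrow> \<rho> dvd x" if "irreducible \<rho>" for \<rho>
      using irreducible_poly_prime[OF that, of y z] y(2)[rule_format, OF that]
        z(2)[rule_format, OF that] dvd_mult2[of \<rho> y z] by blast
    ultimately show "\<exists>z. z \<noteq> 0 \<and> (\<forall>\<rho>. irreducible \<rho> \<longrightarrow> (\<rho> dvd z \<longleftrightarrow> \<rho> dvd x)) \<and>
        \<pi> ^ n dvd z - 1 \<and> \<sigma> ^ n dvd z - v * w"
      using y(1) z(1) by (intro exI[of _ "y * z"]) simp
  qed
  obtain e where e: "e > 0" "\<pi> * \<sigma> dvd x ^ e - 1"
    using torsion_field_residue_torsion[OF K nz co] by metis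
  \<comment> \<open>The congruences with n = 1 suffice, and the exponent is reduced modulo an
    \<open>e\<close> with \<open>x ^ e\<close> congruent to 1.\<close>
  have ex: "\<exists>r<e. \<exists>a. a dvd 1 \<and> \<pi> dvd a * x ^ r - 1 \<and> \<sigma> dvd a * x ^ r - v" if v: "v \<in> ?L" for v
  proof -
    obtain z where z: "z \<noteq> 0" "\<forall>\<rho>. irreducible \<rho> \<longrightarrow> (\<rho> dvd z \<longleftrightarrow> \<rho> dvd x)"
        "\<pi> ^ 1 dvd z - 1" "\<sigma> ^ 1 dvd z - v" by (rule unit_limitsE[OF v])
    obtain a k where ak: "a dvd 1" "k > 0" "z = a * x ^ k"
      by (rule unit_times_prime_power[OF irr(1) z(1) z(2)[rule_format]])
    define q r where "q = k div e" and "r = k mod e"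
    have k: "k = e * q + r" unfolding q_def r_def by simp
    have "\<pi> * \<sigma> dvd (x ^ e) ^ q * x ^ r - 1 ^ q * x ^ r"
      by (intro dvd_diff_mult_cong dvd_diff_power_cong e(2)) simp
    then have "\<pi> * \<sigma> dvd a * (x ^ k - x ^ r)" unfolding k by (simp add: power_add power_mult)
    then have "\<pi> * \<sigma> dvd z - a * x ^ r" unfolding ak(3) by (simp add: right_diff_distrib)
    then have "\<pi> dvd a * x ^ r - z" "\<sigma> dvd a * x ^ r - z"
      by (auto intro: dvd_diff_sym dest: dvd_mult_left dvd_mult_right)
    then have "\<pi> dvd a * x ^ r - 1" "\<sigma> dvd a * x ^ r - v"
      using z(3,4) dvd_diff_trans[of _ "a * x ^ r" z] by simp_all
    moreover have "r < e" unfolding r_def using e(1) by simp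
    ultimately show ?thesis using ak(1) by blast
  qed
  have "\<forall>v\<in>?L. \<exists>r. r < e \<and> (\<exists>a. a dvd 1 \<and> \<pi> dvd a * x ^ r - 1 \<and> \<sigma> dvd a * x ^ r - v)"
    using ex by blast
  from bchoice[OF this] obtain r where
    r: "\<forall>v\<in>?L. r v < e \<and> (\<exists>a. a dvd 1 \<and> \<pi> dvd a * x ^ r v - 1 \<and> \<sigma> dvd a * x ^ r v - v)" by blast
  have "inj_on r ?L"
  proof (rule inj_onI)
    fix v w assume vw: "v \<in> ?L" "w \<in> ?L" "r v = r w"
    obtain a where a: "a dvd 1" "\<pi> dvd a * x ^ r v - 1" "\<sigma> dvd a * x ^ r v - v" using r vw(1) by blast
    obtain b where b: "b dvd 1" "\<pi> dvd b * x ^ r v - 1" "\<sigma> dvd b * x ^ r v - w"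
      using r vw(2) vw(3) by metis
    have "\<pi> dvd (a * x ^ r v - 1) - (b * x ^ r v - 1)" using a(2) b(2) by (rule dvd_diff)
    then have "\<pi> dvd (a - b) * x ^ r v" by (simp add: left_diff_distrib)
    then have "\<pi> dvd a - b"
      using irreducible_poly_prime[OF irr(2)] irreducible_poly_dvd_power[OF irr(2)] nd(1) by blast
    then have ab: "a = b" by (rule unit_polys_cong_imp_eq[OF a(1) b(1) irr(2)])
    have "\<sigma> dvd (b * x ^ r v - w) - (a * x ^ r v - v)" using b(3) a(3) by (rule dvd_diff)
    then have "\<sigma> dvd v - w" using ab by simp
    moreover have "v dvd 1" "w dvd 1" using vw unfolding unit_limits_def by auto
    ultimately show "v = w" using unit_polys_cong_imp_eq irr(3) by blast
  qed
  moreover have "r ` ?L \<subseteq> {..<e}" using r by auto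
  ultimately show fin: "finite ?L" using inj_on_finite by blast
  assume v: "v \<in> ?L"
  have "0 \<notin> ?L" unfolding unit_limits_def by simp
  then show "v ^ card ?L = 1" using finite_mult_closed_power_card[OF fin _ mult v] by simp
qed

lemma card_roots_of_unity_le:
  fixes m :: nat
  assumes "m > 0"
  shows "finite {v :: 'a::idom. v ^ m = 1}" "card {v :: 'a::idom. v ^ m = 1} \<le> m"
proof -
  define f :: "'a poly" where "f = monom 1 m - 1"
  have d: "degree f = m" unfolding f_def
    using assms by (metis degree_1 degree_add_eq_left degree_minus degree_monom_eq diff_conv_add_uminus one_neq_zero)
  then have f0: "f \<noteq> 0" using assms by auto
  have eq: "{v :: 'a. v ^ m = 1} = {v. poly f v = 0}" unfolding f_def by (simp add: poly_monom)
  show "finite {v :: 'a. v ^ m = 1}" unfolding eq using poly_roots_finite[OF f0] .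
  show "card {v :: 'a. v ^ m = 1} \<le> m" unfolding eq using card_poly_roots_bound[OF f0] d by simp
qed

lemma frobenius_diff:
  fixes a b :: "'a::comm_ring_1"
  assumes "prime CHAR('a)"
  shows "(a - b) ^ (CHAR('a) ^ n) = a ^ (CHAR('a) ^ n) - b ^ (CHAR('a) ^ n)"
  using freshmans_dream'[OF assms refl, of "a - b" b n] by (simp add: algebra_simps)

text \<open>With such an N, X^(p^N) - w = (X - w)^(p^N), so X^(p^N) is as close as desired to
  \<open>w\<close> at X - w and, at the same time, to 1 at X - 1.\<close>

lemma torsion_frobenius_fixed:
  fixes w :: "'a::field"
  assumes K: "torsion_field TYPE('a)" and "w \<noteq> 0"
  obtains N where "CHAR('a) ^ N \<ge> n" "w ^ (CHAR('a) ^ N) = w"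
proof -
  let ?p = "CHAR('a)"
  have p: "prime ?p" using torsion_field_prime_char[OF K] .
  obtain F where F: "finite F" "subring_set F" "{w} \<subseteq> F"
    using torsion_field_finite_subring[OF K, of "{w}"] by auto
  have "range (\<lambda>i. w ^ (?p ^ i)) \<subseteq> F" using subring_setD(7)[OF F(2)] F(3) by auto
  then have "finite (range (\<lambda>i. w ^ (?p ^ i)))" using F(1) finite_subset by blast
  then have "\<not> inj (\<lambda>i. w ^ (?p ^ i))" using range_inj_infinite by blast
  then obtain i j where "i \<noteq> j" "w ^ (?p ^ i) = w ^ (?p ^ j)" unfolding inj_def by blast
  then have "\<exists>i j. i < j \<and> w ^ (?p ^ i) = w ^ (?p ^ j)" by (metis linorder_neqE_nat)
  then obtain i j where ij: "i < j" "w ^ (?p ^ i) = w ^ (?p ^ j)" by blast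
  define d where "d = j - i"
  \<comment> \<open>Injectivity of the Frobenius map cancels the exponent \<open>?p ^ i\<close>, so
    \<open>w\<close> itself is fixed by a power of Frobenius, which is then iterated.\<close>
  have "(w ^ (?p ^ d) - w) ^ (?p ^ i) = w ^ (?p ^ d * ?p ^ i) - w ^ (?p ^ i)"
    unfolding frobenius_diff[OF p] by (simp add: power_mult)
  also have "?p ^ d * ?p ^ i = ?p ^ j" unfolding d_def using ij(1) by (simp add: power_add[symmetric])
  finally have "(w ^ (?p ^ d) - w) ^ (?p ^ i) = 0" using ij(2) by simp
  then have wd: "w ^ (?p ^ d) = w" by simp
  have "w ^ (?p ^ (d * l)) = w" for l
  proof (induction l)
    case (Suc l)
    have "w ^ (?p ^ (d * Suc l)) = (w ^ (?p ^ d)) ^ (?p ^ (d * l))"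
      by (simp add: power_add power_mult)
    then show ?case using wd Suc by simp
  qed simp
  moreover have "n \<le> ?p ^ (d * n)"
  proof -
    have "n \<le> 2 ^ n" using less_exp[of n] by simp
    also have "\<dots> \<le> ?p ^ n" using prime_ge_2_nat[OF p] by (rule power_mono) simp
    also have "\<dots> \<le> ?p ^ (d * n)"
      using ij(1) prime_gt_0_nat[OF p] unfolding d_def by (intro power_increasing) auto
    finally show ?thesis .
  qed
  ultimately show ?thesis using that by blast
qed

text \<open>An approximant is \<alpha> X^k with a constant \<alpha>, and the congruences with n = 1
  are its values at \<open>w\<close> and at 1.\<close>

lemma unit_limits_X:
  fixes w c :: "'b::field"
  assumes v: "[:b:] \<in> unit_limits [:c:] [:0, 1:] [:- w, 1:] [:- 1, 1:]"
  obtains k where "k > 0" "b * w ^ k = c"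
proof -
  obtain z where z: "z \<noteq> 0" "\<forall>\<rho>. irreducible \<rho> \<longrightarrow> (\<rho> dvd z \<longleftrightarrow> \<rho> dvd [:0, 1:])"
      "[:- w, 1:] ^ 1 dvd z - [:c:]" "[:- 1, 1:] ^ 1 dvd z - [:b:]"
    by (rule unit_limitsE[OF v])
  have "irreducible [:0, 1 :: 'b:]" by (rule irreducible_poly_degree_1) simp
  then obtain a k where ak: "a dvd 1" "k > 0" "z = a * [:0, 1:] ^ k"
    by (rule unit_times_prime_power[OF _ z(1) z(2)[rule_format]])
  have "a \<noteq> 0" using ak(1) by auto
  then have "degree a = 0" using ak(1) is_unit_iff_degree by blast
  then obtain \<alpha> where \<alpha>: "a = [:\<alpha>:]" by (rule degree_eq_zeroE)
  have "poly (z - [:c:]) w = 0" "poly (z - [:b:]) 1 = 0"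
    using z(3,4) unfolding power_one_right poly_eq_0_iff_dvd .
  then have "\<alpha> * w ^ k = c" "\<alpha> = b" unfolding ak(3) \<alpha> by (simp_all add: poly_power)
  then show ?thesis using that ak(2) by blast
qed

lemma unit_limits_XI:
  fixes w b c :: "'b::field"
  assumes K: "torsion_field TYPE('b)" and w: "w \<noteq> 0" "b \<noteq> 0" "j > 0" "b * w ^ j = c"
  shows "[:b:] \<in> unit_limits [:c:] [:0, 1:] [:- w, 1:] [:- 1, 1:]"
  unfolding unit_limits_def
proof (intro CollectI conjI allI)
  have b: "[:b:] dvd 1" using w(2) is_unit_iff_degree[of "[:b:]"] by simp
  then show "[:b:] dvd 1" .
  fix n
  let ?p = "CHAR('b)"
  have p: "prime CHAR('b poly)" using torsion_field_prime_char[OF K] by simp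
  obtain N where N: "?p ^ N \<ge> n" "w ^ (?p ^ N) = w" using torsion_frobenius_fixed[OF K w(1)] by metis
  \<comment> \<open>Applied to \<open>s = w\<close> and to \<open>s = 1\<close>, both fixed by the
    same power of Frobenius.\<close>
  have key: "[:- s, 1:] ^ n dvd [:b:] * [:0, 1:] ^ (?p ^ N * j) - [:b * s ^ j:]" if "s ^ (?p ^ N) = s" for s
  proof -
    have "[:- s, 1:] ^ (?p ^ N) = ([:0, 1:] - [:s:]) ^ (CHAR('b poly) ^ N)" by simp
    also have "\<dots> = [:0, 1:] ^ (?p ^ N) - [:s:] ^ (?p ^ N)" unfolding frobenius_diff[OF p] by simp
    also have "[:s:] ^ (?p ^ N) = [:s:]" using that by (simp add: poly_const_pow)
    finally have "[:- s, 1:] ^ n dvd [:0, 1:] ^ (?p ^ N) - [:s:]"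
      using N(1) le_imp_power_dvd by metis
    then have "[:- s, 1:] ^ n dvd ([:0, 1:] ^ (?p ^ N)) ^ j - [:s:] ^ j" by (rule dvd_diff_power_cong)
    then have "[:- s, 1:] ^ n dvd [:b:] * (([:0, 1:] ^ (?p ^ N)) ^ j - [:s:] ^ j)" by (rule dvd_mult)
    also have "[:b:] * (([:0, 1:] ^ (?p ^ N)) ^ j - [:s:] ^ j) =
        [:b:] * [:0, 1:] ^ (?p ^ N * j) - [:b:] * [:s ^ j:]"
      by (simp only: right_diff_distrib power_mult poly_const_pow)
    also have "[:b:] * [:s ^ j:] = [:b * s ^ j:]" by simp
    finally show ?thesis .
  qed
  let ?k = "?p ^ N * j"
  have k0: "?k > 0" using w(3) prime_gt_0_nat[OF torsion_field_prime_char[OF K]] by simp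
  have "[:- w, 1:] ^ n dvd [:b:] * [:0, 1:] ^ ?k - [:c:]" using key[OF N(2)] w(4) by simp
  moreover have "[:- 1, 1:] ^ n dvd [:b:] * [:0, 1:] ^ ?k - [:b:]" using key[of 1] by simp
  moreover have "[:b:] * [:0, 1:] ^ ?k \<noteq> 0" using w(2) by (simp del: mult_pCons_left)
  moreover have "\<forall>\<rho>. irreducible \<rho> \<longrightarrow> (\<rho> dvd [:b:] * [:0, 1:] ^ ?k \<longleftrightarrow> \<rho> dvd [:0, 1:])"
    using irreducible_dvd_mult_power_iff[OF _ k0 b] by blast
  ultimately show "\<exists>z. z \<noteq> 0 \<and> (\<forall>\<rho>. irreducible \<rho> \<longrightarrow> (\<rho> dvd z \<longleftrightarrow> \<rho> dvd [:0, 1:])) \<and>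
      [:- w, 1:] ^ n dvd z - [:c:] \<and> [:- 1, 1:] ^ n dvd z - [:b:]" by blast
qed

text \<open>\<open>h\<close> need not fix 1, which brings in the constant \<open>c\<close>; the
  limits are based at 1 on the side of K and at \<open>c\<close> on the side of K'.\<close>

lemma golomb_unit_limits_X:
  fixes h :: "'a::field poly \<Rightarrow> 'b::field poly" and w :: 'b
  assumes eq: "golomb_equivalence h g" and K: "torsion_field TYPE('a)" and w: "w \<noteq> 0"
  obtains L c where "finite L" "1 \<in> L" "\<And>v. v \<in> L \<Longrightarrow> v ^ card L = 1" "h 1 = [:c:]" "c \<noteq> 0"
    "\<And>v. v \<in> L \<Longrightarrow> v dvd 1" "bij_betw h L (unit_limits [:c:] [:0, 1:] [:- w, 1:] [:- 1, 1:])"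
proof -
  have irr: "irreducible [:0, 1 :: 'b:]" "irreducible [:- w, 1:]" "irreducible [:- 1, 1 :: 'b:]"
    by (auto intro!: irreducible_poly_degree_1)
  obtain x where x: "adically_continuous h x [:0, 1:]" "adically_continuous g [:0, 1:] x"
    using golomb_equivalenceD(7)[OF eq irr(1)] by blast
  obtain \<pi> where \<pi>: "adically_continuous h \<pi> [:- w, 1:]" "adically_continuous g [:- w, 1:] \<pi>"
    using golomb_equivalenceD(7)[OF eq irr(2)] by blast
  obtain \<sigma> where \<sigma>: "adically_continuous h \<sigma> [:- 1, 1:]" "adically_continuous g [:- 1, 1:] \<sigma>"
    using golomb_equivalenceD(7)[OF eq irr(3)] by blast
  have irr': "irreducible x" "irreducible \<pi>" "irreducible \<sigma>"
    using adically_continuousD(1) x \<pi> \<sigma> by blast+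
  have x0: "x \<noteq> 0" using irr'(1) irreducible_poly_nonzero by blast
  have "\<not> [:- w, 1:] dvd [:0, 1:]" "\<not> [:- 1, 1:] dvd [:0, 1 :: 'b:]"
    using w unfolding poly_eq_0_iff_dvd[symmetric] by auto
  then have nd: "\<not> \<pi> dvd x" "\<not> \<sigma> dvd x"
    using adically_continuousD(3)[OF \<pi>(1) x0] adically_continuousD(3)[OF \<sigma>(1) x0]
      golomb_equivalence_dvd_image[OF eq x(1)] irr by auto
  have "h 1 dvd 1" using golomb_equivalenceD(5)[OF eq, of 1] by simp
  then have "h 1 \<noteq> 0" "degree (h 1) = 0" using is_unit_iff_degree[of "h 1"] by fastforce+
  then obtain c where c: "h 1 = [:c:]" "c \<noteq> 0" by (metis degree_eq_zeroE pCons_0_0)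
  have "bij_betw h (unit_limits 1 x \<pi> \<sigma>) (unit_limits (h 1) [:0, 1:] [:- w, 1:] [:- 1, 1:])"
    by (rule unit_limits_bij[OF eq x \<pi> \<sigma>]) simp
  moreover have "\<And>v. v \<in> unit_limits 1 x \<pi> \<sigma> \<Longrightarrow> v dvd 1" unfolding unit_limits_def by simp
  ultimately show ?thesis using that[OF unit_limits_torsion(2,1,3)[OF K irr' nd] c] c by simp
qed

text \<open>1 is a limit on the side of K, so its image \<open>c\<close> is one on the side of K'.
  This says c w^k = c for some positive k.\<close>

lemma golomb_equivalence_torsion:
  fixes h :: "'a::field poly \<Rightarrow> 'b::field poly"
  assumes eq: "golomb_equivalence h g" and K: "torsion_field TYPE('a)"
  shows "torsion_field TYPE('b)"
  unfolding torsion_field_def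
proof (intro allI impI)
  fix w :: 'b assume w: "w \<noteq> 0"
  obtain L c where L: "1 \<in> L" "h 1 = [:c:]" "c \<noteq> 0"
      "bij_betw h L (unit_limits [:c:] [:0, 1:] [:- w, 1:] [:- 1, 1:])"
    using golomb_unit_limits_X[OF eq K w] by metis
  have "[:c:] \<in> unit_limits [:c:] [:0, 1:] [:- w, 1:] [:- 1, 1:]"
    using bij_betwE[OF L(4)] L(1,2) by metis
  then obtain k where "k > 0" "c * w ^ k = c" using unit_limits_X by metis
  then show "\<exists>n>0. w ^ n = 1" using L(3) by auto
qed

text \<open>\<open>m\<close> is the order of \<open>w\<close>. The limits in K'[X] are the
  \<open>m\<close> constants c / w^j, so the set \<open>L\<close> in K[X] has \<open>m\<close>
  elements, each an \<open>m\<close>-th root of unity.\<close>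

lemma golomb_equivalence_roots_of_unity:
  fixes h :: "'a::field poly \<Rightarrow> 'b::field poly" and w :: 'b
  assumes eq: "golomb_equivalence h g" and K: "torsion_field TYPE('a)" and w: "w \<noteq> 0"
  defines "m \<equiv> card (range (\<lambda>j::nat. w ^ j))"
  shows "card {v :: 'a. v ^ m = 1} = m"
proof -
  have K': "torsion_field TYPE('b)" using golomb_equivalence_torsion[OF eq K] .
  obtain L c where L: "finite L" "1 \<in> L" "\<And>v. v \<in> L \<Longrightarrow> v ^ card L = 1" "c \<noteq> 0"
      "\<And>v. v \<in> L \<Longrightarrow> v dvd 1" "bij_betw h L (unit_limits [:c:] [:0, 1:] [:- w, 1:] [:- 1, 1:])"
    using golomb_unit_limits_X[OF eq K w] by metis
  let ?L' = "unit_limits [:c:] [:0, 1:] [:- w, 1:] [:- 1, 1:]"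
  obtain n where n: "n > 0" "w ^ n = 1" using K' w unfolding torsion_field_def by blast
  have "bij_betw (\<lambda>a. [:c / a:]) (range (\<lambda>j::nat. w ^ j)) ?L'"
  proof (rule bij_betw_imageI)
    show "inj_on (\<lambda>a. [:c / a:]) (range (\<lambda>j::nat. w ^ j))"
      using L(4) by (auto intro!: inj_onI simp: field_simps)
    show "(\<lambda>a. [:c / a:]) ` range (\<lambda>j::nat. w ^ j) = ?L'"
    proof (intro equalityI subsetI)
      fix v assume "v \<in> (\<lambda>a. [:c / a:]) ` range (\<lambda>j::nat. w ^ j)"
      then obtain j :: nat where v: "v = [:c / w ^ j:]" by blast
      \<comment> \<open>Adding the period \<open>n\<close> makes the exponent positive, as an
        approximant must be divisible by X.\<close>
      have "w ^ (j + n) = w ^ j" using n by (simp add: power_add)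
      then have "(c / w ^ j) * w ^ (j + n) = c" using w by simp
      then show "v \<in> ?L'" unfolding v using w L(4) n(1) by (intro unit_limits_XI[OF K', of w _ "j + n"]) auto
    next
      fix v assume v: "v \<in> ?L'"
      then have "v dvd 1" unfolding unit_limits_def by simp
      then have "degree v = 0" using is_unit_iff_degree[of v] by fastforce
      then obtain b where b: "v = [:b:]" by (rule degree_eq_zeroE)
      then obtain k where k: "b * w ^ k = c" using unit_limits_X v by metis
      then have "b = c / w ^ k" using w by (simp add: field_simps)
      then show "v \<in> (\<lambda>a. [:c / a:]) ` range (\<lambda>j::nat. w ^ j)" using b by blast
    qed
  qed
  then have "card ?L' = m" unfolding m_def using bij_betw_same_card by metis
  then have cL: "card L = m" using bij_betw_same_card[OF L(6)] by simp
  then have m0: "m > 0" using L(1,2) by (metis card_gt_0_iff empty_iff)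
  have "(\<lambda>v. coeff v 0) ` L \<subseteq> {v :: 'a. v ^ m = 1}"
  proof
    fix a assume "a \<in> (\<lambda>v. coeff v 0) ` L"
    then obtain v where v: "v \<in> L" "a = coeff v 0" by blast
    have "coeff (v ^ m) 0 = a ^ m" unfolding v(2) by (induction m) (simp_all add: coeff_mult_0)
    then show "a \<in> {v :: 'a. v ^ m = 1}" using L(3)[OF v(1)] cL by simp
  qed
  moreover have "inj_on (\<lambda>v. coeff v 0) L"
  proof (rule inj_onI)
    fix u v assume uv: "u \<in> L" "v \<in> L" "coeff u 0 = coeff v 0"
    have "degree u = 0" "degree v = 0" using L(5) uv is_unit_iff_degree[of u] is_unit_iff_degree[of v] by fastforce+
    then show "u = v" using uv(3) by (metis degree_eq_zeroE coeff_pCons_0)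
  qed
  ultimately have "m \<le> card {v :: 'a. v ^ m = 1}"
    using card_mono[OF card_roots_of_unity_le(1)[OF m0, where 'a='a]] cL card_image by metis
  then show ?thesis using card_roots_of_unity_le(2)[OF m0, where 'a='a] by simp
qed

section \<open>Finite subrings of torsion fields and isomorphisms\<close>

text \<open>A subgroup \<open>B\<close> of largest p-power order inside \<open>A\<close> is all of
  \<open>A\<close>: an element \<open>x\<close> outside \<open>B\<close> would contribute the p
  distinct cosets B + i x, since a multiple of \<open>x\<close> by an integer prime to p generates
  \<open>x\<close>.\<close>

lemma finite_additive_subgroup_card:
  fixes A :: "'a::field set"
  assumes p: "prime CHAR('a)" and A: "finite A" "0 \<in> A" "\<And>x y. x \<in> A \<Longrightarrow> y \<in> A \<Longrightarrow> x - y \<in> A"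
  obtains k where "card A = CHAR('a) ^ k"
proof -
  let ?p = "CHAR('a)"
  define G where "G = (\<lambda>B. B \<subseteq> A \<and> 0 \<in> B \<and> (\<forall>x\<in>B. \<forall>y\<in>B. x - y \<in> B) \<and> (\<exists>k. card B = ?p ^ k))"
  have "G {0}" unfolding G_def using A by (auto intro: exI[of _ 0])
  moreover have "\<forall>B. G B \<longrightarrow> card B < Suc (card A)"
    unfolding G_def using A(1) by (simp add: card_mono le_imp_less_Suc)
  ultimately have "\<exists>B. G B \<and> (\<forall>C. G C \<longrightarrow> card C \<le> card B)" by (rule ex_has_greatest_nat)
  then obtain B where B: "G B" and max: "\<And>C. G C \<Longrightarrow> card C \<le> card B" by blast
  have BA: "B \<subseteq> A" and B0: "0 \<in> B" and Bd: "\<And>x y. x \<in> B \<Longrightarrow> y \<in> B \<Longrightarrow> x - y \<in> B"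
    using B unfolding G_def by auto
  obtain k where k: "card B = ?p ^ k" using B unfolding G_def by blast
  have Bm: "- x \<in> B" if "x \<in> B" for x using Bd[OF B0 that] by simp
  have Bp: "x + y \<in> B" if "x \<in> B" "y \<in> B" for x y using Bd[OF that(1) Bm[OF that(2)]] by simp
  have Bn: "of_nat i * x \<in> B" if "x \<in> B" for i x
    by (induction i) (use B0 Bp that in \<open>auto simp: distrib_right\<close>)
  have Bi: "of_int i * x \<in> B" if "x \<in> B" for i x
  proof (cases i rule: int_cases2)
    case (nonneg n)
    then show ?thesis using Bn[OF that, of n] by simp
  next
    case (nonpos n)
    then show ?thesis using Bm[OF Bn[OF that, of n]] by simp
  qed
  have An: "of_nat i * x \<in> A" if "x \<in> A" for i x
  proof (induction i)
    case (Suc i)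
    have "0 - x \<in> A" by (rule A(3)[OF A(2) that])
    then have "of_nat i * x - (0 - x) \<in> A" using A(3) Suc by blast
    then show ?case by (simp add: algebra_simps)
  qed (simp add: A)
  have "B = A"
  proof (rule ccontr)
    assume "B \<noteq> A"
    then obtain x where x: "x \<in> A" "x \<notin> B" using BA by blast
    define f where "f = (\<lambda>(i :: nat, b). b + of_nat i * x)"
    have inj: "inj_on f ({..<?p} \<times> B)"
    proof (rule inj_onI)
      fix s t assume st: "s \<in> {..<?p} \<times> B" "t \<in> {..<?p} \<times> B" "f s = f t"
      obtain i b where s: "s = (i, b)" by (cases s)
      obtain j c where t: "t = (j, c)" by (cases t)
      have ij: "i \<in> {..<?p}" "j \<in> {..<?p}" and bc: "b \<in> B" "c \<in> B" using st s t by auto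
      have eq: "b + of_nat i * x = c + of_nat j * x" using st(3) unfolding s t f_def by simp
      define d where "d = int i - int j"
      have dx: "of_int d * x \<in> B"
      proof -
        have "of_int d * x = c - b" unfolding d_def using eq by (simp add: algebra_simps)
        then show ?thesis using Bd bc by simp
      qed
      have "i = j"
      proof (rule ccontr)
        assume "i \<noteq> j"
        then have "d \<noteq> 0" "\<bar>d\<bar> < int ?p" unfolding d_def using ij by auto
        then have "\<not> int ?p dvd d" using zdvd_imp_le[of "int ?p" "\<bar>d\<bar>"] by auto
        moreover have "prime (int ?p)" using p by simp
        ultimately have "coprime (int ?p) d" by (rule prime_imp_coprime[rotated])
        then obtain u where "[d * u = 1] (mod int ?p)"
          using cong_solve_coprime_int coprime_commute by blast
        then have "(of_int (d * u) :: 'a) = of_int 1" by (simp only: of_int_eq_iff_cong_CHAR)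
        then have "of_int u * of_int d = (1 :: 'a)" by (simp add: mult.commute)
        then have "of_int u * (of_int d * x) = x" by (simp only: mult.assoc[symmetric] mult_1_left)
        then show False using Bi[OF dx, of u] x(2) by metis
      qed
      then show "s = t" using eq s t by simp
    qed
    define C where "C = f ` ({..<?p} \<times> B)"
    have "card C = ?p ^ Suc k" unfolding C_def using card_image[OF inj] k by (simp add: card_cartesian_product)
    moreover have "C \<subseteq> A"
    proof
      fix c assume "c \<in> C"
      then obtain i b where c: "c = b + of_nat i * x" "b \<in> B" unfolding C_def f_def by auto
      have "0 - of_nat i * x \<in> A" by (rule A(3)[OF A(2) An[OF x(1)]])
      then have "b - (0 - of_nat i * x) \<in> A" using A(3) c(2) BA by blast
      then show "c \<in> A" using c by simp
    qed
    moreover have memC: "b + of_nat i * x \<in> C" if "b \<in> B" for b i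
    proof -
      have "(of_nat (i mod ?p) :: 'a) = of_nat i" by (simp add: of_nat_eq_iff_cong_CHAR cong_def)
      then have "b + of_nat i * x = f (i mod ?p, b)" unfolding f_def by simp
      moreover have "(i mod ?p, b) \<in> {..<?p} \<times> B" using that prime_gt_0_nat[OF p] by simp
      ultimately show ?thesis unfolding C_def by (metis imageI)
    qed
    moreover have "0 \<in> C" using memC[OF B0, of 0] by simp
    moreover have "c - d \<in> C" if cd: "c \<in> C" "d \<in> C" for c d
    proof -
      obtain i b where c: "c = b + of_nat i * x" "b \<in> B" using cd(1) unfolding C_def f_def by auto
      obtain j e where d: "d = e + of_nat j * x" "e \<in> B" "j < ?p" using cd(2) unfolding C_def f_def by auto
      have "(of_nat (?p - j) :: 'a) = - of_nat j" using d(3) by (simp add: of_nat_diff)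
      then have "c - d = (b - e) + of_nat (i + (?p - j)) * x" unfolding c d by (simp add: algebra_simps)
      then show ?thesis using memC[OF Bd[OF c(2) d(2)]] by metis
    qed
    ultimately have "G C" unfolding G_def by blast
    then have "?p ^ Suc k \<le> ?p ^ k" using max[of C] \<open>card C = ?p ^ Suc k\<close> k by simp
    then show False using prime_gt_1_nat[OF p] by simp
  qed
  then show ?thesis using that k by blast
qed

lemma finite_subring_power_card:
  fixes F :: "'a::field set"
  assumes "finite F" "subring_set F" "x \<in> F"
  shows "x ^ card F = x"
proof (cases "x = 0")
  case True
  have "card F > 0" using assms(1,3) card_gt_0_iff by blast
  then show ?thesis using True by simp
next
  case False
  have "x ^ card (F - {0}) = 1"
    using finite_mult_closed_power_card[of "F - {0}" x] assms False subring_setD(4)[OF assms(2)] by auto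
  moreover have "card F = Suc (card (F - {0}))"
    using assms(1) subring_setD(2)[OF assms(2)] by (metis card_Suc_Diff1)
  ultimately show ?thesis by simp
qed

lemma finite_subring_generator:
  fixes F :: "'a::field set"
  assumes "finite F" "subring_set F"
  obtains w where "w \<in> F" "w \<noteq> 0" "F = insert 0 (range (\<lambda>j::nat. w ^ j))"
proof -
  let ?T = "F - {0}"
  have T: "x * y \<in> ?T" if "x \<in> ?T" "y \<in> ?T" for x y
    using that subring_setD(4)[OF assms(2)] by auto
  have one: "1 \<in> ?T" using subring_setD(1)[OF assms(2)] by simp
  have cT: "card ?T > 0" using one assms(1) card_gt_0_iff by blast
  have "0 dvd x ^ card ?T - 1" if "x \<in> ?T" for x
    using finite_mult_closed_power_card[OF _ _ T that] assms(1) by simp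
  then obtain g where g: "g \<in> ?T" "\<And>x. x \<in> ?T \<Longrightarrow> \<exists>s. 0 dvd x - g ^ s"
    using torsion_modulo_prime_cyclic[of 0 ?T "card ?T"] T one cT by auto
  have "F = insert 0 (range (\<lambda>j::nat. g ^ j))"
  proof (intro equalityI subsetI)
    fix x assume "x \<in> F"
    then show "x \<in> insert 0 (range (\<lambda>j::nat. g ^ j))" using g(2)[of x] by (cases "x = 0") auto
  next
    fix x assume "x \<in> insert 0 (range (\<lambda>j::nat. g ^ j))"
    then show "x \<in> F" using g(1) subring_setD(2,7)[OF assms(2)] by auto
  qed
  then show ?thesis using that g(1) by blast
qed

section \<open>Embeddings of finite subrings and the compactness argument\<close>

text \<open>Integer polynomials can be evaluated in both fields, so relations of \<alpha> are tested
  at \<beta> without identifying the two prime fields.\<close>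

abbreviation int_eval :: "int poly \<Rightarrow> 'a::comm_ring_1 \<Rightarrow> 'a" where
  "int_eval f y \<equiv> poly (map_poly of_int f) y"

lemma map_poly_of_int_hom:
  "map_poly of_int (f + g) = (map_poly of_int f + map_poly of_int g :: 'a::comm_ring_1 poly)"
  "map_poly of_int (f - g) = (map_poly of_int f - map_poly of_int g :: 'a::comm_ring_1 poly)"
  "map_poly of_int (f * g) = (map_poly of_int f * map_poly of_int g :: 'a::comm_ring_1 poly)"
  by (simp_all add: poly_eq_iff coeff_map_poly coeff_mult)

lemma int_eval_simps:
  "int_eval (f + g) y = int_eval f y + int_eval g y"
  "int_eval (f - g) y = int_eval f y - int_eval g y"
  "int_eval (f * g) y = int_eval f y * int_eval g y"
  "int_eval 1 y = 1"
  "int_eval (monom a n) y = of_int a * y ^ n"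
  by (simp_all add: map_poly_of_int_hom map_poly_monom poly_monom)

lemma int_eval_power: "int_eval (f ^ n) y = int_eval f y ^ n"
  by (induction n) (simp_all add: int_eval_simps del: map_poly_1)

lemma int_eval_prod: "int_eval (\<Prod>i\<in>A. f i) y = (\<Prod>i\<in>A. int_eval (f i) y)"
  by (induction A rule: infinite_finite_induct) (simp_all add: int_eval_simps del: map_poly_1)

lemma int_eval_sum: "int_eval (\<Sum>i\<in>A. f i) y = (\<Sum>i\<in>A. int_eval (f i) y)"
  by (induction A rule: infinite_finite_induct) (simp_all add: int_eval_simps)

text \<open>The remainder modulo \<open>X ^ q - X\<close>.\<close>

definition reduce_exponents :: "nat \<Rightarrow> int poly \<Rightarrow> int poly" where
  "reduce_exponents q g =
     (\<Sum>k\<le>degree g. monom (coeff g k) (if k = 0 then 0 else Suc ((k - 1) mod (q - 1))))"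

lemma degree_reduce_exponents:
  assumes "q \<ge> 2"
  shows "degree (reduce_exponents q g) < q"
proof -
  have "degree (reduce_exponents q g) \<le> q - 1"
    unfolding reduce_exponents_def
  proof (rule degree_sum_le)
    fix k
    have "(k - 1) mod (q - 1) < q - 1" using assms by simp
    then have "(if k = 0 then 0 else Suc ((k - 1) mod (q - 1))) \<le> q - 1" by auto
    then show "degree (monom (coeff g k) (if k = 0 then 0 else Suc ((k - 1) mod (q - 1)))) \<le> q - 1"
      using degree_monom_le le_trans by blast
  qed simp
  then show ?thesis using assms by simp
qed

lemma int_eval_reduce_exponents:
  fixes y :: "'a::comm_ring_1"
  assumes y: "y ^ q = y" and q: "q \<ge> 2"
  shows "int_eval (reduce_exponents q g) y = int_eval g y"
proof -
  \<comment> \<open>Exponents are reduced to the range from 1 to q - 1 and exponent 0 is kept apart,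
    because y may be 0.\<close>
  have pow: "y ^ Suc (s + (q - 1) * t) = y ^ Suc s" for s t
  proof (induction t)
    case (Suc t)
    have "Suc (s + (q - 1) * Suc t) = (s + (q - 1) * t) + Suc (q - 1)" by simp
    then have "y ^ Suc (s + (q - 1) * Suc t) = y ^ (s + (q - 1) * t) * (y ^ Suc (q - 1))"
      by (simp only: power_add)
    also have "Suc (q - 1) = q" using q by simp
    finally show ?case using y Suc by (simp add: mult.commute)
  qed simp
  have red: "y ^ (if k = 0 then 0 else Suc ((k - 1) mod (q - 1))) = y ^ k" for k
  proof (cases k)
    case (Suc j)
    have "Suc (j mod (q - 1) + (q - 1) * (j div (q - 1))) = k" using Suc by simp
    then show ?thesis using pow[of "j mod (q - 1)" "j div (q - 1)"] Suc by simp
  qed simp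
  have "int_eval (reduce_exponents q g) y = (\<Sum>k\<le>degree g. of_int (coeff g k) * y ^ k)"
    unfolding reduce_exponents_def int_eval_sum int_eval_simps red ..
  also have "\<dots> = int_eval (\<Sum>k\<le>degree g. monom (coeff g k) k) y"
    unfolding int_eval_sum int_eval_simps ..
  finally show ?thesis by (simp only: poly_as_sum_of_monoms)
qed

text \<open>\<open>F\<close> consists of 0 and the powers of one element \<alpha>. The embedding
  sends \<alpha> to a \<beta> among the roots of y^q = y in the other field that satisfies every
  integer relation of \<alpha>.\<close>

lemma finite_subring_embedding:
  fixes F :: "'a::field set"
  assumes F: "finite F" "subring_set F" and char: "CHAR('b::field) = CHAR('a)" and p: "prime CHAR('a)"
    and card: "card {y :: 'b::field. y ^ card F = y} = card F"
  obtains \<phi> :: "'a \<Rightarrow> 'b::field" where "\<phi> 1 = 1"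
    "\<And>x y. x \<in> F \<Longrightarrow> y \<in> F \<Longrightarrow> \<phi> (x + y) = \<phi> x + \<phi> y"
    "\<And>x y. x \<in> F \<Longrightarrow> y \<in> F \<Longrightarrow> \<phi> (x * y) = \<phi> x * \<phi> y"
proof -
  define q where "q = card F"
  let ?F' = "{y :: 'b. y ^ q = y}"
  have cF': "card ?F' = q" using card unfolding q_def .
  obtain k where k: "q = CHAR('a) ^ k"
    using finite_additive_subgroup_card[OF p F(1) subring_setD(2)[OF F(2)] subring_setD(3)[OF F(2)]]
    unfolding q_def by metis
  have "card {0, 1 :: 'a} \<le> card F"
    using subring_setD(1,2)[OF F(2)] by (intro card_mono F) auto
  then have q2: "q \<ge> 2" unfolding q_def by simp
  have finF': "finite ?F'" by (rule card_ge_0_finite) (use cF' q2 in simp)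
  obtain \<alpha> where \<alpha>: "\<alpha> \<in> F" "F = insert 0 (range (\<lambda>j::nat. \<alpha> ^ j))"
    using finite_subring_generator[OF F] by metis
  have \<alpha>q: "\<alpha> ^ q = \<alpha>" using finite_subring_power_card[OF F \<alpha>(1)] unfolding q_def .
  \<comment> \<open>Reduced modulo X^q - X, such a \<open>g\<close> has degree below q and yet q
    roots, so its coefficients are divisible by the common characteristic.\<close>
  have vanish: "int_eval g \<alpha> = 0" if g: "\<And>y. y \<in> ?F' \<Longrightarrow> int_eval g y = 0" for g
  proof -
    define r where "r = reduce_exponents q g"
    let ?R = "map_poly of_int r :: 'b poly"
    have "?R = 0"
    proof (rule ccontr)
      assume R: "?R \<noteq> 0"
      have "?F' \<subseteq> {y. poly ?R y = 0}"
      proof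
        fix y :: 'b assume y: "y \<in> ?F'"
        then show "y \<in> {y. poly ?R y = 0}"
          using g[OF y] int_eval_reduce_exponents[of y q g] q2 unfolding r_def by simp
      qed
      then have "q \<le> card {y. poly ?R y = 0}"
        using card_mono[OF poly_roots_finite[OF R]] cF' by metis
      also have "\<dots> \<le> degree ?R" by (rule card_poly_roots_bound[OF R])
      also have "\<dots> \<le> degree r" by (rule degree_le) (simp add: coeff_map_poly coeff_eq_0)
      finally show False using degree_reduce_exponents[OF q2, of g] unfolding r_def by simp
    qed
    then have "(of_int (coeff r i) :: 'b) = 0" for i by (metis coeff_0 coeff_map_poly of_int_0)
    then have "(of_int (coeff r i) :: 'a) = 0" for i by (simp add: of_int_eq_0_iff_char_dvd char)
    then have "(map_poly of_int r :: 'a poly) = 0" by (intro poly_eqI) (simp add: coeff_map_poly)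
    then have "int_eval r \<alpha> = 0" by simp
    then show ?thesis using int_eval_reduce_exponents[OF \<alpha>q q2, of g] unfolding r_def by simp
  qed
  have "\<exists>\<beta>\<in>?F'. \<forall>f. int_eval f \<alpha> = 0 \<longrightarrow> int_eval f \<beta> = 0"
  proof (rule ccontr)
    assume "\<not> ?thesis"
    then have "\<forall>\<beta>\<in>?F'. \<exists>f. int_eval f \<alpha> = 0 \<and> int_eval f \<beta> \<noteq> 0" by blast
    from bchoice[OF this] obtain f where
      f: "\<And>\<beta>. \<beta> \<in> ?F' \<Longrightarrow> int_eval (f \<beta>) \<alpha> = 0" "\<And>\<beta>. \<beta> \<in> ?F' \<Longrightarrow> int_eval (f \<beta>) \<beta> \<noteq> 0" by blast
    define g where "g = (\<Prod>\<beta>\<in>?F'. 1 - f \<beta> ^ (q - 1))"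
    have frob: "int_eval h \<beta> ^ q = int_eval h \<beta>" if "\<beta> \<in> ?F'" for h \<beta>
    proof (induction h)
      case 0
      then show ?case using q2 by simp
    next
      case (pCons a h)
      have p': "prime CHAR('b)" using p char by simp
      have "(of_int a :: 'b) ^ q = of_int a"
      proof -
        have 1: "(of_nat n :: 'b) ^ q = of_nat n" for n
        proof (induction n)
          case 0
          then show ?case using q2 by simp
        next
          case (Suc n)
          have "(1 + of_nat n :: 'b) ^ q = 1 ^ q + of_nat n ^ q"
            by (rule freshmans_dream'[OF p', of q k]) (simp add: k char)
          then show ?case using Suc by simp
        qed
        have "(0 - of_nat n :: 'b) ^ q = 0 ^ q - of_nat n ^ q" for n
          using frobenius_diff[OF p', of 0 "of_nat n" k] k char by simp
        then have 2: "(- of_nat n :: 'b) ^ q = - of_nat n" for n using 1 q2 by simp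
        show ?thesis using 1 2 by (cases a) (simp_all del: of_nat_Suc)
      qed
      moreover have "int_eval (pCons a h) \<beta> = of_int a + \<beta> * int_eval h \<beta>"
        by (simp add: map_poly_pCons)
      moreover have "(of_int a + \<beta> * int_eval h \<beta>) ^ q = of_int a ^ q + (\<beta> * int_eval h \<beta>) ^ q"
        by (rule freshmans_dream'[OF p', of q k]) (simp add: k char)
      ultimately show ?case using pCons(2) that by (simp add: power_mult_distrib)
    qed
    have "int_eval g y = 0" if y: "y \<in> ?F'" for y
    proof -
      have "int_eval (f y) y * int_eval (f y) y ^ (q - 1) = int_eval (f y) y ^ q"
        using q2 by (metis power_Suc Suc_diff_1 less_le_trans zero_less_numeral)
      then have "int_eval (f y) y ^ (q - 1) = 1" using frob[OF y, of "f y"] f(2)[OF y] by simp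
      then have "int_eval (1 - f y ^ (q - 1)) y = 0"
        by (simp add: int_eval_simps int_eval_power del: map_poly_1)
      then show ?thesis unfolding g_def int_eval_prod using finF' y by (intro prod_zero) blast+
    qed
    then have "int_eval g \<alpha> = 0" by (rule vanish)
    moreover have "int_eval g \<alpha> = 1"
      unfolding g_def int_eval_prod
      using f(1) q2 by (intro prod.neutral ballI) (simp add: int_eval_simps int_eval_power del: map_poly_1)
    ultimately show False by simp
  qed
  then obtain \<beta> :: 'b where \<beta>: "\<And>f. int_eval f \<alpha> = 0 \<Longrightarrow> int_eval f \<beta> = 0" by blast
  have wd: "int_eval f \<beta> = int_eval g \<beta>" if "int_eval f \<alpha> = int_eval g \<alpha>" for f g
    using \<beta>[of "f - g"] that by (simp add: int_eval_simps)
  have ex: "\<exists>f. int_eval f \<alpha> = x" if "x \<in> F" for x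
  proof -
    consider "x = 0" | j where "x = \<alpha> ^ j" using \<alpha>(2) \<open>x \<in> F\<close> by auto
    then show ?thesis
    proof cases
      case 1
      then show ?thesis by (intro exI[of _ 0]) simp
    next
      case 2
      then show ?thesis by (intro exI[of _ "monom 1 j"]) (simp add: int_eval_simps)
    qed
  qed
  define c where "c x = (SOME f. int_eval f \<alpha> = x)" for x
  define \<phi> where "\<phi> x = (int_eval (c x) \<beta> :: 'b)" for x
  have c: "int_eval (c x) \<alpha> = x" if "x \<in> F" for x
    unfolding c_def using someI_ex[OF ex[OF that]] .
  have \<phi>: "\<phi> x = int_eval f \<beta>" if "x \<in> F" "int_eval f \<alpha> = x" for x f
    unfolding \<phi>_def by (rule wd) (use c that in simp)
  show ?thesis
  proof (rule that[of \<phi>])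
    show "\<phi> 1 = 1" using \<phi>[of 1 1] subring_setD(1)[OF F(2)] by simp
    fix x y assume xy: "x \<in> F" "y \<in> F"
    show "\<phi> (x + y) = \<phi> x + \<phi> y"
      using \<phi>[of "x + y" "c x + c y"] subring_setD(6)[OF F(2) xy] c xy
      by (simp add: int_eval_simps \<phi>_def)
    show "\<phi> (x * y) = \<phi> x * \<phi> y"
      using \<phi>[of "x * y" "c x * c y"] subring_setD(4)[OF F(2) xy] c xy
      by (simp add: int_eval_simps \<phi>_def)
  qed
qed

text \<open>Homomorphisms form an intersection of closed subsets of a product of finite discrete
  spaces. Finitely many conditions involve finitely many elements, hence a finite subring, where
  \<open>finite_subring_embedding\<close> solves them.\<close>

lemma torsion_fields_hom:
  assumes K: "torsion_field TYPE('a::field)"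
    and char: "CHAR('b::field) = CHAR('a::field)"
    and card: "\<And>F :: 'a::field set. finite F \<Longrightarrow> subring_set F \<Longrightarrow> card {y :: 'b::field. y ^ card F = y} = card F"
  obtains f :: "'a::field \<Rightarrow> 'b::field" where "f 1 = 1" "\<And>x y. f (x + y) = f x + f y" "\<And>x y. f (x * y) = f x * f y"
proof -
  \<comment> \<open>This form of the torsion condition includes 0, and \<open>S x\<close> below
    collects the possible images of \<open>x\<close>.\<close>
  have "\<exists>n>0. x * x ^ n = x" for x :: 'a
    using K unfolding torsion_field_def by (cases "x = 0") force+
  then obtain n where n: "\<And>x :: 'a. n x > 0" "\<And>x :: 'a. x * x ^ n x = x" by metis
  define S where "S x = {y :: 'b. y * y ^ n x = y}" for x
  have "S x = insert 0 {y. y ^ n x = 1}" for x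
    unfolding S_def using n(1)[of x] by (auto simp: power_0_left)
  then have finS: "finite (S x)" for x using card_roots_of_unity_le(1)[OF n(1)] by simp
  have S0: "0 \<in> S x" for x unfolding S_def by simp
  define X where "X = product_topology (\<lambda>x. discrete_topology (S x)) (UNIV :: 'a set)"
  have topX: "f \<in> topspace X \<longleftrightarrow> (\<forall>x. f x \<in> S x)" for f
    unfolding X_def by (auto simp: PiE_iff)
  have comp: "compact_space X"
    unfolding X_def compact_space_product_topology using finS by (simp add: compact_space_discrete_topology)
  have proj: "continuous_map X (discrete_topology UNIV) (\<lambda>f. f x)" for x
  proof -
    have "continuous_map X (discrete_topology (S x)) (\<lambda>f. f x)"
      unfolding X_def by (rule continuous_map_product_projection) simp
    then have "continuous_map X (discrete_topology (S x)) ((\<lambda>y. y) \<circ> (\<lambda>f. f x))" by (simp add: comp_def)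
    moreover have "continuous_map (discrete_topology (S x)) (discrete_topology UNIV) (\<lambda>y. y)" by simp
    ultimately show ?thesis using continuous_map_compose[of X _ "\<lambda>f. f x" _ "\<lambda>y. y"]
      \<open>continuous_map X (discrete_topology (S x)) (\<lambda>f. f x)\<close> by (simp add: comp_def)
  qed
  have op: "continuous_map X (discrete_topology UNIV) (\<lambda>f. h (f x) (f y))" for h :: "'b \<Rightarrow> 'b \<Rightarrow> 'b" and x y
  proof -
    have "continuous_map X (prod_topology (discrete_topology UNIV) (discrete_topology UNIV)) (\<lambda>f. (f x, f y))"
      using proj by (intro continuous_map_pairedI)
    then have "continuous_map X (discrete_topology UNIV) (\<lambda>f. (f x, f y))"
      by (simp flip: prod_topology_discrete_topology)
    moreover have "continuous_map (discrete_topology UNIV) (discrete_topology UNIV) (\<lambda>(a, b). h a b)" by simp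
    ultimately show ?thesis using continuous_map_compose[of X _ "\<lambda>f. (f x, f y)" _ "\<lambda>(a, b). h a b"]
      by (simp add: comp_def)
  qed
  define D where "D x y = {f \<in> topspace X. f 1 = 1} \<inter> {f \<in> topspace X. f (x + y) = f x + f y} \<inter>
    {f \<in> topspace X. f (x * y) = f x * f y}" for x y
  have H: "Hausdorff_space (discrete_topology (UNIV :: 'b set))" by simp
  have closed: "closedin X (D x y)" for x y
  proof -
    have "closedin X {f \<in> topspace X. f 1 = 1}"
      by (rule closedin_continuous_maps_eq[OF H proj]) simp
    moreover have "closedin X {f \<in> topspace X. f (x + y) = f x + f y}"
      by (rule closedin_continuous_maps_eq[OF H proj op])
    moreover have "closedin X {f \<in> topspace X. f (x * y) = f x * f y}"
      by (rule closedin_continuous_maps_eq[OF H proj op])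
    ultimately show ?thesis unfolding D_def by (intro closedin_Int)
  qed
  have fip: "\<Inter>\<F> \<noteq> {}" if fin: "finite \<F>" "\<F> \<subseteq> range (\<lambda>(x, y). D x y)" for \<F>
  proof -
    obtain P where P: "finite P" "\<F> = (\<lambda>(x, y). D x y) ` P"
      using finite_subset_image[OF fin] by blast
    have "finite (fst ` P \<union> snd ` P)" using P(1) by simp
    then obtain F where F: "finite F" "subring_set F" "fst ` P \<union> snd ` P \<subseteq> F"
      using torsion_field_finite_subring[OF K] by metis
    obtain \<phi> :: "'a \<Rightarrow> 'b" where \<phi>: "\<phi> 1 = 1"
      "\<And>x y. x \<in> F \<Longrightarrow> y \<in> F \<Longrightarrow> \<phi> (x + y) = \<phi> x + \<phi> y"
      "\<And>x y. x \<in> F \<Longrightarrow> y \<in> F \<Longrightarrow> \<phi> (x * y) = \<phi> x * \<phi> y"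
      using finite_subring_embedding[OF F(1,2) char torsion_field_prime_char[OF K] card[OF F(1,2)]] by metis
    \<comment> \<open>The value 0 lies in every \<open>S x\<close>, so it is admissible outside of
      \<open>F\<close>.\<close>
    define f where "f x = (if x \<in> F then \<phi> x else 0)" for x
    have pow: "\<phi> (x ^ k) = \<phi> x ^ k" if "x \<in> F" for x k
      by (induction k) (use \<phi> that subring_setD(7)[OF F(2)] in auto)
    have "f x \<in> S x" for x
    proof (cases "x \<in> F")
      case True
      have "\<phi> (x * x ^ n x) = \<phi> x * \<phi> x ^ n x" using \<phi>(3)[OF True subring_setD(7)[OF F(2) True]] pow[OF True] by simp
      then have "\<phi> x * \<phi> x ^ n x = \<phi> x" using n(2)[of x] by simp
      then show ?thesis unfolding f_def S_def using True by simp
    qed (simp add: f_def S0)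
    then have "f \<in> topspace X" using topX by blast
    moreover have "f 1 = 1" unfolding f_def using \<phi>(1) subring_setD(1)[OF F(2)] by simp
    moreover have "f (x + y) = f x + f y" "f (x * y) = f x * f y" if "(x, y) \<in> P" for x y
    proof -
      have "x \<in> F" "y \<in> F" using F(3) that by force+
      then show "f (x + y) = f x + f y" "f (x * y) = f x * f y"
        unfolding f_def using \<phi>(2,3) subring_setD(4,6)[OF F(2)] by auto
    qed
    ultimately have "f \<in> \<Inter>\<F>" unfolding P(2) D_def by auto
    then show ?thesis by blast
  qed
  have "\<Inter>(range (\<lambda>(x, y). D x y)) \<noteq> {}"
    using comp[unfolded compact_space_fip, rule_format, of "range (\<lambda>(x, y). D x y)"] closed fip by auto
  then obtain f where f: "\<And>x y. f \<in> D x y" by auto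
  show ?thesis
    by (rule that[of f]) (use f in \<open>auto simp: D_def\<close>)
qed

text \<open>The homomorphism is injective. For surjectivity, \<open>y\<close> solves y^q = y for
  some q; there are q solutions in the source, and their images exhaust the at most q solutions in
  the target.\<close>

lemma torsion_fields_iso:
  assumes K: "torsion_field TYPE('a::field)" and L: "torsion_field TYPE('b::field)"
    and char: "CHAR('b::field) = CHAR('a::field)"
    and card: "\<And>F :: 'a::field set. finite F \<Longrightarrow> subring_set F \<Longrightarrow> card {y :: 'b::field. y ^ card F = y} = card F"
    and card': "\<And>F :: 'b::field set. finite F \<Longrightarrow> subring_set F \<Longrightarrow> card {y :: 'a::field. y ^ card F = y} = card F"
  obtains f :: "'a::field \<Rightarrow> 'b::field" where "field_iso f"
proof -
  obtain f :: "'a \<Rightarrow> 'b" where f: "f 1 = 1" "\<And>x y. f (x + y) = f x + f y" "\<And>x y. f (x * y) = f x * f y"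
    using torsion_fields_hom[OF K char card] by metis
  have fz: "x = 0" if "f x = 0" for x
  proof (rule ccontr)
    assume "x \<noteq> 0"
    then have "f x * f (inverse x) = 1" using f(1) f(3)[of x "inverse x"] by simp
    then show False using that by simp
  qed
  have inj: "inj f"
  proof (rule injI)
    fix x y assume xy: "f x = f y"
    have "f (x - y) + f y = f x" using f(2)[of "x - y" y] by simp
    then have "f (x - y) = 0" using xy by simp
    then show "x = y" using fz by fastforce
  qed
  have fpow: "f (x ^ k) = f x ^ k" for x k by (induction k) (simp_all add: f)
  have "y \<in> range f" for y
  proof -
    obtain F where F: "finite F" "subring_set F" "{y} \<subseteq> F"
      using torsion_field_finite_subring[OF L, of "{y}"] by auto
    define q where "q = card F"
    have "card {0, 1 :: 'b} \<le> card F"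
      using subring_setD(1,2)[OF F(2)] by (intro card_mono F) auto
    then have q2: "q \<ge> 2" unfolding q_def by simp
    have eq: "{y :: 'b. y ^ q = y} = insert 0 {y. y ^ (q - 1) = 1}"
    proof (intro set_eqI)
      fix z :: 'b
      have "z ^ q = z * z ^ (q - 1)" using q2 by (metis power_Suc Suc_diff_1 less_le_trans zero_less_numeral)
      then show "z \<in> {y. y ^ q = y} \<longleftrightarrow> z \<in> insert 0 {y. y ^ (q - 1) = 1}" by auto
    qed
    have q1: "q - 1 > 0" using q2 by simp
    have fin: "finite {y :: 'b. y ^ q = y}" unfolding eq using card_roots_of_unity_le(1)[OF q1] by simp
    have "card {y :: 'b. y ^ q = y} \<le> Suc (card {y :: 'b. y ^ (q - 1) = 1})"
      unfolding eq by (rule card_insert_le_m1) (use q1 in simp_all)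
    also have "\<dots> \<le> q" using card_roots_of_unity_le(2)[OF q1, where 'a='b] q2 by simp
    finally have le: "card {y :: 'b. y ^ q = y} \<le> q" .
    have "f ` {x :: 'a. x ^ q = x} \<subseteq> {y. y ^ q = y}" using fpow by (auto, metis)
    moreover have "card (f ` {x :: 'a. x ^ q = x}) = q"
      using card_image[OF inj_on_subset[OF inj subset_UNIV]] card'[OF F(1,2)] unfolding q_def by metis
    ultimately have "f ` {x :: 'a. x ^ q = x} = {y. y ^ q = y}"
      using card_seteq[OF fin] le by metis
    moreover have "y ^ q = y" using finite_subring_power_card[OF F(1,2)] F(3) unfolding q_def by simp
    ultimately show ?thesis by blast
  qed
  then have "field_iso f" unfolding field_iso_def bij_def using f inj by auto
  then show ?thesis using that by blast
qed

lemma golomb_equivalence_finite_subring: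
  fixes h :: "'a::field poly \<Rightarrow> 'b::field poly" and F :: "'b set"
  assumes eq: "golomb_equivalence h g" and K: "torsion_field TYPE('a)"
    and F: "finite F" "subring_set F"
  shows "card {v :: 'a. v ^ card F = v} = card F"
proof -
  obtain w where w: "w \<in> F" "w \<noteq> 0" "F = insert 0 (range (\<lambda>j::nat. w ^ j))"
    using finite_subring_generator[OF F] by metis
  define m where "m = card (range (\<lambda>j::nat. w ^ j))"
  have "finite (range (\<lambda>j::nat. w ^ j))" using w(3) F(1) by (metis finite_insert)
  moreover have "0 \<notin> range (\<lambda>j::nat. w ^ j)" using w(2) by auto
  ultimately have q: "card F = Suc m" unfolding m_def by (subst w(3)) simp
  have m0: "m > 0" unfolding m_def using \<open>finite (range (\<lambda>j::nat. w ^ j))\<close> by (simp add: card_gt_0_iff)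
  have "card {v :: 'a. v ^ m = 1} = m"
    using golomb_equivalence_roots_of_unity[OF eq K w(2)] unfolding m_def .
  moreover have "{v :: 'a. v ^ Suc m = v} = insert 0 {v. v ^ m = 1}" by auto
  moreover have "0 \<notin> {v :: 'a. v ^ m = 1}" using m0 by (simp add: power_0_left)
  ultimately show ?thesis unfolding q using card_roots_of_unity_le(1)[OF m0, where 'a='a] by simp
qed

unbundle no vec_syntax

section \<open>Additive subgroups of finite index\<close>

definition add_subgroup :: "'a::ab_group_add set \<Rightarrow> bool" where
  "add_subgroup G \<longleftrightarrow> 0 \<in> G \<and> (\<forall>x\<in>G. \<forall>y\<in>G. x - y \<in> G)"

definition finite_index :: "'a::ab_group_add set \<Rightarrow> bool" where
  "finite_index W \<longleftrightarrow> add_subgroup W \<and> (\<exists>T. finite T \<and> (\<forall>x. \<exists>t\<in>T. x - t \<in> W))"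

lemma add_subgroupD:
  assumes "add_subgroup G"
  shows "0 \<in> G" "x \<in> G \<Longrightarrow> y \<in> G \<Longrightarrow> x - y \<in> G" "x \<in> G \<Longrightarrow> - x \<in> G" "x \<in> G \<Longrightarrow> y \<in> G \<Longrightarrow> x + y \<in> G"
proof -
  show 0: "0 \<in> G" and d: "\<And>x y. x \<in> G \<Longrightarrow> y \<in> G \<Longrightarrow> x - y \<in> G"
    using assms unfolding add_subgroup_def by auto
  show m: "\<And>x. x \<in> G \<Longrightarrow> - x \<in> G" using d[OF 0] by simp
  show "\<And>x y. x \<in> G \<Longrightarrow> y \<in> G \<Longrightarrow> x + y \<in> G" using d m by (metis diff_minus_eq_add)
qed

lemma add_subgroup_sum:
  "add_subgroup G \<Longrightarrow> (\<And>i. i \<in> A \<Longrightarrow> f i \<in> G) \<Longrightarrow> (\<Sum>i\<in>A. f i) \<in> G"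
  by (induction A rule: infinite_finite_induct) (auto intro: add_subgroupD)

lemma finite_index_UNIV: "finite_index UNIV"
  unfolding finite_index_def add_subgroup_def by (auto intro: exI[of _ "{0}"])

lemma finite_index_Int:
  assumes "finite_index V" "finite_index W"
  shows "finite_index (V \<inter> W)"
proof -
  have V: "add_subgroup V" and W: "add_subgroup W" using assms unfolding finite_index_def by auto
  obtain S where S: "finite S" "\<And>x. \<exists>s\<in>S. x - s \<in> V" using assms(1) unfolding finite_index_def by metis
  obtain T where T: "finite T" "\<And>x. \<exists>t\<in>T. x - t \<in> W" using assms(2) unfolding finite_index_def by metis
  define r where "r = (\<lambda>(s, t). SOME y. y - s \<in> V \<and> y - t \<in> W)"
  have "\<exists>t\<in>r ` (S \<times> T). x - t \<in> V \<inter> W" for x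
  proof -
    obtain s t where st: "s \<in> S" "x - s \<in> V" "t \<in> T" "x - t \<in> W" using S(2) T(2) by metis
    then have "r (s, t) - s \<in> V \<and> r (s, t) - t \<in> W"
      unfolding r_def prod.case by (intro someI[of "\<lambda>y. y - s \<in> V \<and> y - t \<in> W" x]) simp
    then have "(x - s) - (r (s, t) - s) \<in> V" "(x - t) - (r (s, t) - t) \<in> W"
      using st add_subgroupD(2)[OF V, of "x - s"] add_subgroupD(2)[OF W, of "x - t"] by blast+
    then have "x - r (s, t) \<in> V \<inter> W" by simp
    then show ?thesis using st(1,3) by (intro bexI[of _ "r (s, t)"]) auto
  qed
  moreover have "finite (r ` (S \<times> T))" using S(1) T(1) by simp
  moreover have "add_subgroup (V \<inter> W)" using V W unfolding add_subgroup_def by simp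
  ultimately show ?thesis unfolding finite_index_def by blast
qed

lemma finite_index_vimage_mult:
  fixes W :: "'a::field set"
  assumes "finite_index W"
  shows "finite_index {x. a * x \<in> W}"
proof (cases "a = 0")
  case True
  then have "{x. a * x \<in> W} = UNIV"
    using assms add_subgroupD(1) unfolding finite_index_def by auto
  then show ?thesis using finite_index_UNIV by metis
next
  case False
  obtain T where T: "finite T" "\<And>x. \<exists>t\<in>T. x - t \<in> W" using assms unfolding finite_index_def by metis
  have "\<exists>t\<in>(\<lambda>t. t / a) ` T. x - t \<in> {x. a * x \<in> W}" for x
  proof -
    obtain t where "t \<in> T" "a * x - t \<in> W" using T(2) by metis
    then show ?thesis using False by (intro bexI[of _ "t / a"]) (auto simp: right_diff_distrib)
  qed
  moreover have "finite ((\<lambda>t. t / a) ` T)" using T(1) by simp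
  moreover have "add_subgroup {x. a * x \<in> W}"
    using assms unfolding finite_index_def add_subgroup_def by (simp add: right_diff_distrib)
  ultimately show ?thesis unfolding finite_index_def by blast
qed

lemma finite_index_INT:
  assumes "finite I" "\<And>i. i \<in> I \<Longrightarrow> finite_index (W i)"
  shows "finite_index {x. \<forall>i\<in>I. x \<in> W i}"
  using assms
proof (induction I)
  case empty
  then show ?case using finite_index_UNIV by simp
next
  case (insert i I)
  have "{x. \<forall>j\<in>insert i I. x \<in> W j} = W i \<inter> {x. \<forall>j\<in>I. x \<in> W j}" by auto
  then show ?case using finite_index_Int[of "W i"] insert by simp
qed

lemma finite_index_infinite:
  assumes "finite_index (W :: 'a::ab_group_add set)" "infinite (UNIV :: 'a set)"
  shows "infinite W"
proof
  assume "finite W"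
  obtain T where T: "finite T" "\<And>x. \<exists>t\<in>T. x - t \<in> W" using assms(1) unfolding finite_index_def by metis
  have "x \<in> (\<lambda>(t, w). t + w) ` (T \<times> W)" for x
  proof -
    obtain t where "t \<in> T" "x - t \<in> W" using T(2) by metis
    then show ?thesis by (intro image_eqI[of _ _ "(t, x - t)"]) auto
  qed
  then have "(UNIV :: 'a set) \<subseteq> (\<lambda>(t, w). t + w) ` (T \<times> W)" by blast
  then show False using assms(2) \<open>finite W\<close> T(1) finite_subset by blast
qed

text \<open>Infinitely many multiples of a finite index subgroup inside \<open>G\<close> force the multiplier ring of
  \<open>G\<close> to be infinite, and \<open>K / G\<close> is a finite vector space over it.\<close>

lemma add_subgroup_eq_UNIV:
  fixes G W :: "'a::field set"
  assumes K: "torsion_field TYPE('a)" and G: "add_subgroup G" and W: "finite_index W"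
    and I: "infinite I" "\<And>s w. s \<in> I \<Longrightarrow> w \<in> W \<Longrightarrow> s * w \<in> G"
  shows "G = UNIV"
proof -
  obtain T where T: "finite T" "\<And>x. \<exists>t\<in>T. x - t \<in> W" using W unfolding finite_index_def by metis
  \<comment> \<open>\<open>\<tau> s\<close> records which representatives modulo \<open>W\<close>
    are carried into \<open>G\<close> by \<open>s\<close>. There are finitely many possibilities, so
    infinitely many \<open>s\<close> share one.\<close>
  define \<tau> where "\<tau> s = {t \<in> T. s * t \<in> G}" for s
  have I0: "infinite (I - {0})" using I(1) by simp
  have "\<tau> ` (I - {0}) \<subseteq> Pow T" unfolding \<tau>_def by auto
  then have "finite (\<tau> ` (I - {0}))" using T(1) finite_subset by blast
  then obtain s0 where s0: "s0 \<in> I - {0}" "infinite {s \<in> I - {0}. \<tau> s = \<tau> s0}"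
    using pigeonhole_infinite[OF I0] by metis
  \<comment> \<open>These quotients multiply \<open>G\<close> into itself: write g / s0 = t + w with
    t in T and w in W. Then s0 t lies in G, hence so does s t, and with s w also s g / s0.\<close>
  define J where "J = (\<lambda>s. s / s0) ` {s \<in> I - {0}. \<tau> s = \<tau> s0}"
  have "inj_on (\<lambda>s. s / s0) {s \<in> I - {0}. \<tau> s = \<tau> s0}" using s0(1) by (intro inj_onI) simp
  then have infJ: "infinite J" unfolding J_def using s0(2) by (simp add: finite_image_iff)
  have J: "r * g \<in> G" if r: "r \<in> J" and g: "g \<in> G" for r g
  proof -
    obtain s where s: "s \<in> I" "\<tau> s = \<tau> s0" "r = s / s0" using r unfolding J_def by auto
    obtain t where t: "t \<in> T" "g / s0 - t \<in> W" using T(2) by metis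
    define w where "w = g / s0 - t"
    have eq: "g / s0 = t + w" unfolding w_def by simp
    have "g = s0 * (g / s0)" using s0(1) by simp
    then have "s0 * t = g - s0 * w" unfolding eq by (simp add: algebra_simps)
    also have "\<dots> \<in> G" using add_subgroupD(2)[OF G g] I(2)[of s0 w] s0(1) t(2) unfolding w_def by simp
    finally have "t \<in> \<tau> s0" unfolding \<tau>_def using t(1) by simp
    then have "s * t \<in> G" using s(2) unfolding \<tau>_def by blast
    moreover have "s * w \<in> G" using I(2)[OF s(1)] t(2) unfolding w_def by simp
    ultimately have "s * t + s * w \<in> G" by (rule add_subgroupD(4)[OF G])
    moreover have "r * g = s * (g / s0)" unfolding s(3) by simp
    ultimately show ?thesis unfolding eq by (simp add: distrib_left)
  qed
  define R where "R = {r. \<forall>g\<in>G. r * g \<in> G}"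
  have R: "r - r' \<in> R" if "r \<in> R" "r' \<in> R" for r r'
    using that add_subgroupD(2)[OF G] unfolding R_def by (simp add: left_diff_distrib)
  have Rpow: "r ^ n \<in> R" if "r \<in> R" for r n
    by (induction n) (use that in \<open>auto simp: R_def mult.assoc\<close>)
  have "J \<subseteq> R" using J unfolding R_def by blast
  then have infR: "infinite R" using infJ finite_subset by blast
  define c where "c x = (SOME t. t \<in> T \<and> x - t \<in> W)" for x
  have c: "c x \<in> T" "x - c x \<in> W" for x
    using someI_ex[of "\<lambda>t. t \<in> T \<and> x - t \<in> W"] T(2)[of x] unfolding c_def by auto
  have "x \<in> G" for x
  proof -
    \<comment> \<open>There are more multipliers than classes modulo \<open>W\<close>, so two of
      them agree on x / s0 modulo \<open>W\<close>; multiplying the difference by s0 gives (r - r')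
      x in G.\<close>
    have "finite ((\<lambda>r. c (r * x / s0)) ` R)"
      by (rule finite_subset[OF _ T(1)]) (use c(1) in auto)
    then have "\<not> inj_on (\<lambda>r. c (r * x / s0)) R" using infR finite_imageD by blast
    then obtain r r' where rr: "r \<in> R" "r' \<in> R" "r \<noteq> r'" "c (r * x / s0) = c (r' * x / s0)"
      unfolding inj_on_def by blast
    have "(r * x / s0 - c (r * x / s0)) - (r' * x / s0 - c (r' * x / s0)) \<in> W"
      using W add_subgroupD(2)[OF _ c(2) c(2)] unfolding finite_index_def by simp
    then have "r * x / s0 - r' * x / s0 \<in> W" using rr(4) by simp
    then have "s0 * (r * x / s0 - r' * x / s0) \<in> G" using I(2) s0(1) by blast
    moreover have "s0 * (r * x / s0 - r' * x / s0) = (r - r') * x" using s0(1) by (simp add: field_simps)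
    ultimately have rx: "(r - r') * x \<in> G" by simp
    \<comment> \<open>The inverse of r - r' is one of its powers, hence again a multiplier of
      \<open>G\<close>.\<close>
    obtain k where k: "k > 0" "(r - r') ^ k = 1" using K rr(3) unfolding torsion_field_def
      by (metis right_minus_eq)
    have "(r - r') ^ (k - 1) \<in> R" using Rpow[OF R[OF rr(1,2)]] .
    then have "(r - r') ^ (k - 1) * ((r - r') * x) \<in> G" using rx unfolding R_def by blast
    moreover have "(r - r') ^ (k - 1) * ((r - r') * x) = x"
      using k by (metis mult.assoc mult_1 power_minus_mult)
    ultimately show ?thesis by (simp only:)
  qed
  then show ?thesis by blast
qed

section \<open>Generation by linear polynomials\<close>

abbreviation lin :: "'a::field \<Rightarrow> 'a fps" where "lin b \<equiv> 1 + fps_const b * fps_X"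

text \<open>Power series make the factors 1 + b X invertible, and X-adic approximation becomes
  agreement of low coefficients.\<close>

inductive_set lin_group :: "'a::field set \<Rightarrow> 'a fps set" for H where
  one: "1 \<in> lin_group H"
| mult: "f \<in> lin_group H \<Longrightarrow> b \<in> H \<Longrightarrow> f * lin b \<in> lin_group H"
| div: "f \<in> lin_group H \<Longrightarrow> b \<in> H \<Longrightarrow> f * inverse (lin b) \<in> lin_group H"

lemma lin_nth: "lin b $ 0 = 1" "lin b $ Suc 0 = b" "lin b * inverse (lin b) = 1"
  by (simp_all add: inverse_mult_eq_1')

lemma lin_group_nth_0: "f \<in> lin_group H \<Longrightarrow> f $ 0 = 1"
  by (induction rule: lin_group.induct) simp_all

lemma lin_in_lin_group: "b \<in> H \<Longrightarrow> lin b \<in> lin_group H" "b \<in> H \<Longrightarrow> inverse (lin b) \<in> lin_group H"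
  using lin_group.mult[OF lin_group.one] lin_group.div[OF lin_group.one] by (metis mult_1)+

lemma lin_group_mult: "g \<in> lin_group H \<Longrightarrow> f \<in> lin_group H \<Longrightarrow> f * g \<in> lin_group H"
  by (induction rule: lin_group.induct)
    (auto simp del: mult.assoc simp add: mult.assoc[symmetric] intro: lin_group.intros)

lemma lin_group_inverse: "f \<in> lin_group H \<Longrightarrow> inverse f \<in> lin_group H"
proof (induction rule: lin_group.induct)
  case one
  then show ?case by (simp add: lin_group.one)
next
  case (mult f b)
  then show ?case using lin_group.div by (simp add: fps_inverse_mult)
next
  case (div f b)
  have "inverse (inverse (lin b)) = lin b" by (rule fps_inverse_idempotent) simp
  then show ?case using div lin_group.mult[OF div.IH div.hyps(2)] by (simp add: fps_inverse_mult)
qed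

lemma lin_group_mono:
  assumes "f \<in> lin_group S" "S \<subseteq> H"
  shows "f \<in> lin_group H"
  using assms(1) by (induction rule: lin_group.induct) (use assms(2) in \<open>auto intro: lin_group.intros\<close>)

lemma lin_group_finite_support:
  assumes "f \<in> lin_group H"
  obtains S where "finite S" "S \<subseteq> H" "f \<in> lin_group S"
proof -
  have "\<exists>S. finite S \<and> S \<subseteq> H \<and> f \<in> lin_group S"
    using assms
  proof (induction rule: lin_group.induct)
    case one
    then show ?case by (intro exI[of _ "{}"]) (simp add: lin_group.one)
  next
    case (mult f b)
    then obtain S where S: "finite S" "S \<subseteq> H" "f \<in> lin_group S" by blast
    have "f * lin b \<in> lin_group (insert b S)"
      by (intro lin_group.mult lin_group_mono[OF S(3)]) auto
    then show ?case using S mult(2) by (intro exI[of _ "insert b S"]) simp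
  next
    case (div f b)
    then obtain S where S: "finite S" "S \<subseteq> H" "f \<in> lin_group S" by blast
    have "f * inverse (lin b) \<in> lin_group (insert b S)"
      by (intro lin_group.div lin_group_mono[OF S(3)]) auto
    then show ?case using S div(2) by (intro exI[of _ "insert b S"]) simp
  qed
  then show ?thesis using that by blast
qed

lemma lin_group_compose:
  fixes s :: "'a::field fps"
  assumes f: "f \<in> lin_group S" and s: "s $ 0 = 0" and lin: "\<And>b. b \<in> S \<Longrightarrow> lin b oo s \<in> lin_group H"
  shows "f oo s \<in> lin_group H"
  using f
proof (induction rule: lin_group.induct)
  case one
  then show ?case by (simp add: lin_group.one)
next
  case (mult f b)
  then show ?case using lin_group_mult[OF lin mult.IH] by (simp only: fps_compose_mult_distrib[OF s])
next
  case (div f b)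
  have "inverse (lin b) oo s = inverse (lin b oo s)"
    by (rule fps_inverse_compose[OF s]) simp
  then have "f * inverse (lin b) oo s = (f oo s) * inverse (lin b oo s)"
    by (simp only: fps_compose_mult_distrib[OF s])
  then show ?case using div lin lin_group_mult lin_group_inverse by metis
qed

text \<open>The \<open>m\<close>-th graded piece of the group generated by the \<open>1 + b X\<close> for \<open>b \<in> H\<close>.\<close>

definition leading :: "nat \<Rightarrow> 'a::field set \<Rightarrow> 'a set" where
  "leading m H = {u $ 0 | u. 1 + fps_X ^ m * u \<in> lin_group H}"

lemma leading_quotient:
  fixes f g u :: "'a::field fps"
  assumes "f \<in> lin_group H" "g \<in> lin_group H" "f = g + fps_X ^ m * u"
  shows "u $ 0 \<in> leading m H"
proof -
  have g: "g $ 0 = 1" "g * inverse g = 1" using lin_group_nth_0[OF assms(2)] by (simp_all add: inverse_mult_eq_1')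
  have "f * inverse g = g * inverse g + fps_X ^ m * u * inverse g" unfolding assms(3) by (rule distrib_right)
  then have "f * inverse g = 1 + fps_X ^ m * (u * inverse g)" using g(2) by (simp add: mult.assoc)
  then have "1 + fps_X ^ m * (u * inverse g) \<in> lin_group H"
    using lin_group_mult[OF lin_group_inverse[OF assms(2)] assms(1)] by simp
  moreover have "(u * inverse g) $ 0 = u $ 0" using g(1) by simp
  ultimately show ?thesis unfolding leading_def by (intro CollectI exI[of _ "u * inverse g"]) simp
qed

lemma add_subgroup_leading: "add_subgroup (leading m (H :: 'a::field set))"
  unfolding add_subgroup_def
proof (intro conjI ballI)
  have "1 + fps_X ^ m * 0 \<in> lin_group H" by (simp add: lin_group.one)
  then show "0 \<in> leading m H" unfolding leading_def by (intro CollectI exI[of _ 0]) simp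
next
  fix c d assume "c \<in> leading m H" "d \<in> leading m H"
  then obtain u v where u: "c = u $ 0" "1 + fps_X ^ m * u \<in> lin_group H"
    and v: "d = v $ 0" "1 + fps_X ^ m * v \<in> lin_group H" unfolding leading_def by blast
  have "(u - v) $ 0 \<in> leading m H"
    by (rule leading_quotient[OF u(2) v(2)]) (simp add: algebra_simps)
  then show "c - d \<in> leading m H" using u(1) v(1) by simp
qed

text \<open>Substituting a X for X turns 1 + b X into 1 + a b X and multiplies the coefficient of
  X^m by a^m.\<close>

lemma leading_scale:
  fixes H :: "'a::field set"
  assumes "1 + fps_X ^ m * u \<in> lin_group S" "\<And>b. b \<in> S \<Longrightarrow> a * b \<in> H"
  shows "a ^ m * u $ 0 \<in> leading m H"
proof -
  let ?s = "fps_const a * fps_X"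
  have s: "?s $ 0 = 0" by simp
  have "(1 + fps_X ^ m * u) oo ?s \<in> lin_group H"
  proof (rule lin_group_compose[OF assms(1) s])
    fix b assume "b \<in> S"
    have "lin b oo ?s = lin (a * b)"
      by (simp add: fps_compose_add_distrib fps_compose_mult_distrib mult.commute mult.left_commute
          flip: fps_const_mult)
    then show "lin b oo ?s \<in> lin_group H" using assms(2)[OF \<open>b \<in> S\<close>] lin_in_lin_group(1) by metis
  qed
  moreover have "(1 + fps_X ^ m * u) oo ?s = 1 + fps_X ^ m * (fps_const (a ^ m) * (u oo ?s))"
    by (simp add: fps_compose_add_distrib fps_compose_mult_distrib fps_X_power_compose power_mult_distrib
        fps_const_power mult.commute mult.left_commute)
  ultimately show ?thesis unfolding leading_def
    by (intro CollectI exI[of _ "fps_const (a ^ m) * (u oo ?s)"]) simp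
qed

lemma fps_power_nth_Suc_0:
  fixes a :: "'a::comm_ring_1 fps"
  assumes "a $ 0 = 1"
  shows "(a ^ m) $ Suc 0 = of_nat m * a $ Suc 0"
proof (induction m)
  case (Suc m)
  have "(a ^ m) $ 0 = 1" using assms by (simp add: fps_power_zeroth)
  then show ?case using Suc assms by (simp add: fps_mult_nth_1 algebra_simps)
qed simp

text \<open>Translating all the \<open>b\<close> amounts to the substitution of \<open>X / (1 + b X)\<close> for \<open>X\<close>.\<close>

lemma leading_shift:
  fixes H :: "'a::field set"
  assumes H: "add_subgroup H" and c: "c \<in> leading m H" and b: "b \<in> H"
  shows "- of_nat m * c * b \<in> leading (Suc m) H"
proof -
  obtain u where u: "c = u $ 0" "1 + fps_X ^ m * u \<in> lin_group H" using c unfolding leading_def by blast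
  define L where "L = inverse (lin b)"
  define s where "s = fps_X * L"
  have L0: "L $ 0 = 1" unfolding L_def by simp
  have "lin b * L = 1" unfolding L_def by (rule lin_nth)
  then have "(lin b * L) $ Suc 0 = 0" by simp
  then have L1: "L $ Suc 0 = - b" using L0 by (simp add: fps_mult_nth_1 add_eq_0_iff)
  have s0: "s $ 0 = 0" and s1: "s $ Suc 0 = 1" unfolding s_def using L0 by (simp_all add: fps_mult_nth_1)
  have mem: "(1 + fps_X ^ m * u) oo s \<in> lin_group H"
  proof (rule lin_group_compose[OF u(2) s0])
    fix d assume d: "d \<in> H"
    \<comment> \<open>1 + d X / (1 + b X) is the quotient of 1 + (b + d) X by 1 + b X.\<close>
    have "lin d oo s = 1 + fps_const d * s"
      by (simp add: fps_compose_add_distrib fps_compose_mult_distrib[OF s0] fps_X_fps_compose_startby0[OF s0])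
    also have "\<dots> = lin b * L + fps_const d * fps_X * L" using \<open>lin b * L = 1\<close> unfolding s_def by (simp add: mult.assoc)
    also have "\<dots> = lin (b + d) * L" by (simp add: algebra_simps flip: fps_const_add)
    finally show "lin d oo s \<in> lin_group H"
      using lin_group.div[OF lin_in_lin_group(1)[OF add_subgroupD(4)[OF H b d]] b] unfolding L_def by simp
  qed
  \<comment> \<open>The substitution changes the series by X^m w. The constant terms cancel; the
    next coefficient comes from L^m = 1 - m b X + ..., as s = X + ... preserves that of
    \<open>u\<close>.\<close>
  define w where "w = L ^ m * (u oo s) - u"
  have Lm: "(L ^ m) $ 0 = 1" "(L ^ m) $ Suc 0 = - of_nat m * b"
    using fps_power_nth_Suc_0[OF L0, of m] L0 L1 by (simp_all add: fps_power_zeroth)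
  have us: "(u oo s) $ 0 = u $ 0" "(u oo s) $ Suc 0 = u $ Suc 0"
    using s1 by (simp_all add: fps_compose_nth)
  have w: "w $ 0 = 0" "w $ Suc 0 = - of_nat m * c * b"
    unfolding w_def using Lm us u(1) by (simp_all add: fps_mult_nth_1 algebra_simps)
  have "w = fps_X * fps_shift 1 w" using w(1) by (intro fps_ext) (simp add: fps_mult_fps_X_commute[symmetric])
  moreover have "(1 + fps_X ^ m * u) oo s = (1 + fps_X ^ m * u) + fps_X ^ m * w"
  proof -
    have "fps_X ^ m oo s = fps_X ^ m * L ^ m"
      unfolding fps_X_power_compose[OF s0] unfolding s_def power_mult_distrib ..
    then have "(1 + fps_X ^ m * u) oo s = 1 + fps_X ^ m * L ^ m * (u oo s)"
      by (simp add: fps_compose_add_distrib fps_compose_mult_distrib[OF s0])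
    then show ?thesis unfolding w_def by (simp add: algebra_simps)
  qed
  ultimately have "(1 + fps_X ^ m * u) oo s = (1 + fps_X ^ m * u) + fps_X ^ Suc m * fps_shift 1 w"
    by (metis mult.assoc power_Suc2)
  then have "fps_shift 1 w $ 0 \<in> leading (Suc m) H" by (rule leading_quotient[OF mem u(2)])
  then show ?thesis using w(2) by simp
qed

section \<open>Products of linear polynomials and the graded pieces\<close>

abbreviation lin_prod :: "'a::field list \<Rightarrow> 'a poly" where
  "lin_prod xs \<equiv> \<Prod>x\<leftarrow>xs. [:1, x:]"

lemma fps_of_lin: "fps_of_poly [:1, x:] = lin x"
  by (simp add: fps_of_poly_pCons mult.commute)

lemma lin_prod_in_lin_group: "set xs \<subseteq> H \<Longrightarrow> fps_of_poly (lin_prod xs) \<in> lin_group H"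
proof (induction xs)
  case Nil
  then show ?case by (simp add: lin_group.one)
next
  case (Cons x xs)
  then have "fps_of_poly (lin_prod xs) * lin x \<in> lin_group H" by (intro lin_group.mult) auto
  then show ?case by (simp only: list.map prod_list.Cons fps_of_poly_mult fps_of_lin mult.commute)
qed

lemma degree_lin_prod: "degree (lin_prod xs) \<le> length xs"
proof (induction xs)
  case (Cons x xs)
  have "degree ([:1, x:] * lin_prod xs) \<le> degree [:1, x:] + degree (lin_prod xs)" by (rule degree_mult_le)
  moreover have "degree [:1, x:] \<le> 1" by simp
  ultimately show ?case using Cons by (simp del: mult_pCons_left)
qed simp

lemma lin_prod_nonzero: "lin_prod xs \<noteq> (0 :: 'a::field poly)"
  by (induction xs) (simp_all del: mult_pCons_left)

lemma coeff_lin_prod_in_subring: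
  assumes "subring_set F" "set xs \<subseteq> F"
  shows "coeff (lin_prod xs) i \<in> F"
  using assms(2)
proof (induction xs arbitrary: i)
  case Nil
  then show ?case using subring_setD(1,2)[OF assms(1)] by simp
next
  case (Cons x xs)
  have "coeff ([:1, x:] * lin_prod xs) i = coeff (lin_prod xs) i + (if i = 0 then 0 else x * coeff (lin_prod xs) (i - 1))"
    by (cases i) (simp_all add: coeff_pCons)
  also have "\<dots> \<in> F"
    using Cons subring_setD[OF assms(1)] by auto
  finally show ?case by simp
qed

text \<open>There are \<open>q ^ m\<close> products of \<open>m\<close> linear polynomials with coefficients in a ring with \<open>q\<close>
  elements, up to order, but only \<open>q ^ (m - 1)\<close> possible lists of coefficients below \<open>X ^ m\<close>.\<close>

lemma leading_UNIV_nontrivial: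
  assumes K: "torsion_field TYPE('a::field)" and inf: "infinite (UNIV :: 'a set)" and m: "m > 0"
  obtains c where "c \<noteq> 0" "c \<in> leading m (UNIV :: 'a set)"
proof -
  \<comment> \<open>A bound for the number of lists with a given product: nonzero entries x
    correspond to roots -1/x, of which there are at most m. Together with 0 this allows m + 1
    entries in m places.\<close>
  define N where "N = (m + 1) ^ m"
  obtain S :: "'a set" where S: "finite S" "card S = Suc N"
    using infinite_arbitrarily_large[OF inf] by metis
  obtain F where F: "finite F" "subring_set F" "S \<subseteq> F"
    using torsion_field_finite_subring[OF K S(1)] by metis
  have cF: "card F > N" using card_mono[OF F(1,3)] S(2) by simp
  define Ls where "Ls = {xs. set xs \<subseteq> F \<and> length xs = m}"
  have fin: "finite Ls" and cLs: "card Ls = card F ^ m"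
    unfolding Ls_def using finite_lists_length_eq[OF F(1)] card_lists_length_eq[OF F(1)] by auto
  \<comment> \<open>The coefficients of X, ..., X^(m-1); the constant coefficient is always
    1.\<close>
  define \<Phi> where "\<Phi> xs = map (\<lambda>k. coeff (lin_prod xs) (Suc k)) [0..<m - 1]" for xs :: "'a list"
  have fiber: "card {xs \<in> Ls. lin_prod xs = f} \<le> N" if "f \<noteq> 0" "degree f \<le> m" for f
  proof -
    define E where "E = insert 0 ((\<lambda>r. - 1 / r) ` {r. poly f r = 0})"
    have finR: "finite {r. poly f r = 0}" by (rule poly_roots_finite[OF that(1)])
    then have finE: "finite E" unfolding E_def by simp
    have "card E \<le> Suc (card {r. poly f r = 0})"
      unfolding E_def using finR by (intro le_trans[OF card_insert_le_m1[of "Suc (card {r. poly f r = 0})"]])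
        (simp_all add: card_image_le)
    also have "\<dots> \<le> m + 1" using card_poly_roots_bound[OF that(1)] that(2) by simp
    finally have cE: "card E \<le> m + 1" .
    have root: "poly (lin_prod xs) (- 1 / x) = 0" if "x \<in> set xs" "x \<noteq> 0" for x and xs :: "'a list"
      using that by (induction xs) auto
    have "{xs \<in> Ls. lin_prod xs = f} \<subseteq> {xs. set xs \<subseteq> E \<and> length xs = m}"
    proof
      fix xs assume xs: "xs \<in> {xs \<in> Ls. lin_prod xs = f}"
      have "x \<in> E" if x: "x \<in> set xs" for x
      proof (cases "x = 0")
        case False
        then have "poly f (- 1 / x) = 0" using root[OF x] xs by auto
        moreover have "x = - 1 / (- 1 / x)" using False by simp
        ultimately show ?thesis unfolding E_def by blast
      qed (simp add: E_def)
      then show "xs \<in> {xs. set xs \<subseteq> E \<and> length xs = m}" using xs unfolding Ls_def by auto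
    qed
    then have "card {xs \<in> Ls. lin_prod xs = f} \<le> card {xs. set xs \<subseteq> E \<and> length xs = m}"
      using finite_lists_length_eq[OF finE] by (intro card_mono)
    also have "\<dots> = card E ^ m" by (rule card_lists_length_eq[OF finE])
    also have "\<dots> \<le> N" unfolding N_def using cE by (rule power_mono) simp
    finally show ?thesis .
  qed
  \<comment> \<open>Otherwise these m - 1 coefficients determine the whole product, so there are at
    most q^(m-1) products with at most N lists each, too few for q^m lists since q > N.\<close>
  have "\<exists>xs\<in>Ls. \<exists>ys\<in>Ls. \<Phi> xs = \<Phi> ys \<and> coeff (lin_prod xs) m \<noteq> coeff (lin_prod ys) m"
  proof (rule ccontr)
    assume no: "\<not> ?thesis"
    have eq: "lin_prod xs = lin_prod ys" if xy: "xs \<in> Ls" "ys \<in> Ls" "\<Phi> xs = \<Phi> ys" for xs ys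
    proof (rule poly_eqI)
      fix i
      consider "i = 0" | k where "i = Suc k" "k < m - 1" | "i = m" | "i > m" using m
        by (metis Suc_lessI Suc_pred diff_Suc_1 lessI linorder_neqE_nat not0_implies_Suc not_less_eq)
      then show "coeff (lin_prod xs) i = coeff (lin_prod ys) i"
      proof cases
        case 1
        have "coeff (lin_prod zs) 0 = 1" for zs :: "'a list"
          by (induction zs) (simp_all add: coeff_mult_0 del: mult_pCons_left)
        then show ?thesis using 1 by simp
      next
        case (2 k)
        have "\<Phi> xs ! k = \<Phi> ys ! k" using xy(3) by simp
        then show ?thesis unfolding \<Phi>_def 2(1) using 2(2) by simp
      next
        case 3
        then show ?thesis using no xy by blast
      next
        case 4
        have "degree (lin_prod xs) < i" "degree (lin_prod ys) < i"
          using degree_lin_prod[of xs] degree_lin_prod[of ys] xy(1,2) 4 unfolding Ls_def by auto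
        then show ?thesis by (simp add: coeff_eq_0)
      qed
    qed
    define \<psi> where "\<psi> z = lin_prod (SOME xs. xs \<in> Ls \<and> \<Phi> xs = z)" for z
    have "lin_prod xs = \<psi> (\<Phi> xs)" if "xs \<in> Ls" for xs
    proof -
      define ys where "ys = (SOME ys. ys \<in> Ls \<and> \<Phi> ys = \<Phi> xs)"
      have "ys \<in> Ls \<and> \<Phi> ys = \<Phi> xs" unfolding ys_def by (rule someI[of _ xs]) (use that in simp)
      then show ?thesis unfolding \<psi>_def ys_def[symmetric] using eq that by metis
    qed
    then have img: "lin_prod ` Ls = \<psi> ` (\<Phi> ` Ls)" by (force simp: image_image)
    have "\<Phi> ` Ls \<subseteq> {zs. set zs \<subseteq> F \<and> length zs = m - 1}"
      unfolding \<Phi>_def Ls_def using coeff_lin_prod_in_subring[OF F(2)] by auto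
    then have "card (\<Phi> ` Ls) \<le> card F ^ (m - 1)"
      using card_mono[OF finite_lists_length_eq[OF F(1)]] card_lists_length_eq[OF F(1)] by metis
    then have cimg: "card (lin_prod ` Ls) \<le> card F ^ (m - 1)"
      unfolding img using card_image_le[of "\<Phi> ` Ls" \<psi>] fin by simp
    have "card Ls = (\<Sum>f\<in>lin_prod ` Ls. card {xs \<in> Ls. lin_prod xs = f})"
      using sum.image_gen[OF fin, of "\<lambda>_. 1 :: nat" lin_prod] by simp
    also have "\<dots> \<le> (\<Sum>f\<in>lin_prod ` Ls. N)"
    proof (rule sum_mono)
      fix f assume "f \<in> lin_prod ` Ls"
      then obtain xs where "xs \<in> Ls" "f = lin_prod xs" by blast
      then show "card {xs \<in> Ls. lin_prod xs = f} \<le> N"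
        using fiber[of f] lin_prod_nonzero[of xs] degree_lin_prod[of xs] unfolding Ls_def by simp
    qed
    also have "\<dots> = card (lin_prod ` Ls) * N" by simp
    also have "\<dots> \<le> card F ^ (m - 1) * N" using cimg by simp
    finally have "card F ^ m \<le> card F ^ (m - 1) * N" using cLs by simp
    moreover have "card F ^ m = card F ^ (m - 1) * card F" using m by (metis power_minus_mult)
    ultimately have "card F \<le> N" using cF by simp
    then show False using cF by simp
  qed
  then obtain xs ys where xy: "xs \<in> Ls" "ys \<in> Ls" "\<Phi> xs = \<Phi> ys"
    "coeff (lin_prod xs) m \<noteq> coeff (lin_prod ys) m" by blast
  let ?f = "fps_of_poly (lin_prod xs)" and ?g = "fps_of_poly (lin_prod ys)"
  have mem: "?f \<in> lin_group UNIV" "?g \<in> lin_group UNIV" by (simp_all add: lin_prod_in_lin_group)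
  define u where "u = fps_shift m (?f - ?g)"
  have low: "(?f - ?g) $ k = 0" if "k < m" for k
  proof (cases k)
    case 0
    then show ?thesis using lin_group_nth_0[OF mem(1)] lin_group_nth_0[OF mem(2)] by simp
  next
    case (Suc j)
    have "\<Phi> xs ! j = \<Phi> ys ! j" using xy(3) by simp
    then show ?thesis unfolding \<Phi>_def Suc using that Suc by simp
  qed
  have "?f = ?g + fps_X ^ m * u"
  proof (rule fps_ext)
    fix n
    show "?f $ n = (?g + fps_X ^ m * u) $ n"
      using low[of n] by (cases "n < m") (simp_all add: fps_X_power_mult_nth u_def)
  qed
  then have "u $ 0 \<in> leading m UNIV" by (rule leading_quotient[OF mem])
  moreover have "u $ 0 \<noteq> 0" unfolding u_def using xy(4) by simp
  ultimately show ?thesis using that by blast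
qed

lemma finite_power_image_imp_finite:
  fixes A :: "'a::field set"
  assumes "finite ((\<lambda>a. a ^ k) ` A)" "k > 0"
  shows "finite A"
proof -
  have "finite {a :: 'a. a ^ k = y}" for y
  proof -
    define f :: "'a poly" where "f = monom 1 k - [:y:]"
    have "coeff f k = 1" unfolding f_def using assms(2) by (cases k) simp_all
    then have f0: "f \<noteq> 0" by auto
    have "{a. a ^ k = y} = {a. poly f a = 0}" unfolding f_def by (simp add: poly_monom)
    then show ?thesis using poly_roots_finite[OF f0] by simp
  qed
  then have "finite (\<Union>y\<in>(\<lambda>a. a ^ k) ` A. {a. a ^ k = y})" using assms(1) by blast
  then show ?thesis by (rule finite_subset[rotated]) auto
qed

text \<open>\<open>E\<close> is the exact order of \<eta>. It is prime to the characteristic p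
  because X^p - 1 = (X - 1)^p, so an average over \<open>E\<close> powers retains a nonzero
  factor.\<close>

lemma torsion_field_high_order:
  assumes K: "torsion_field TYPE('a::field)" and inf: "infinite (UNIV :: 'a::field set)"
  obtains \<eta> :: "'a::field" and E where "E > 0" "\<eta> ^ E = 1" "(of_nat E :: 'a::field) \<noteq> 0"
    "\<And>j. 0 < j \<Longrightarrow> j \<le> m \<Longrightarrow> \<eta> ^ j \<noteq> 1"
proof -
  have "finite (insert 0 (\<Union>j\<in>{1..m}. {x :: 'a. x ^ j = 1}))"
    using card_roots_of_unity_le(1)[where 'a='a] by simp
  then obtain \<eta> :: 'a where \<eta>: "\<eta> \<notin> insert 0 (\<Union>j\<in>{1..m}. {x :: 'a. x ^ j = 1})"
    using inf ex_new_if_finite by metis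
  define E where "E = (LEAST n. n > 0 \<and> \<eta> ^ n = 1)"
  have "\<exists>n. n > 0 \<and> \<eta> ^ n = 1" using K \<eta> unfolding torsion_field_def by simp
  then have E: "E > 0" "\<eta> ^ E = 1" unfolding E_def using LeastI_ex[of "\<lambda>n. n > 0 \<and> \<eta> ^ n = 1"] by auto
  have p: "prime CHAR('a)" by (rule torsion_field_prime_char[OF K])
  have "\<not> CHAR('a) dvd E"
  proof
    assume "CHAR('a) dvd E"
    then obtain l where l: "E = CHAR('a) * l" by blast
    have "(\<eta> ^ l - 1) ^ (CHAR('a) ^ 1) = (\<eta> ^ l) ^ (CHAR('a) ^ 1) - 1 ^ (CHAR('a) ^ 1)"
      by (rule frobenius_diff[OF p])
    also have "(\<eta> ^ l) ^ (CHAR('a) ^ 1) = 1" using E(2) unfolding l by (simp add: power_mult mult.commute)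
    finally have "\<eta> ^ l = 1" by simp
    moreover have "l > 0" using E(1) l by (cases l) auto
    ultimately have "E \<le> l" unfolding E_def by (intro Least_le) simp
    then show False using l \<open>l > 0\<close> prime_gt_1_nat[OF p] by simp
  qed
  then have "(of_nat E :: 'a) \<noteq> 0" by (simp add: of_nat_eq_0_iff_char_dvd)
  then show ?thesis using that[of E \<eta>] E \<eta> by auto
qed

text \<open>Averaging \<open>(a + \<zeta> b) ^ m\<close> over roots of unity isolates the term \<open>m a ^ (m - 1) b\<close>, which is
  additive in \<open>b\<close>.\<close>

lemma leading_eq_UNIV_coprime:
  fixes H :: "'a::field set"
  assumes K: "torsion_field TYPE('a)" and inf: "infinite (UNIV :: 'a set)"
    and H: "finite_index H" and m: "m \<ge> 2" "\<not> CHAR('a) dvd m"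
  shows "leading m H = UNIV"
proof -
  let ?G = "leading m H"
  have G: "add_subgroup ?G" by (rule add_subgroup_leading)
  obtain c0 where c0: "c0 \<noteq> 0" "c0 \<in> leading m (UNIV :: 'a set)"
    using leading_UNIV_nontrivial[OF K inf, of m] m(1) by auto
  then obtain u where u: "c0 = u $ 0" "1 + fps_X ^ m * u \<in> lin_group UNIV" unfolding leading_def by blast
  obtain S where S: "finite S" "1 + fps_X ^ m * u \<in> lin_group S"
    using lin_group_finite_support[OF u(2)] by metis
  \<comment> \<open>For \<open>a\<close> in \<open>A\<close>, substituting a X sends the generators
    from \<open>S\<close> to generators from \<open>H\<close>.\<close>
  define A where "A = {a. \<forall>x\<in>S. a \<in> {a. x * a \<in> H}}"
  have A: "finite_index A" unfolding A_def by (rule finite_index_INT[OF S(1) finite_index_vimage_mult[OF H]])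
  have inA: "c0 * a ^ m \<in> ?G" if "a \<in> A" for a
  proof -
    have "a ^ m * u $ 0 \<in> ?G"
      by (rule leading_scale[OF S(2)]) (use that in \<open>simp add: A_def mult.commute\<close>)
    then show ?thesis using u(1) by (simp add: mult.commute)
  qed
  obtain \<eta> :: 'a and E where E: "E > 0" "\<eta> ^ E = 1" "(of_nat E :: 'a) \<noteq> 0"
      and \<eta>: "\<And>j. 0 < j \<Longrightarrow> j \<le> m * m \<Longrightarrow> \<eta> ^ j \<noteq> 1"
    using torsion_field_high_order[OF K inf, of "m * m"] by metis
  have \<eta>0: "\<eta> \<noteq> 0" using E(1,2) by (metis power_0_left neq0_conv zero_neq_one)
  \<comment> \<open>With this \<zeta>, the term b^i a^(m-i) of the t-th summand carries the factor
    (\<eta>^m \<zeta>^i)^t = \<eta>^(t m (1 - i)), which is trivial exactly for i = 1. The bound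
    \<open>m * m\<close> on excluded orders covers all i up to m.\<close>
  define \<zeta> where "\<zeta> = inverse \<eta> ^ m"
  define B where "B = {b. \<forall>t\<in>{..<E}. b \<in> {b. \<eta> ^ t * b \<in> A} \<inter> {b. (\<eta> * \<zeta>) ^ t * b \<in> A}}"
  have B: "finite_index B" unfolding B_def
    by (rule finite_index_INT) (auto intro!: finite_index_Int finite_index_vimage_mult[OF A])
  have r: "(\<Sum>t<E. (\<eta> ^ m * \<zeta> ^ i) ^ t) = (if i = 1 then of_nat E else 0)" if i: "i \<le> m" for i
  proof (cases "i = 1")
    case True
    have "\<eta> ^ m * \<zeta> ^ i = 1" unfolding True \<zeta>_def using \<eta>0 by (simp add: power_inverse)
    then show ?thesis using True by simp
  next
    case False
    define s where "s = \<eta> ^ m * \<zeta> ^ i"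
    have s1: "s \<noteq> 1"
    proof
      assume s: "s = 1"
      have "\<zeta> ^ i * \<eta> ^ (m * i) = (inverse \<eta> * \<eta>) ^ (m * i)"
        unfolding \<zeta>_def by (simp only: power_mult_distrib power_mult)
      then have "\<zeta> ^ i * \<eta> ^ (m * i) = 1" using \<eta>0 by simp
      then have "\<eta> ^ m = s * \<eta> ^ (m * i)" unfolding s_def by (simp only: mult.assoc mult_1_right)
      then have "\<eta> ^ m = \<eta> ^ (m * i)" using s by simp
      show False
      proof (cases "i = 0")
        case True
        then show False using \<open>\<eta> ^ m = \<eta> ^ (m * i)\<close> \<eta>[of m] m(1) by simp
      next
        case i0: False
        have "m * i = m + m * (i - 1)" using i0 by (simp add: algebra_simps)
        then have "\<eta> ^ m * \<eta> ^ (m * (i - 1)) = \<eta> ^ m * 1"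
          using \<open>\<eta> ^ m = \<eta> ^ (m * i)\<close> by (simp add: power_add)
        then have "\<eta> ^ (m * (i - 1)) = 1" using \<eta>0 by simp
        moreover have "0 < m * (i - 1)" using m(1) i0 False by simp
        moreover have "m * (i - 1) \<le> m * m" using i by (intro mult_le_mono2) simp
        ultimately show False using \<eta> by blast
      qed
    qed
    have "s ^ E = (\<eta> ^ E) ^ m * ((inverse \<eta>) ^ E) ^ (m * i)"
      unfolding s_def \<zeta>_def by (simp add: power_mult_distrib mult.commute flip: power_mult)
    then have sE: "s ^ E = 1" using E(2) by (simp add: power_inverse)
    have "(1 - s) * (\<Sum>t<E. s ^ t) = 1 - s ^ E" by (rule one_diff_power_eq[symmetric])
    then have "(\<Sum>t<E. s ^ t) = 0" using s1 sE by simp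
    then show ?thesis using False unfolding s_def by simp
  qed
  have key: "(c0 * of_nat m * of_nat E * a ^ (m - 1)) * b \<in> ?G" if ab: "a \<in> B" "b \<in> B" for a b
  proof -
    have "(\<Sum>t<E. c0 * ((\<eta> * \<zeta>) ^ t * b + \<eta> ^ t * a) ^ m) \<in> ?G"
    proof (rule add_subgroup_sum[OF G])
      fix t assume "t \<in> {..<E}"
      then have "(\<eta> * \<zeta>) ^ t * b \<in> A" "\<eta> ^ t * a \<in> A" using ab unfolding B_def by auto
      then have "(\<eta> * \<zeta>) ^ t * b + \<eta> ^ t * a \<in> A"
        using A add_subgroupD(4) unfolding finite_index_def by blast
      then show "c0 * ((\<eta> * \<zeta>) ^ t * b + \<eta> ^ t * a) ^ m \<in> ?G" by (rule inA)
    qed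
    also have "(\<Sum>t<E. c0 * ((\<eta> * \<zeta>) ^ t * b + \<eta> ^ t * a) ^ m) =
        (\<Sum>t<E. \<Sum>i\<le>m. c0 * of_nat (m choose i) * b ^ i * a ^ (m - i) * (\<eta> ^ m * \<zeta> ^ i) ^ t)"
    proof (rule sum.cong[OF refl])
      fix t
      have "((\<eta> * \<zeta>) ^ t * b) ^ i * (\<eta> ^ t * a) ^ (m - i) = b ^ i * a ^ (m - i) * (\<eta> ^ m * \<zeta> ^ i) ^ t"
        if "i \<le> m" for i
      proof -
        have "(\<eta> ^ t) ^ i * (\<eta> ^ t) ^ (m - i) = (\<eta> ^ t) ^ m" using that by (simp add: power_add[symmetric])
        then show ?thesis
          by (simp add: power_mult_distrib mult.commute mult.left_commute flip: power_mult)
      qed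
      then show "c0 * ((\<eta> * \<zeta>) ^ t * b + \<eta> ^ t * a) ^ m =
          (\<Sum>i\<le>m. c0 * of_nat (m choose i) * b ^ i * a ^ (m - i) * (\<eta> ^ m * \<zeta> ^ i) ^ t)"
        unfolding binomial_ring sum_distrib_left by (intro sum.cong) (simp_all add: mult.assoc)
    qed
    also have "\<dots> = (\<Sum>i\<le>m. \<Sum>t<E. c0 * of_nat (m choose i) * b ^ i * a ^ (m - i) * (\<eta> ^ m * \<zeta> ^ i) ^ t)"
      by (rule sum.swap)
    also have "\<dots> = (\<Sum>i\<le>m. c0 * of_nat (m choose i) * b ^ i * a ^ (m - i) * (if i = 1 then of_nat E else 0))"
      by (intro sum.cong refl) (simp only: sum_distrib_left[symmetric] r atMost_iff)
    also have "\<dots> = (\<Sum>i\<in>{1}. c0 * of_nat (m choose i) * b ^ i * a ^ (m - i) * (if i = 1 then of_nat E else 0))"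
      by (rule sum.mono_neutral_right) (use m(1) in auto)
    also have "\<dots> = (c0 * of_nat m * of_nat E * a ^ (m - 1)) * b" by (simp add: mult_ac)
    finally show ?thesis .
  qed
  define I where "I = (\<lambda>a. c0 * of_nat m * of_nat E * a ^ (m - 1)) ` B"
  have "infinite B" by (rule finite_index_infinite[OF B inf])
  then have "infinite ((\<lambda>a. a ^ (m - 1)) ` B)" using finite_power_image_imp_finite[of "m - 1" B] m(1) by auto
  moreover have "c0 * of_nat m * of_nat E \<noteq> 0"
    using c0(1) E(3) m(2) by (simp add: of_nat_eq_0_iff_char_dvd)
  then have "inj_on ((*) (c0 * of_nat m * of_nat E)) ((\<lambda>a. a ^ (m - 1)) ` B)" by (intro inj_onI) simp
  ultimately have "infinite ((*) (c0 * of_nat m * of_nat E) ` (\<lambda>a. a ^ (m - 1)) ` B)"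
    using finite_imageD by blast
  then have "infinite I" unfolding I_def by (simp add: image_image)
  then show ?thesis
    by (rule add_subgroup_eq_UNIV[OF K G B]) (use key in \<open>auto simp: I_def\<close>)
qed

text \<open>If the characteristic divides m, it does not divide m - 1, and
  \<open>leading_shift\<close> yields products of infinitely many multipliers from degree m - 1 with
  elements of \<open>H\<close>. In degree 1 these multipliers come from \<open>H\<close>
  itself.\<close>

lemma leading_eq_UNIV:
  fixes H :: "'a::field set"
  assumes K: "torsion_field TYPE('a)" and inf: "infinite (UNIV :: 'a set)"
    and H: "finite_index H" and m: "m \<ge> 2"
  shows "leading m H = UNIV"
proof (cases "CHAR('a) dvd m")
  case False
  then show ?thesis by (rule leading_eq_UNIV_coprime[OF K inf H m])
next
  case True
  have H': "add_subgroup H" using H unfolding finite_index_def by simp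
  obtain k where k: "m = Suc k" "k \<ge> 1" using m by (cases m) auto
  have "\<not> CHAR('a) dvd k"
  proof
    assume "CHAR('a) dvd k"
    then have "CHAR('a) dvd m - k" using True by simp
    then show False using k torsion_field_prime_char[OF K] by simp
  qed
  then have k0: "(of_nat k :: 'a) \<noteq> 0" and kd: "\<not> CHAR('a) dvd k" by (simp_all add: of_nat_eq_0_iff_char_dvd)
  have "infinite (leading k H)"
  proof (cases "k = 1")
    case True
    have "H \<subseteq> leading k H"
    proof
      fix b assume "b \<in> H"
      then have "1 + fps_X ^ k * fps_const b \<in> lin_group H"
        using lin_in_lin_group(1) True by (simp add: mult.commute)
      then show "b \<in> leading k H" unfolding leading_def by (intro CollectI exI[of _ "fps_const b"]) simp
    qed
    then show ?thesis using finite_index_infinite[OF H inf] finite_subset by blast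
  next
    case False
    then show ?thesis using leading_eq_UNIV_coprime[OF K inf H _ kd] k(2) inf by simp
  qed
  moreover have "inj_on (\<lambda>c. - of_nat k * c) (leading k H)" using k0 by (intro inj_onI) simp
  ultimately have "infinite ((\<lambda>c. - of_nat k * c) ` leading k H)" using finite_imageD by blast
  then show ?thesis
    by (rule add_subgroup_eq_UNIV[OF K add_subgroup_leading H])
      (use leading_shift[OF H'] in \<open>auto simp: k(1)\<close>)
qed

text \<open>From X^2 on each coefficient can be corrected in turn by \<open>leading_eq_UNIV\<close>.
  The coefficient of X, which \<open>H\<close> restricts, is assumed to vanish.\<close>

lemma lin_group_approximation:
  fixes w :: "'a::field fps"
  assumes K: "torsion_field TYPE('a)" and inf: "infinite (UNIV :: 'a set)"
    and H: "finite_index H" and w: "w $ 0 = 1" "w $ Suc 0 = 0"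
  shows "\<exists>f\<in>lin_group H. \<exists>u. w = f + fps_X ^ (n + 2) * u"
proof (induction n)
  case 0
  have "w = 1 + fps_X ^ 2 * fps_shift 2 w"
  proof (rule fps_ext)
    fix i :: nat
    consider "i = 0" | "i = 1" | j where "i = Suc (Suc j)" by (metis One_nat_def not0_implies_Suc)
    then show "w $ i = (1 + fps_X ^ 2 * fps_shift 2 w) $ i"
      by cases (use w in \<open>simp_all add: fps_X_power_mult_nth\<close>)
  qed
  then show ?case using lin_group.one by (metis add_0)
next
  case (Suc n)
  then obtain f u where f: "f \<in> lin_group H" "w = f + fps_X ^ (n + 2) * u" by blast
  have "u $ 0 \<in> leading (n + 2) H" using leading_eq_UNIV[OF K inf H, of "n + 2"] by simp
  then obtain v where v: "v $ 0 = u $ 0" "1 + fps_X ^ (n + 2) * v \<in> lin_group H" unfolding leading_def by auto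
  have f0: "f $ 0 = 1" by (rule lin_group_nth_0[OF f(1)])
  have "(u - f * v) $ 0 = 0" using v(1) f0 by simp
  then have "u - f * v = fps_X * fps_shift 1 (u - f * v)"
    by (intro fps_ext) (simp add: fps_mult_fps_X_commute[symmetric])
  moreover have "w = f * (1 + fps_X ^ (n + 2) * v) + fps_X ^ (n + 2) * (u - f * v)"
    unfolding f(2) by (simp add: algebra_simps)
  ultimately have "w = f * (1 + fps_X ^ (n + 2) * v) + fps_X ^ (Suc n + 2) * fps_shift 1 (u - f * v)"
    by (metis add_Suc mult.assoc power_Suc2)
  then show ?case using lin_group_mult[OF v(2) f(1)] by blast
qed

text \<open>For q = p^n, (1 + b X)^q is 1 up to X^n, so inverses may be replaced by (q - 1)-th
  powers.\<close>

lemma lin_group_poly_approximation: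
  fixes f :: "'a::field fps"
  assumes p: "prime CHAR('a)" and f: "f \<in> lin_group H"
  shows "\<exists>xs u. set xs \<subseteq> H \<and> f = fps_of_poly (lin_prod xs) + fps_X ^ n * u"
  using f
proof (induction rule: lin_group.induct)
  case one
  have "1 = fps_of_poly (lin_prod []) + fps_X ^ n * (0 :: 'a fps)" by simp
  then show ?case by (metis empty_subsetI list.set(1))
next
  case (mult f b)
  then obtain xs u where x: "set xs \<subseteq> H" "f = fps_of_poly (lin_prod xs) + fps_X ^ n * u" by blast
  have "f * lin b = fps_of_poly (lin_prod (b # xs)) + fps_X ^ n * (u * lin b)"
  proof -
    have "(A + fps_X ^ n * u) * L = L * A + fps_X ^ n * (u * L)" for A L :: "'a fps"
      by (simp add: algebra_simps)
    then show ?thesis unfolding x(2) list.map prod_list.Cons fps_of_poly_mult fps_of_lin .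
  qed
  then show ?case using x(1) mult(2) by (metis insert_subset list.set(2))
next
  case (div f b)
  then obtain xs u where x: "set xs \<subseteq> H" "f = fps_of_poly (lin_prod xs) + fps_X ^ n * u" by blast
  define q where "q = CHAR('a) ^ n"
  have "n \<le> 2 ^ n" using less_exp[of n] by simp
  also have "\<dots> \<le> q" unfolding q_def using prime_ge_2_nat[OF p] by (rule power_mono) simp
  finally have nq: "n \<le> q" .
  have q0: "q > 0" unfolding q_def using prime_gt_0_nat[OF p] by simp
  have p': "prime CHAR('a fps)" using p by simp
  have "lin b ^ q = 1 ^ q + (fps_const b * fps_X) ^ q"
    by (rule freshmans_dream'[OF p', of q n]) (simp add: q_def)
  also have "\<dots> = 1 + fps_X ^ n * (fps_const b ^ q * fps_X ^ (q - n))"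
    using nq by (simp add: power_mult_distrib mult.left_commute flip: power_add)
  finally have lq: "lin b ^ q = 1 + fps_X ^ n * (fps_const b ^ q * fps_X ^ (q - n))" .
  define t where "t = fps_const b ^ q * fps_X ^ (q - n)"
  have "lin b ^ (q - 1) = lin b ^ (q - 1) * lin b * inverse (lin b)" by (simp only: mult.assoc lin_nth(3) mult_1_right)
  also have "\<dots> = lin b ^ q * inverse (lin b)" using q0 by (simp only: power_minus_mult)
  also have "\<dots> = inverse (lin b) + fps_X ^ n * (t * inverse (lin b))"
    unfolding lq t_def[symmetric] by (simp only: distrib_right mult_1 mult.assoc)
  finally have inv: "inverse (lin b) = lin b ^ (q - 1) - fps_X ^ n * (t * inverse (lin b))" by simp
  have rep: "fps_of_poly (lin_prod (replicate k b @ xs)) = lin b ^ k * fps_of_poly (lin_prod xs)" for k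
    by (induction k) (simp_all only: replicate.simps append.simps list.map prod_list.Cons fps_of_poly_mult
        fps_of_lin power_0 mult_1 power_Suc mult.assoc)
  have "f * inverse (lin b) = fps_of_poly (lin_prod xs) * inverse (lin b) + fps_X ^ n * (u * inverse (lin b))"
    unfolding x(2) by (simp only: distrib_right mult.assoc)
  also have "fps_of_poly (lin_prod xs) * inverse (lin b) = fps_of_poly (lin_prod xs) *
      (lin b ^ (q - 1) - fps_X ^ n * (t * inverse (lin b)))" using inv by simp
  finally have "f * inverse (lin b) = fps_of_poly (lin_prod (replicate (q - 1) b @ xs)) +
      fps_X ^ n * (u * inverse (lin b) - fps_of_poly (lin_prod xs) * (t * inverse (lin b)))"
    unfolding rep by (simp add: algebra_simps)
  moreover have "set (replicate (q - 1) b @ xs) \<subseteq> H" using x(1) div(2) by auto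
  ultimately show ?case by blast
qed

text \<open>Removing the constant term and one factor 1 + b X with b in \<open>H'\<close> leaves 1 +
  O(X^2), which the smaller group \<open>H\<close> of finite index already approximates.\<close>

lemma lin_prod_approximation:
  fixes z :: "'a::field poly"
  assumes K: "torsion_field TYPE('a)" and inf: "infinite (UNIV :: 'a set)"
    and H: "finite_index H" "H \<subseteq> H'" and z: "coeff z 0 \<noteq> 0" "coeff z 1 / coeff z 0 \<in> H'"
  obtains xs where "set xs \<subseteq> H'" "[:0, 1:] ^ n dvd smult (coeff z 0) (lin_prod xs) - z"
proof -
  define b where "b = coeff z 1 / coeff z 0"
  define w where "w = fps_const (inverse (coeff z 0)) * fps_of_poly z * inverse (lin b)"
  have "inverse (lin b) $ 0 = 1" by simp
  moreover have "(lin b * inverse (lin b)) $ Suc 0 = 0" unfolding lin_nth(3) by simp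
  ultimately have "inverse (lin b) $ Suc 0 + b = 0" by (simp add: fps_mult_nth_1)
  then have "inverse (lin b) $ Suc 0 = - b" by (simp only: eq_neg_iff_add_eq_0)
  then have w: "w $ 0 = 1" "w $ Suc 0 = 0"
    unfolding w_def using z(1) by (simp_all add: fps_mult_nth_1 b_def field_simps)
  obtain f u where f: "f \<in> lin_group H" "w = f + fps_X ^ (n + 2) * u"
    using lin_group_approximation[OF K inf H(1) w, of n] by blast
  have "f * lin b \<in> lin_group H'"
    by (intro lin_group.mult lin_group_mono[OF f(1) H(2)]) (use z(2) b_def in simp)
  then obtain xs v where x: "set xs \<subseteq> H'" "f * lin b = fps_of_poly (lin_prod xs) + fps_X ^ n * v"
    using lin_group_poly_approximation[OF torsion_field_prime_char[OF K]] by blast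
  let ?c = "fps_const (coeff z 0)"
  have "?c * fps_const (inverse (coeff z 0)) = 1" using z(1) by (simp add: fps_const_mult)
  then have "fps_of_poly z = ?c * (fps_const (inverse (coeff z 0)) * fps_of_poly z * (inverse (lin b) * lin b))"
    using lin_nth(3)[of b] by (simp only: mult.commute[of "inverse (lin b)"] mult_1_right mult.assoc[symmetric] mult_1_left)
  also have "\<dots> = ?c * (w * lin b)" unfolding w_def by (simp only: mult.assoc)
  also have "\<dots> = ?c * (f * lin b) + fps_X ^ n * (fps_X ^ 2 * u * ?c * lin b)"
    unfolding f(2) by (simp add: algebra_simps power_add power2_eq_square)
  also have "\<dots> = ?c * fps_of_poly (lin_prod xs) + fps_X ^ n * (v * ?c + fps_X ^ 2 * u * ?c * lin b)"
    unfolding x(2) by (simp add: algebra_simps)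
  finally have "fps_of_poly z = fps_of_poly (smult (coeff z 0) (lin_prod xs)) +
      fps_X ^ n * (v * ?c + fps_X ^ 2 * u * ?c * lin b)" by (simp only: fps_of_poly_smult)
  then have eq: "coeff z i = coeff (smult (coeff z 0) (lin_prod xs)) i" if "i < n" for i
    using that by (metis (no_types, lifting) add.right_neutral fps_X_power_mult_nth fps_add_nth fps_of_poly_nth)
  have "coeff (smult (coeff z 0) (lin_prod xs) - z) i = 0" if "i < n" for i
    unfolding coeff_diff eq[OF that, symmetric] by (rule diff_self)
  then have "monom 1 n dvd smult (coeff z 0) (lin_prod xs) - z"
    unfolding monom_1_dvd_iff' by blast
  then have "[:0, 1:] ^ n dvd smult (coeff z 0) (lin_prod xs) - z" by (simp add: monom_altdef)
  then show ?thesis using that x(1) by blast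
qed

section \<open>Partitions into submonoids\<close>

lemma power_mem_of_mult_closed:
  fixes M :: "'a::monoid_mult set"
  assumes "1 \<in> M" "\<And>x y. x \<in> M \<Longrightarrow> y \<in> M \<Longrightarrow> x * y \<in> M" "x \<in> M"
  shows "x ^ n \<in> M"
  by (induction n) (use assms in auto)

text \<open>Modulo a power of \<open>\<rho>\<close>, the sets below become subgroups of an abelian torsion group that
  partition it modulo \<open>N\<close>. The torsion prime to the characteristic is locally cyclic, so some
  element \<open>a\<close> has order the characteristic \<open>p\<close> modulo \<open>N\<close>, and for \<open>b\<close> outside of the part of
  \<open>a\<close>, the elements \<open>a, b, a b, \<dots>, a ^ (p - 1) b\<close> lie in pairwise different parts.\<close>

lemma adic_partition_bound:
  fixes M :: "nat \<Rightarrow> 'b::field poly set"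
  assumes K: "torsion_field TYPE('b)" and \<rho>: "irreducible \<rho>" and k: "k > 0"
    and sub: "\<And>i z. i \<le> k \<Longrightarrow> z \<in> M i \<Longrightarrow> \<not> \<rho> dvd z"
    and cover: "\<And>z. \<not> \<rho> dvd z \<Longrightarrow> \<exists>i\<le>k. z \<in> M i"
    and int: "\<And>i j. i \<le> k \<Longrightarrow> j \<le> k \<Longrightarrow> i \<noteq> j \<Longrightarrow> M i \<inter> M j = N"
    and proper: "\<And>i. i \<le> k \<Longrightarrow> \<exists>z\<in>M i. z \<notin> N"
    and mult: "\<And>i x y. i \<le> k \<Longrightarrow> x \<in> M i \<Longrightarrow> y \<in> M i \<Longrightarrow> x * y \<in> M i"
    and closed: "\<And>i z. i \<le> k \<Longrightarrow> \<not> \<rho> dvd z \<Longrightarrow> (\<And>n. \<exists>y\<in>M i. \<rho> ^ n dvd y - z) \<Longrightarrow> z \<in> M i"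
    and op: "n0 > 0" "\<And>i y. i \<le> k \<Longrightarrow> \<rho> ^ n0 dvd y - 1 \<Longrightarrow> y \<in> M i"
  shows "CHAR('b) \<le> k"
proof -
  let ?p = "CHAR('b)"
  have p: "prime ?p" by (rule torsion_field_prime_char[OF K])
  have p': "prime CHAR('b poly)" using p by simp
  have one: "1 \<in> M i" if "i \<le> k" for i by (rule op(2)[OF that]) simp
  have pow: "x ^ n \<in> M i" if "i \<le> k" "x \<in> M i" for i x n
    by (rule power_mem_of_mult_closed[OF one[OF that(1)] mult[OF that(1)] that(2)])
  have co: "comaximal z (\<rho> ^ n)" if "\<not> \<rho> dvd z" for z n
    using that comaximal_irreducible_iff[OF \<rho>] comaximal_power_right by blast
  have tors: "\<exists>e>0. \<rho> ^ n dvd z ^ e - 1" if "\<not> \<rho> dvd z" for z n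
  proof -
    have "\<rho> ^ n \<noteq> 0" using irreducible_poly_nonzero[OF \<rho>] by simp
    from torsion_field_residue_torsion[OF K this co[OF that]] show ?thesis by metis
  qed
  have ndm: "\<not> \<rho> dvd x * y" if "\<not> \<rho> dvd x" "\<not> \<rho> dvd y" for x y
    using that irreducible_poly_prime[OF \<rho>] by blast
  \<comment> \<open>\<open>x ^ (e - 1)\<close> inverts \<open>x\<close> modulo
    \<open>\<rho> ^ n\<close>, and \<open>M i\<close> is adically closed.\<close>
  have D: "y \<in> M i" if i: "i \<le> k" and x: "x \<in> M i" and xy: "x * y \<in> M i" for i x y
  proof (rule closed[OF i])
    show "\<not> \<rho> dvd y" using sub[OF i xy] by auto
    fix n
    obtain e where e: "e > 0" "\<rho> ^ n dvd x ^ e - 1" using tors[OF sub[OF i x]] by blast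
    have "x ^ (e - 1) * (x * y) = x ^ e * y" using e(1) by (metis mult.assoc power_minus_mult)
    then have "x ^ (e - 1) * (x * y) - y = (x ^ e - 1) * y" by (simp add: left_diff_distrib)
    then have "\<rho> ^ n dvd x ^ (e - 1) * (x * y) - y" using e(2) by simp
    then show "\<exists>y'\<in>M i. \<rho> ^ n dvd y' - y" using mult[OF i pow[OF i x] xy] by blast
  qed
  \<comment> \<open>Membership in \<open>M i\<close> depends only on the class modulo
    \<open>\<rho> ^ n0\<close>.\<close>
  have E: "y \<in> M i" if i: "i \<le> k" and z: "z \<in> M i" and yz: "\<rho> ^ n0 dvd y - z" for i y z
  proof -
    obtain e where e: "e > 0" "\<rho> ^ n0 dvd z ^ e - 1" using tors[OF sub[OF i z]] by blast
    have "z ^ e = z ^ (e - 1) * z" using e(1) by (metis power_minus_mult)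
    then have "z ^ (e - 1) * y - 1 = z ^ (e - 1) * (y - z) + (z ^ e - 1)" by (simp add: right_diff_distrib)
    then have "\<rho> ^ n0 dvd z ^ (e - 1) * y - 1" using yz e(2) by (metis dvd_add dvd_mult)
    then show ?thesis using D[OF i pow[OF i z]] op(2)[OF i] by blast
  qed
  have Neq: "N = M 0 \<inter> M 1" using int[of 0 1] k by simp
  have Npow: "x ^ n \<in> N" if "x \<in> N" for x n using that pow[of 0 x n] pow[of 1 x n] k unfolding Neq by simp
  have ND: "y \<in> N" if "x \<in> N" "x * y \<in> N" for x y using that D[of 0 x y] D[of 1 x y] k unfolding Neq by simp
  \<comment> \<open>The Q-th power turns congruence modulo \<rho> into congruence modulo
    \<open>\<rho> ^ n0\<close>, so after it only the cyclic torsion modulo \<rho> matters.\<close>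
  define Q where "Q = ?p ^ n0"
  have nQ: "n0 \<le> Q"
  proof -
    have "n0 \<le> 2 ^ n0" using less_exp[of n0] by simp
    also have "\<dots> \<le> Q" unfolding Q_def using prime_ge_2_nat[OF p] by (rule power_mono) simp
    finally show ?thesis .
  qed
  have frob: "\<rho> ^ n0 dvd x ^ Q - y ^ Q" if "\<rho> dvd x - y" for x y
  proof -
    have "x ^ Q - y ^ Q = (x - y) ^ Q" using frobenius_diff[OF p', of x y n0] by (simp add: Q_def)
    then have "\<rho> ^ Q dvd x ^ Q - y ^ Q" using dvd_power_same[OF that, of Q] by simp
    then show ?thesis using le_imp_power_dvd[OF nQ] dvd_trans by blast
  qed
  \<comment> \<open>Modulo \<rho>, a and b are powers of one g. If g^Q lies in \<open>M l\<close>,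
    so do a^Q and b^Q, and \<open>l\<close> differs from \<open>i\<close> or from
    \<open>j\<close>.\<close>
  have some: "a ^ Q \<in> N \<or> b ^ Q \<in> N" if ij: "i \<le> k" "j \<le> k" "i \<noteq> j" and ab: "a \<in> M i" "b \<in> M j" for i j a b
  proof -
    define T where "T = {a ^ s * b ^ t | s t. True}"
    have a: "\<not> \<rho> dvd a" and b: "\<not> \<rho> dvd b" using sub ij ab by auto
    obtain e1 where e1: "e1 > 0" "\<rho> ^ 1 dvd a ^ e1 - 1" using tors[OF a] by blast
    obtain e2 where e2: "e2 > 0" "\<rho> ^ 1 dvd b ^ e2 - 1" using tors[OF b] by blast
    have T1: "1 \<in> T" unfolding T_def by (intro CollectI exI[of _ 0]) simp
    have Tm: "x * y \<in> T" if xy: "x \<in> T" "y \<in> T" for x y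
    proof -
      obtain s t s' t' where "x = a ^ s * b ^ t" "y = a ^ s' * b ^ t'" using xy unfolding T_def by blast
      then have "x * y = a ^ (s + s') * b ^ (t + t')" by (simp add: power_add mult_ac)
      then show ?thesis unfolding T_def by blast
    qed
    have Te: "\<rho> dvd x ^ (e1 * e2) - 1" if xT: "x \<in> T" for x
    proof -
      obtain s t where x: "x = a ^ s * b ^ t" using xT unfolding T_def by blast
      have "\<rho> dvd (a ^ e1) ^ (e2 * s) - 1 ^ (e2 * s)" "\<rho> dvd (b ^ e2) ^ (e1 * t) - 1 ^ (e1 * t)"
        using e1(2) e2(2) by (intro dvd_diff_power_cong; simp)+
      then have "\<rho> dvd (a ^ e1) ^ (e2 * s) * (b ^ e2) ^ (e1 * t) - 1 ^ (e2 * s) * 1 ^ (e1 * t)"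
        by (rule dvd_diff_mult_cong)
      moreover have "x ^ (e1 * e2) = (a ^ e1) ^ (e2 * s) * (b ^ e2) ^ (e1 * t)"
        unfolding x by (simp add: power_mult_distrib mult_ac flip: power_mult)
      ultimately show ?thesis by simp
    qed
    have "e1 * e2 > 0" using e1 e2 by simp
    then obtain g where g: "g \<in> T" "\<And>x. x \<in> T \<Longrightarrow> \<exists>s. \<rho> dvd x - g ^ s"
      using torsion_modulo_prime_cyclic[of \<rho> T "e1 * e2"] irreducible_poly_prime[OF \<rho>]
        irreducible_not_unit[OF \<rho>] T1 Tm Te by metis
    have "a = a ^ 1 * b ^ 0" "b = a ^ 0 * b ^ 1" by simp_all
    then have "a \<in> T" "b \<in> T" unfolding T_def by blast+
    then obtain s t where st: "\<rho> dvd a - g ^ s" "\<rho> dvd b - g ^ t" using g(2) by metis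
    have "\<not> \<rho> dvd g"
    proof
      assume "\<rho> dvd g"
      moreover obtain s t where "g = a ^ s * b ^ t" using g(1) unfolding T_def by blast
      ultimately show False
        using a b irreducible_poly_prime[OF \<rho>] irreducible_poly_dvd_power[OF \<rho>] by metis
    qed
    then have "\<not> \<rho> dvd g ^ Q" using irreducible_poly_dvd_power[OF \<rho>] by blast
    then obtain l where l: "l \<le> k" "g ^ Q \<in> M l" using cover by blast
    have st': "\<rho> ^ n0 dvd a ^ Q - (g ^ Q) ^ s" "\<rho> ^ n0 dvd b ^ Q - (g ^ Q) ^ t"
      using frob[OF st(1)] frob[OF st(2)] by (simp_all add: mult.commute flip: power_mult)
    have l': "a ^ Q \<in> M l" "b ^ Q \<in> M l"
      using E[OF l(1) pow[OF l] st'(1)] E[OF l(1) pow[OF l] st'(2)] .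
    have "a ^ Q \<in> M i" "b ^ Q \<in> M j" using pow[OF ij(1) ab(1)] pow[OF ij(2) ab(2)] .
    then have "l \<noteq> i \<Longrightarrow> a ^ Q \<in> N" "l \<noteq> j \<Longrightarrow> b ^ Q \<in> N"
      using int[OF l(1) ij(1)] int[OF l(1) ij(2)] l' by blast+
    then show ?thesis using ij(3) by blast
  qed
  obtain a0 b0 where ab0: "a0 \<in> M 0" "a0 \<notin> N" "b0 \<in> M 1" "b0 \<notin> N"
    using proper[of 0] proper[of 1] k by auto
  have "a0 ^ Q \<in> N \<or> b0 ^ Q \<in> N" using some[of 0 1] ab0 k by simp
  then have "\<exists>i j a b. i \<le> k \<and> j \<le> k \<and> i \<noteq> j \<and> a \<in> M i \<and> a \<notin> N \<and> b \<in> M j \<and> b \<notin> N \<and> a ^ Q \<in> N"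
  proof
    assume "a0 ^ Q \<in> N"
    then show ?thesis using ab0 k by (intro exI[of _ 0] exI[of _ 1] exI[of _ a0] exI[of _ b0]) simp
  next
    assume "b0 ^ Q \<in> N"
    then show ?thesis using ab0 k by (intro exI[of _ 1] exI[of _ 0] exI[of _ b0] exI[of _ a0]) simp
  qed
  then obtain i j a b where ij: "i \<le> k" "j \<le> k" "i \<noteq> j"
    and ab: "a \<in> M i" "a \<notin> N" "b \<in> M j" "b \<notin> N" "a ^ Q \<in> N" by blast
  \<comment> \<open>Minimality of \<open>s\<close> makes \<open>a1\<close> an element of order
    exactly p modulo \<open>N\<close>.\<close>
  define s where "s = (LEAST s. a ^ (?p ^ s) \<in> N)"
  have s: "a ^ (?p ^ s) \<in> N" unfolding s_def by (rule LeastI[of _ n0]) (use ab(5) Q_def in simp)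
  have s0: "s > 0" using s ab(2) by (cases s) auto
  define a1 where "a1 = a ^ (?p ^ (s - 1))"
  have a1N: "a1 \<notin> N"
  proof
    assume "a1 \<in> N"
    then have "s \<le> s - 1" unfolding a1_def s_def by (rule Least_le)
    then show False using s0 by simp
  qed
  have "?p ^ (s - 1) * ?p = ?p ^ s" using s0 by (rule power_minus_mult)
  then have a1p: "a1 ^ ?p \<in> N" using s unfolding a1_def by (simp flip: power_mult)
  have a1M: "a1 \<in> M i" unfolding a1_def by (rule pow[OF ij(1) ab(1)])
  have a1d: "a1 ^ d \<notin> N" if d: "0 < d" "d < ?p" for d
  proof
    assume dN: "a1 ^ d \<in> N"
    obtain x y where "d * x = ?p * y + gcd d ?p" using bezout_nat[of d ?p] d by auto
    moreover have "coprime ?p d" using p d by (metis dvd_imp_le linorder_not_less prime_imp_coprime)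
    ultimately have "d * x = ?p * y + 1" by (simp add: coprime_commute)
    then have "(a1 ^ ?p) ^ y * a1 = (a1 ^ d) ^ x" by (simp add: mult.commute flip: power_mult)
    then have "(a1 ^ ?p) ^ y * a1 \<in> N" using Npow[OF dN] by simp
    then show False using ND[OF Npow[OF a1p]] a1N by blast
  qed
  have bi: "a1 ^ l * b \<notin> M i" for l
  proof
    assume "a1 ^ l * b \<in> M i"
    then have "b \<in> M i" by (rule D[OF ij(1) pow[OF ij(1) a1M]])
    then show False using int[OF ij] ab by blast
  qed
  \<comment> \<open>The p + 1 elements to be separated: a1^l b for l < p, and a1 itself at index
    p.\<close>
  define c where "c l = (if l < ?p then a1 ^ l * b else a1)" for l
  have "\<exists>t\<le>k. c l \<in> M t" for l
    unfolding c_def using cover ndm sub[OF ij(1) a1M] sub[OF ij(2) ab(3)]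
      irreducible_poly_dvd_power[OF \<rho>] by metis
  then obtain t where t: "\<And>l. t l \<le> k" "\<And>l. c l \<in> M (t l)" by metis
  have uniq: "t' = i" if "t' \<le> k" "x \<in> M t'" "x \<in> M i" "x \<notin> N" for t' x
    using int[OF ij(1) that(1)] that by blast
  \<comment> \<open>Two of them in one part would put a1, or a power of it outside \<open>N\<close>,
    into that part. The part would then be \<open>M i\<close>, which contains no a1^l b.\<close>
  have ne: "t l \<noteq> t l'" if l: "l < l'" "l' \<le> ?p" for l l'
  proof
    assume eq: "t l = t l'"
    have l1: "a1 ^ l * b \<in> M (t l)" using t(2)[of l] l unfolding c_def by simp
    show False
    proof (cases "l' < ?p")
      case True
      then have "a1 ^ l' * b \<in> M (t l)" using t(2)[of l'] eq unfolding c_def by simp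
      moreover have "a1 ^ l' * b = (a1 ^ l * b) * a1 ^ (l' - l)"
        using l(1) by (simp add: mult_ac flip: power_add)
      ultimately have "a1 ^ (l' - l) \<in> M (t l)" using D[OF t(1) l1] by simp
      then have "t l = i" using uniq[OF t(1) _ pow[OF ij(1) a1M] a1d] l True by simp
      then show False using l1 bi by simp
    next
      case False
      then have "a1 \<in> M (t l)" using t(2)[of l'] eq unfolding c_def by simp
      then have "t l = i" using uniq[OF t(1) _ a1M a1N] by simp
      then show False using l1 bi by simp
    qed
  qed
  have "inj_on t {..?p}"
  proof (rule inj_onI)
    fix l l' assume "l \<in> {..?p}" "l' \<in> {..?p}" "t l = t l'"
    then show "l = l'" using ne[of l l'] ne[of l' l] by (metis atMost_iff linorder_neqE_nat)
  qed
  moreover have "t ` {..?p} \<subseteq> {..k}" using t(1) by auto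
  ultimately have "card {..?p} \<le> card {..k}" by (rule card_inj_on_le) simp
  then show ?thesis by simp
qed

section \<open>The characteristic of an infinite field\<close>

lemma of_int_dvd_char: "(of_int i :: 'a::ring_1) = 0 \<longleftrightarrow> int CHAR('a) dvd i"
  by (rule of_int_eq_0_iff_char_dvd)

lemma int_inverse_mod_prime:
  assumes "prime p" "\<not> int p dvd l"
  obtains l' where "[l * l' = 1] (mod int p)"
proof -
  have "prime (int p)" using assms(1) by simp
  then have "coprime (int p) l" using assms(2) by (rule prime_imp_coprime)
  then show ?thesis using that cong_solve_coprime_int coprime_commute by blast
qed

lemma add_subgroup_of_int_mult:
  fixes H :: "'a::comm_ring_1 set"
  assumes "add_subgroup H" "x \<in> H"
  shows "of_int i * x \<in> H"
proof -
  have n: "of_nat n * x \<in> H" for n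
    by (induction n) (use add_subgroupD[OF assms(1)] assms(2) in \<open>auto simp: distrib_right\<close>)
  show ?thesis
  proof (cases i rule: int_cases2)
    case (nonneg n)
    then show ?thesis using n[of n] by simp
  next
    case (nonpos n)
    then show ?thesis using add_subgroupD(3)[OF assms(1) n[of n]] by simp
  qed
qed

text \<open>A complement of the plane spanned by 1 and v over the prime field, obtained by Zorn: a
  \<open>w\<close> outside the sum could be adjoined to a maximal \<open>H\<close>.\<close>

lemma two_dimensional_complement:
  assumes p: "prime CHAR('a::field)" and inf: "infinite (UNIV :: 'a::field set)"
  obtains H :: "'a::field set" and v where "add_subgroup H"
    "\<And>i j. of_int i + of_int j * v \<in> H \<Longrightarrow> int CHAR('a::field) dvd i \<and> int CHAR('a::field) dvd j"
    "\<And>w. \<exists>h\<in>H. \<exists>i j. w = h + (of_int i + of_int j * v)"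
proof -
  let ?p = "CHAR('a)"
  let ?F = "range (of_int :: int \<Rightarrow> 'a)"
  have "card ?F = ?p" by (rule card_range_of_int) (use prime_gt_0_nat[OF p] in auto)
  then have "card ?F > 0" using prime_gt_0_nat[OF p] by simp
  then have "finite ?F" by (rule card_ge_0_finite)
  then obtain v where v: "v \<notin> ?F" using inf ex_new_if_finite by metis
  have inv: "\<exists>l'. of_int l' * of_int l = (1 :: 'a)" if l: "\<not> int ?p dvd l" for l
  proof -
    obtain l' where "[l * l' = 1] (mod int ?p)" using int_inverse_mod_prime[OF p l] by blast
    then have "(of_int (l * l') :: 'a) = of_int 1" by (simp only: of_int_eq_iff_cong_CHAR)
    then show ?thesis by (intro exI[of _ l']) (simp add: mult.commute)
  qed
  \<comment> \<open>Since 0 lies in \<open>H\<close>, the condition expresses both the independence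
    of 1 and v and the trivial intersection with \<open>H\<close>.\<close>
  define P where "P = (\<lambda>H. add_subgroup H \<and>
    (\<forall>i j. of_int i + of_int j * v \<in> H \<longrightarrow> int ?p dvd i \<and> int ?p dvd j))"
  have P0: "P {0}"
    unfolding P_def
  proof (intro conjI allI impI)
    show "add_subgroup {0 :: 'a}" unfolding add_subgroup_def by simp
    fix i j assume "of_int i + of_int j * v \<in> {0}"
    then have ij: "of_int i + of_int j * v = 0" by simp
    show j: "int ?p dvd j"
    proof (rule ccontr)
      assume "\<not> int ?p dvd j"
      then obtain j' where j': "of_int j' * of_int j = (1 :: 'a)" using inv by blast
      have "of_int j' * (of_int i + of_int j * v) = of_int (j' * i) + (of_int j' * of_int j) * v"
        by (simp add: algebra_simps)
      then have "v = of_int (- (j' * i))" using ij j' by (simp add: eq_neg_iff_add_eq_0 add.commute)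
      then show False using v by blast
    qed
    then have "(of_int j :: 'a) = 0" by (simp only: of_int_dvd_char)
    then have "(of_int i :: 'a) = 0" using ij by simp
    then show "int ?p dvd i" by (simp only: of_int_dvd_char)
  qed
  have "\<exists>H\<in>{H. P H}. \<forall>X\<in>{H. P H}. H \<subseteq> X \<longrightarrow> X = H"
  proof (rule subset_Zorn_nonempty)
    show "{H. P H} \<noteq> {}" using P0 by blast
    fix C assume C: "C \<noteq> {}" "subset.chain {H. P H} C"
    have CP: "\<And>H. H \<in> C \<Longrightarrow> P H" and Ct: "\<And>H H'. H \<in> C \<Longrightarrow> H' \<in> C \<Longrightarrow> H \<subseteq> H' \<or> H' \<subseteq> H"
      using C(2) unfolding subset.chain_def by auto
    have "add_subgroup (\<Union>C)"
      unfolding add_subgroup_def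
    proof (intro conjI ballI)
      show "0 \<in> \<Union>C" using C(1) CP add_subgroupD(1) unfolding P_def by blast
      fix x y assume "x \<in> \<Union>C" "y \<in> \<Union>C"
      then obtain H H' where H: "H \<in> C" "x \<in> H" "H' \<in> C" "y \<in> H'" by blast
      define H'' where "H'' = (if H \<subseteq> H' then H' else H)"
      have "H'' \<in> C" "x \<in> H''" "y \<in> H''" unfolding H''_def using H Ct[OF H(1,3)] by auto
      then have "x - y \<in> H''" using CP[of H''] add_subgroupD(2) unfolding P_def by blast
      then show "x - y \<in> \<Union>C" using \<open>H'' \<in> C\<close> by blast
    qed
    moreover have "int ?p dvd i \<and> int ?p dvd j" if "of_int i + of_int j * v \<in> \<Union>C" for i j
    proof -
      obtain H where "H \<in> C" "of_int i + of_int j * v \<in> H" using \<open>of_int i + of_int j * v \<in> \<Union>C\<close> by blast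
      then show ?thesis using CP[of H] unfolding P_def by blast
    qed
    ultimately show "\<Union>C \<in> {H. P H}" unfolding P_def by blast
  qed
  then obtain H where H: "P H" and max: "\<And>X. P X \<Longrightarrow> H \<subseteq> X \<Longrightarrow> X = H" by blast
  have sg: "add_subgroup H" and ind: "\<And>i j. of_int i + of_int j * v \<in> H \<Longrightarrow> int ?p dvd i \<and> int ?p dvd j"
    using H unfolding P_def by auto
  have "\<exists>h\<in>H. \<exists>i j. w = h + (of_int i + of_int j * v)" for w
  proof (rule ccontr)
    assume no: "\<not> ?thesis"
    define H' where "H' = {h + of_int l * w | h l. h \<in> H}"
    have "add_subgroup H'"
      unfolding add_subgroup_def
    proof (intro conjI ballI)
      show "0 \<in> H'" unfolding H'_def using add_subgroupD(1)[OF sg]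
        by (intro CollectI exI[of _ 0]) simp
      fix x y assume "x \<in> H'" "y \<in> H'"
      then obtain h l h' l' where "x = h + of_int l * w" "y = h' + of_int l' * w" "h \<in> H" "h' \<in> H"
        unfolding H'_def by blast
      moreover from this have "x - y = (h - h') + of_int (l - l') * w" by (simp add: algebra_simps)
      ultimately show "x - y \<in> H'" unfolding H'_def using add_subgroupD(2)[OF sg] by blast
    qed
    moreover have "int ?p dvd i \<and> int ?p dvd j" if ij: "of_int i + of_int j * v \<in> H'" for i j
    proof -
      obtain h l where hl: "of_int i + of_int j * v = h + of_int l * w" "h \<in> H"
        using ij unfolding H'_def by blast
      have "int ?p dvd l"
      proof (rule ccontr)
        assume "\<not> int ?p dvd l"
        then obtain l' where l': "of_int l' * of_int l = (1 :: 'a)" using inv by blast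
        have "of_int l' * (h + of_int l * w) = of_int l' * h + w"
          using l' by (simp add: distrib_left flip: mult.assoc)
        then have "w = of_int (- l') * h + (of_int (l' * i) + of_int (l' * j) * v)"
          unfolding hl(1)[symmetric] by (simp add: algebra_simps)
        moreover have "of_int (- l') * h \<in> H" by (rule add_subgroup_of_int_mult[OF sg hl(2)])
        ultimately show False using no by blast
      qed
      then have "(of_int l :: 'a) = 0" by (simp only: of_int_dvd_char)
      then have "of_int i + of_int j * v \<in> H" using hl by simp
      then show ?thesis by (rule ind)
    qed
    ultimately have "P H'" unfolding P_def by blast
    moreover have "H \<subseteq> H'"
    proof
      fix h assume "h \<in> H"
      then show "h \<in> H'" unfolding H'_def by (intro CollectI exI[of _ h] exI[of _ 0]) simp
    qed
    ultimately have "H' = H" by (rule max)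
    moreover have "w \<in> H'" unfolding H'_def using add_subgroupD(1)[OF sg]
      by (intro CollectI exI[of _ 0] exI[of _ 1]) simp
    ultimately have "w \<in> H" by simp
    then have "\<exists>h\<in>H. \<exists>i j. w = h + (of_int i + of_int j * v)"
      by (intro bexI[of _ w] exI[of _ 0]) simp_all
    then show False using no by blast
  qed
  then show ?thesis using that sg ind by blast
qed

section \<open>Submonoids given by the logarithmic derivative\<close>

text \<open>The quotient is the logarithmic derivative at 0.\<close>

definition log_deriv_in :: "'a::field set \<Rightarrow> 'a poly set" where
  "log_deriv_in H = {z. coeff z 0 \<noteq> 0 \<and> coeff z 1 / coeff z 0 \<in> H}"

text \<open>A condition on the support alone, hence one that \<open>h\<close> transports.\<close>

definition lin_smooth :: "'a::field set \<Rightarrow> 'a poly set" where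
  "lin_smooth H = {z. z \<noteq> 0 \<and> (\<forall>\<rho>. irreducible \<rho> \<longrightarrow> \<rho> dvd z \<longrightarrow> (\<exists>b\<in>H. \<rho> dvd [:1, b:]))}"

lemma unit_in_log_deriv_in:
  assumes "z dvd 1" "0 \<in> H"
  shows "z \<in> log_deriv_in H"
proof -
  have "z \<noteq> 0" using assms(1) by auto
  then have "degree z = 0" using assms(1) is_unit_iff_degree by blast
  then obtain c where c: "z = [:c:]" by (rule degree_eq_zeroE)
  then show ?thesis using \<open>z \<noteq> 0\<close> assms(2) unfolding log_deriv_in_def by simp
qed

text \<open>Splitting off a factor 1 + b X lowers the logarithmic derivative at 0 by b; a constant
  has logarithmic derivative 0.\<close>

lemma lin_smooth_subset:
  assumes H: "add_subgroup H" and z: "z \<in> lin_smooth H"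
  shows "z \<in> log_deriv_in H"
  using z
proof (induction "degree z" arbitrary: z rule: less_induct)
  case less
  have z0: "z \<noteq> 0" using less(2) unfolding lin_smooth_def by simp
  show ?case
  proof (cases "z dvd 1")
    case True
    then show ?thesis using unit_in_log_deriv_in add_subgroupD(1)[OF H] by blast
  next
    case False
    then obtain \<rho> where \<rho>: "irreducible \<rho>" "\<rho> dvd z" using poly_irreducible_factor z0 by metis
    then obtain b where b: "b \<in> H" "\<rho> dvd [:1, b:]" using less(2) unfolding lin_smooth_def by blast
    have "b \<noteq> 0"
    proof
      assume "b = 0"
      then have "\<rho> dvd 1" using b(2) by (simp add: one_pCons)
      then show False using irreducible_not_unit[OF \<rho>(1)] by blast
    qed
    then have "irreducible [:1, b:]" by (intro irreducible_poly_degree_1) simp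
    then have "[:1, b:] dvd \<rho>" using irreducible_poly_dvd_irreducible \<rho>(1) b(2) by blast
    then have "[:1, b:] dvd z" using \<rho>(2) dvd_trans by blast
    then obtain y where y: "z = [:1, b:] * y" by blast
    have y0: "y \<noteq> 0" using z0 y by auto
    have "degree z = degree [:1, b:] + degree y" unfolding y by (rule degree_mult_eq) (use y0 in auto)
    then have "degree y < degree z" using \<open>b \<noteq> 0\<close> by simp
    moreover have "y \<in> lin_smooth H"
      unfolding lin_smooth_def
    proof (intro CollectI conjI allI impI)
      fix \<kappa> assume \<kappa>: "irreducible \<kappa>" "\<kappa> dvd y"
      then have "\<kappa> dvd z" unfolding y by (intro dvd_mult)
      then show "\<exists>b\<in>H. \<kappa> dvd [:1, b:]" using less(2) \<kappa>(1) unfolding lin_smooth_def by blast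
    qed (rule y0)
    ultimately have IH: "y \<in> log_deriv_in H" using less(1) by blast
    have "coeff z 0 = coeff y 0" "coeff z 1 = coeff y 1 + b * coeff y 0"
      unfolding y by simp_all
    then have "coeff z 0 \<noteq> 0" "coeff z 1 / coeff z 0 = coeff y 1 / coeff y 0 + b"
      using IH unfolding log_deriv_in_def by (simp_all add: field_simps)
    then show ?thesis using IH add_subgroupD(4)[OF H _ b(1)] unfolding log_deriv_in_def by auto
  qed
qed

lemma lin_prod_smooth:
  assumes "set xs \<subseteq> H" "c \<noteq> 0"
  shows "smult c (lin_prod xs) \<in> lin_smooth H"
  unfolding lin_smooth_def
proof (intro CollectI conjI allI impI)
  show "smult c (lin_prod xs) \<noteq> 0" using assms(2) lin_prod_nonzero by simp
  fix \<rho> :: "'a poly" assume \<rho>: "irreducible \<rho>" "\<rho> dvd smult c (lin_prod xs)"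
  then have "\<rho> dvd lin_prod xs" using assms(2) by (simp add: dvd_smult_iff)
  then show "\<exists>b\<in>H. \<rho> dvd [:1, b:]"
    using assms(1)
  proof (induction xs)
    case Nil
    then show ?case using irreducible_not_unit[OF \<rho>(1)] by simp
  next
    case (Cons x xs)
    then have "\<rho> dvd [:1, x:] * lin_prod xs" by simp
    then have "\<rho> dvd [:1, x:] \<or> \<rho> dvd lin_prod xs" by (rule irreducible_poly_prime[OF \<rho>(1)])
    then show ?case using Cons by auto
  qed
qed

lemma dvd_X_iff: "[:0, 1:] dvd z \<longleftrightarrow> coeff z 0 = (0 :: 'a::field)"
  using poly_eq_0_iff_dvd[of z 0] by (simp add: poly_0_coeff_0)

lemma log_deriv_in_cong:
  assumes "z \<in> log_deriv_in H" "[:0, 1:] ^ 2 dvd y - z"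
  shows "y \<in> log_deriv_in H"
proof -
  have "monom 1 2 dvd y - z" using assms(2) by (simp add: monom_altdef)
  then have "coeff y 0 = coeff z 0" "coeff y 1 = coeff z 1" unfolding monom_1_dvd_iff' by auto
  then show ?thesis using assms(1) unfolding log_deriv_in_def by simp
qed

lemma golomb_equivalence_char_le:
  fixes h :: "'a::field poly \<Rightarrow> 'b::field poly"
  assumes eq: "golomb_equivalence h g" and K: "torsion_field TYPE('a)" and L: "torsion_field TYPE('b)"
    and inf: "infinite (UNIV :: 'a set)"
  shows "CHAR('b) \<le> CHAR('a)"
proof -
  let ?p = "CHAR('a)"
  let ?X = "[:0, 1 :: 'a:]"
  have p: "prime ?p" by (rule torsion_field_prime_char[OF K])
  obtain H :: "'a set" and v where H: "add_subgroup H"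
    and ind: "\<And>i j. of_int i + of_int j * v \<in> H \<Longrightarrow> int ?p dvd i \<and> int ?p dvd j"
    and span: "\<And>w. \<exists>h\<in>H. \<exists>i j. w = h + (of_int i + of_int j * v)"
    using two_dimensional_complement[OF p inf] by metis
  have char0: "(of_int i :: 'a) = 0" if "int ?p dvd i" for i using that by (simp only: of_int_dvd_char)
  have modp: "(of_int (i mod int ?p) :: 'a) = of_int i" for i
    by (simp add: of_int_eq_iff_cong_CHAR cong_def)
  have fi: "finite_index H"
  proof -
    define T where "T = (\<lambda>(i, j). of_int i + of_int j * v) ` ({0..<int ?p} \<times> {0..<int ?p})"
    have "\<exists>t\<in>T. x - t \<in> H" for x
    proof -
      obtain h i j where x: "h \<in> H" "x = h + (of_int i + of_int j * v)" using span by blast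
      have "of_int (i mod int ?p) + of_int (j mod int ?p) * v \<in> T"
        unfolding T_def using prime_gt_0_nat[OF p]
        by (intro image_eqI[of _ _ "(i mod int ?p, j mod int ?p)"]) auto
      then show ?thesis using x by (intro bexI) (auto simp: modp)
    qed
    moreover have "finite T" unfolding T_def by simp
    ultimately show ?thesis unfolding finite_index_def using H by blast
  qed
  \<comment> \<open>Directions of the p + 1 lines in the plane: slopes 0, ..., p - 1 and, at index
    p, the line through v.\<close>
  define d where "d l = (if l < ?p then 1 + of_nat l * v else v)" for l
  define Hl where "Hl l = {x + of_int t * d l | x t. x \<in> H}" for l
  have HHl: "H \<subseteq> Hl l" for l
  proof
    fix x assume "x \<in> H"
    then show "x \<in> Hl l" unfolding Hl_def by (intro CollectI exI[of _ x] exI[of _ 0]) simp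
  qed
  have Hl: "add_subgroup (Hl l)" for l
    unfolding add_subgroup_def
  proof (intro conjI ballI)
    show "0 \<in> Hl l" using HHl add_subgroupD(1)[OF H] by blast
    fix x y assume "x \<in> Hl l" "y \<in> Hl l"
    then obtain a s b t where "x = a + of_int s * d l" "y = b + of_int t * d l" "a \<in> H" "b \<in> H"
      unfolding Hl_def by blast
    moreover from this have "x - y = (a - b) + of_int (s - t) * d l" by (simp add: algebra_simps)
    ultimately show "x - y \<in> Hl l" unfolding Hl_def using add_subgroupD(2)[OF H] by blast
  qed
  have cov: "\<exists>l\<le>?p. w \<in> Hl l" for w
  proof -
    obtain h i j where w: "h \<in> H" "w = h + (of_int i + of_int j * v)" using span by blast
    show ?thesis
    proof (cases "int ?p dvd i")
      case True
      then have "w = h + of_int j * d ?p" using w(2) char0[OF True] unfolding d_def by simp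
      then show ?thesis unfolding Hl_def using w(1) by (intro exI[of _ ?p]) blast
    next
      case False
      \<comment> \<open>The slope is j / i modulo p, so that i + j v is i times 1 + l v.\<close>
      then obtain i' where i': "[i * i' = 1] (mod int ?p)" using int_inverse_mod_prime[OF p] by blast
      define l where "l = nat ((i' * j) mod int ?p)"
      have l: "int l = (i' * j) mod int ?p" "l < ?p"
        unfolding l_def using prime_gt_0_nat[OF p] by (simp_all add: nat_less_iff)
      have "(of_nat l :: 'a) = of_int (int l)" by simp
      then have "(of_nat l :: 'a) = of_int (i' * j)" unfolding l(1) modp .
      moreover have "(of_int (i * i') :: 'a) = of_int 1" using i' by (simp only: of_int_eq_iff_cong_CHAR)
      ultimately have "of_int i * of_nat l = (of_int j :: 'a)" by (simp flip: mult.assoc)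
      then have "w = h + of_int i * d l" using w(2) l(2) unfolding d_def
        by (simp add: distrib_left flip: mult.assoc)
      then show ?thesis unfolding Hl_def using w(1) l(2) by (intro exI[of _ l]) auto
    qed
  qed
  have dform: "\<exists>\<alpha> \<beta>. d l = of_int \<alpha> + of_int \<beta> * v \<and> (\<alpha>, \<beta>) = (if l < ?p then (1, int l) else (0, 1))" for l
    unfolding d_def by (auto intro!: exI[of _ "1 :: int"] exI[of _ "int l"])
  have dH: "d l \<notin> H" for l
  proof
    assume dl: "d l \<in> H"
    obtain \<alpha> \<beta> where ab: "d l = of_int \<alpha> + of_int \<beta> * v" "(\<alpha>, \<beta>) = (if l < ?p then (1, int l) else (0, 1))"
      using dform by blast
    have "int ?p dvd \<alpha> \<and> int ?p dvd \<beta>" using ind dl ab(1) by simp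
    then have "int ?p dvd 1" using ab(2) by (auto split: if_splits)
    then show False using prime_gt_1_nat[OF p] by simp
  qed
  have disj: "x \<in> H" if x: "x \<in> Hl l" "x \<in> Hl l'" and l: "l < l'" "l' \<le> ?p" for x l l'
  proof -
    obtain a s where a: "x = a + of_int s * d l" "a \<in> H" using x(1) unfolding Hl_def by blast
    obtain b t where b: "x = b + of_int t * d l'" "b \<in> H" using x(2) unfolding Hl_def by blast
    have dl: "d l = 1 + of_nat l * v" using l unfolding d_def by simp
    have "int ?p dvd s"
    proof (cases "l' < ?p")
      case True
      then have dl': "d l' = 1 + of_nat l' * v" unfolding d_def by simp
      have "of_int (s - t) + of_int (s * int l - t * int l') * v = b - a"
        using a(1) b(1) unfolding dl dl' by (simp add: algebra_simps)
      then have "of_int (s - t) + of_int (s * int l - t * int l') * v \<in> H"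
        using add_subgroupD(2)[OF H b(2) a(2)] by (simp only:)
      then have "int ?p dvd s - t \<and> int ?p dvd s * int l - t * int l'" by (rule ind)
      then have "int ?p dvd s - t" "int ?p dvd s * int l - t * int l'" by blast+
      then have "int ?p dvd (s * int l - t * int l') - (s - t) * int l'"
        by (rule dvd_diff[OF _ dvd_mult2, rotated])
      also have "(s * int l - t * int l') - (s - t) * int l' = s * (int l - int l')"
        by (simp add: algebra_simps)
      finally have "int ?p dvd s \<or> int ?p dvd int l - int l'" using p by (simp add: prime_dvd_mult_iff)
      moreover have "\<not> int ?p dvd int l - int l'"
      proof
        assume "int ?p dvd int l - int l'"
        then have "int ?p dvd int l' - int l" by (metis dvd_minus_iff minus_diff_eq)
        then have "int ?p \<le> int l' - int l" using l by (intro zdvd_imp_le) auto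
        then show False using True by simp
      qed
      ultimately show ?thesis by blast
    next
      case False
      then have dl': "d l' = v" unfolding d_def by simp
      have "of_int s + of_int (s * int l - t) * v = b - a"
        using a(1) b(1) unfolding dl dl' by (simp add: algebra_simps)
      then have "of_int s + of_int (s * int l - t) * v \<in> H"
        using add_subgroupD(2)[OF H b(2) a(2)] by (simp only:)
      then show ?thesis using ind by blast
    qed
    then show ?thesis using a char0 by simp
  qed
  have Hint: "Hl l \<inter> Hl l' = H" if "l \<le> ?p" "l' \<le> ?p" "l \<noteq> l'" for l l'
    using disj[of _ l l'] disj[of _ l' l] that HHl[of l] HHl[of l'] by (metis IntE IntI linorder_neqE_nat subsetI subset_antisym subset_iff)
  have irrX: "irreducible ?X" by (rule irreducible_poly_degree_1) simp
  obtain \<rho> where \<rho>: "adically_continuous h ?X \<rho>" "adically_continuous g \<rho> ?X"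
    using golomb_equivalenceD(6)[OF eq irrX] by blast
  have irr\<rho>: "irreducible \<rho>" by (rule adically_continuousD(2)[OF \<rho>(1)])
  define M where "M l = h ` log_deriv_in (Hl l)" for l
  define N where "N = h ` log_deriv_in H"
  have ld0: "z \<noteq> 0" if "z \<in> log_deriv_in A" for z and A :: "'a set"
    using that unfolding log_deriv_in_def by auto
  have hg: "\<And>x. x \<noteq> 0 \<Longrightarrow> h x \<noteq> 0" "\<And>x. x \<noteq> 0 \<Longrightarrow> g (h x) = x" "\<And>y. y \<noteq> 0 \<Longrightarrow> g y \<noteq> 0" "\<And>y. y \<noteq> 0 \<Longrightarrow> h (g y) = y"
    using golomb_equivalenceD[OF eq] by auto
  have memM: "z \<in> M l \<longleftrightarrow> z \<noteq> 0 \<and> g z \<in> log_deriv_in (Hl l)" for z l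
    unfolding M_def using hg ld0 by (metis image_iff)
  have memN: "z \<in> N \<longleftrightarrow> z \<noteq> 0 \<and> g z \<in> log_deriv_in H" for z
    unfolding N_def using hg ld0 by (metis image_iff)
  have ldX: "\<not> ?X dvd z" if "z \<in> log_deriv_in A" for z and A :: "'a set"
    using that unfolding dvd_X_iff log_deriv_in_def by simp
  have dvdg: "?X dvd g z \<longleftrightarrow> \<rho> dvd z" if "z \<noteq> 0" for z
    using adically_continuousD(3)[OF \<rho>(2) that] .
  have sub: "\<not> \<rho> dvd z" if "z \<in> M l" for z l
    using that ldX dvdg unfolding memM by blast
  \<comment> \<open>The images of \<open>lin_smooth\<close> elements are \<rho>-adically dense in
    \<open>M l\<close>.\<close>
  have smooth: "\<exists>y\<in>lin_smooth (Hl l). \<rho> ^ n dvd h y - z" if z: "z \<in> M l" for z l n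
  proof -
    have gz: "g z \<in> log_deriv_in (Hl l)" "z \<noteq> 0" using z memM by auto
    obtain k where k: "\<And>y. ?X ^ k dvd y - g z \<Longrightarrow> \<rho> ^ n dvd h y - h (g z)"
      using adically_continuousD(4)[OF \<rho>(1) ldX[OF gz(1)]] by metis
    have c: "coeff (g z) 0 \<noteq> 0" "coeff (g z) 1 / coeff (g z) 0 \<in> Hl l"
      using gz(1) unfolding log_deriv_in_def by auto
    obtain xs where xs: "set xs \<subseteq> Hl l" "?X ^ k dvd smult (coeff (g z) 0) (lin_prod xs) - g z"
      using lin_prod_approximation[OF K inf fi HHl c] by metis
    have "\<rho> ^ n dvd h (smult (coeff (g z) 0) (lin_prod xs)) - z" using k[OF xs(2)] hg(4)[OF gz(2)] by simp
    then show ?thesis using lin_prod_smooth[OF xs(1) c(1)] by blast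
  qed
  have closed: "z \<in> M l" if z: "\<not> \<rho> dvd z" and app: "\<And>n. \<exists>y\<in>M l. \<rho> ^ n dvd y - z" for z l
  proof -
    have z0: "z \<noteq> 0" using z by auto
    obtain k where k: "\<And>y. \<rho> ^ k dvd y - z \<Longrightarrow> ?X ^ 2 dvd g y - g z"
      using adically_continuousD(4)[OF \<rho>(2) z] by metis
    obtain y where y: "y \<in> M l" "\<rho> ^ k dvd y - z" using app by blast
    have "?X ^ 2 dvd g z - g y" using k[OF y(2)] by (rule dvd_diff_sym)
    then have "g z \<in> log_deriv_in (Hl l)" using log_deriv_in_cong y(1) memM by blast
    then show ?thesis using z0 memM by blast
  qed
  have smoothM: "h y \<in> M l" if "y \<in> lin_smooth (Hl l)" for y l
    unfolding M_def using lin_smooth_subset[OF Hl that] by blast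
  \<comment> \<open>\<open>h\<close> is not multiplicative, but a prime dividing the product of h x
    and h y divides one of them, so the pull-back of the product has its primes among those of x and
    y. Density then extends closure under products to all of \<open>M l\<close>.\<close>
  have smooth_mult: "h x * h y \<in> M l" if xy: "x \<in> lin_smooth (Hl l)" "y \<in> lin_smooth (Hl l)" for x y l
  proof -
    have x0: "x \<noteq> 0" "y \<noteq> 0" using xy unfolding lin_smooth_def by auto
    have hxy: "h x * h y \<noteq> 0" using hg(1) x0 by simp
    have "g (h x * h y) \<in> lin_smooth (Hl l)"
      unfolding lin_smooth_def
    proof (intro CollectI conjI allI impI)
      show "g (h x * h y) \<noteq> 0" using hg(3)[OF hxy] .
      fix \<kappa> assume \<kappa>: "irreducible \<kappa>" "\<kappa> dvd g (h x * h y)"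
      obtain \<mu> where \<mu>: "adically_continuous h \<kappa> \<mu>" "adically_continuous g \<mu> \<kappa>"
        using golomb_equivalenceD(6)[OF eq \<kappa>(1)] by blast
      have "\<mu> dvd h x * h y" using adically_continuousD(3)[OF \<mu>(2) hxy] \<kappa>(2) by simp
      then have "\<mu> dvd h x \<or> \<mu> dvd h y"
        by (rule irreducible_poly_prime[OF adically_continuousD(1)[OF \<mu>(2)]])
      then have "\<kappa> dvd x \<or> \<kappa> dvd y"
        using adically_continuousD(3)[OF \<mu>(1) x0(1)] adically_continuousD(3)[OF \<mu>(1) x0(2)] by simp
      then show "\<exists>b\<in>Hl l. \<kappa> dvd [:1, b:]" using xy \<kappa>(1) unfolding lin_smooth_def by blast
    qed
    then show ?thesis using smoothM[of "g (h x * h y)"] hg(4)[OF hxy] by metis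
  qed
  have mult: "x * y \<in> M l" if xy: "x \<in> M l" "y \<in> M l" for x y l
  proof (rule closed)
    show "\<not> \<rho> dvd x * y" using sub xy irreducible_poly_prime[OF irr\<rho>] by blast
    fix n
    obtain a where a: "a \<in> lin_smooth (Hl l)" "\<rho> ^ n dvd h a - x" using smooth[OF xy(1)] by blast
    obtain b where b: "b \<in> lin_smooth (Hl l)" "\<rho> ^ n dvd h b - y" using smooth[OF xy(2)] by blast
    have "\<rho> ^ n dvd h a * h b - x * y" by (rule dvd_diff_mult_cong[OF a(2) b(2)])
    then show "\<exists>z\<in>M l. \<rho> ^ n dvd z - x * y" using smooth_mult[OF a(1) b(1)] by blast
  qed
  have nd1: "\<not> \<rho> dvd 1" by (rule irreducible_not_unit[OF irr\<rho>])
  have g1: "g 1 dvd 1" using golomb_equivalenceD(5)[OF golomb_equivalence_sym[OF eq], of 1] by simp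
  \<comment> \<open>The power X^2 suffices because the logarithmic derivative at 0 depends only on
    the first two coefficients.\<close>
  obtain n0 where n0: "n0 > 0" "\<And>y. \<rho> ^ n0 dvd y - 1 \<Longrightarrow> ?X ^ 2 dvd g y - g 1"
    using adically_continuousD(4)[OF \<rho>(2) nd1] by metis
  have open1: "y \<in> M l" if y: "\<rho> ^ n0 dvd y - 1" for y l
  proof -
    have "\<not> \<rho> dvd y" using dvd_power_diff_imp[OF y n0(1)] nd1 by simp
    then have "y \<noteq> 0" by auto
    moreover have "g 1 \<in> log_deriv_in (Hl l)" using unit_in_log_deriv_in[OF g1] add_subgroupD(1)[OF Hl] by blast
    then have "g y \<in> log_deriv_in (Hl l)" using log_deriv_in_cong n0(2)[OF y] by blast
    ultimately show ?thesis using memM by blast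
  qed
  have cover: "\<exists>l\<le>?p. z \<in> M l" if z: "\<not> \<rho> dvd z" for z
  proof -
    have z0: "z \<noteq> 0" using z by auto
    then have "coeff (g z) 0 \<noteq> 0" using dvdg z dvd_X_iff by blast
    moreover obtain l where "l \<le> ?p" "coeff (g z) 1 / coeff (g z) 0 \<in> Hl l" using cov by blast
    ultimately show ?thesis using z0 memM unfolding log_deriv_in_def by blast
  qed
  have int: "M l \<inter> M l' = N" if "l \<le> ?p" "l' \<le> ?p" "l \<noteq> l'" for l l'
    using Hint[OF that] unfolding set_eq_iff Int_iff memM memN log_deriv_in_def by blast
  have proper: "\<exists>z\<in>M l. z \<notin> N" for l
  proof -
    have "d l \<in> Hl l" unfolding Hl_def using add_subgroupD(1)[OF H]
      by (intro CollectI exI[of _ 0] exI[of _ 1]) simp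
    then have a: "[:1, d l:] \<in> log_deriv_in (Hl l)" "[:1, d l:] \<notin> log_deriv_in H"
      unfolding log_deriv_in_def using dH by auto
    have "h [:1, d l:] \<in> M l" unfolding M_def using a(1) by blast
    moreover have "h [:1, d l:] \<notin> N" unfolding memN using hg(2)[OF ld0[OF a(1)]] a(2) by simp
    ultimately show ?thesis by blast
  qed
  show ?thesis
  proof (rule adic_partition_bound[OF L irr\<rho> prime_gt_0_nat[OF p], of M N n0])
    show "\<exists>i\<le>?p. z \<in> M i" if "\<not> \<rho> dvd z" for z using that by (rule cover)
    show "M i \<inter> M j = N" if "i \<le> ?p" "j \<le> ?p" "i \<noteq> j" for i j using that by (rule int)
    show "\<not> \<rho> dvd z" if "i \<le> ?p" "z \<in> M i" for i z using that(2) by (rule sub)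
    show "\<exists>z\<in>M i. z \<notin> N" if "i \<le> ?p" for i by (rule proper)
    show "x * y \<in> M i" if "i \<le> ?p" "x \<in> M i" "y \<in> M i" for i x y using that(2,3) by (rule mult)
    show "z \<in> M i" if "i \<le> ?p" "\<not> \<rho> dvd z" "\<And>n. \<exists>y\<in>M i. \<rho> ^ n dvd y - z" for i z
      using that(2,3) by (rule closed)
    show "0 < n0" by (rule n0(1))
    show "y \<in> M i" if "i \<le> ?p" "\<rho> ^ n0 dvd y - 1" for i y using that(2) by (rule open1)
  qed
qed

section \<open>Equality of characteristics and the isomorphism\<close>

text \<open>Every finite subset of K' lies in a finite subring, whose size is the number of
  solutions of v^q = v in K.\<close>

lemma golomb_equivalence_card_le:
  fixes h :: "'a::field poly \<Rightarrow> 'b::field poly"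
  assumes eq: "golomb_equivalence h g" and K: "torsion_field TYPE('a)" and L: "torsion_field TYPE('b)"
    and fin: "finite (UNIV :: 'a set)"
  shows "finite (UNIV :: 'b set) \<and> card (UNIV :: 'b set) \<le> card (UNIV :: 'a set)"
proof -
  have le: "card S \<le> card (UNIV :: 'a set)" if S: "finite S" for S :: "'b set"
  proof -
    obtain F where F: "finite F" "subring_set F" "S \<subseteq> F"
      using torsion_field_finite_subring[OF L S] by metis
    have "card S \<le> card F" by (rule card_mono[OF F(1,3)])
    also have "\<dots> = card {v :: 'a. v ^ card F = v}"
      by (rule golomb_equivalence_finite_subring[OF eq K F(1,2), symmetric])
    also have "\<dots> \<le> card (UNIV :: 'a set)" by (rule card_mono[OF fin]) simp
    finally show ?thesis .
  qed
  have "finite (UNIV :: 'b set)"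
  proof (rule ccontr)
    assume "infinite (UNIV :: 'b set)"
    then obtain S :: "'b set" where "finite S" "card S = Suc (card (UNIV :: 'a set))"
      using infinite_arbitrarily_large by blast
    then show False using le[of S] by simp
  qed
  then show ?thesis using le by blast
qed

text \<open>Finite fields have equal cardinality, a power of both characteristics. Otherwise both
  fields are infinite and the bound applies in both directions.\<close>

lemma golomb_equivalence_char:
  fixes h :: "'a::field poly \<Rightarrow> 'b::field poly"
  assumes eq: "golomb_equivalence h g" and K: "torsion_field TYPE('a)" and L: "torsion_field TYPE('b)"
  shows "CHAR('b) = CHAR('a)"
proof (cases "finite (UNIV :: 'a set)")
  case True
  note b = golomb_equivalence_card_le[OF eq K L True]
  note a = golomb_equivalence_card_le[OF golomb_equivalence_sym[OF eq] L K conjunct1[OF b]]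
  have pa: "prime CHAR('a)" and pb: "prime CHAR('b)" by (rule torsion_field_prime_char[OF K] torsion_field_prime_char[OF L])+
  obtain k where k: "card (UNIV :: 'a set) = CHAR('a) ^ k"
    by (rule finite_additive_subgroup_card[OF pa True]) simp_all
  obtain l where l: "card (UNIV :: 'b set) = CHAR('b) ^ l"
    by (rule finite_additive_subgroup_card[OF pb conjunct1[OF b]]) simp_all
  have "card {0, 1 :: 'a} \<le> card (UNIV :: 'a set)" by (rule card_mono[OF True]) simp
  then have "CHAR('a) ^ k \<noteq> 1" unfolding k[symmetric] by simp
  then have "CHAR('a) dvd CHAR('a) ^ k" by (cases k) auto
  also have "CHAR('a) ^ k = CHAR('b) ^ l" using a b k l by simp
  finally have "CHAR('a) dvd CHAR('b)" using pa prime_dvd_power_nat by blast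
  then show ?thesis using pa pb primes_dvd_imp_eq by metis
next
  case False
  have "infinite (UNIV :: 'b set)"
    using golomb_equivalence_card_le[OF golomb_equivalence_sym[OF eq] L K] False by blast
  then show ?thesis
    using golomb_equivalence_char_le[OF eq K L False]
      golomb_equivalence_char_le[OF golomb_equivalence_sym[OF eq] L K] by simp
qed

lemma golomb_equivalence_field_iso:
  fixes h :: "'a::field poly \<Rightarrow> 'b::field poly"
  assumes eq: "golomb_equivalence h g" and K: "torsion_field TYPE('a)"
  obtains f :: "'a \<Rightarrow> 'b" where "field_iso f"
proof -
  note L = golomb_equivalence_torsion[OF eq K]
  show thesis
    by (rule torsion_fields_iso[OF K L golomb_equivalence_char[OF eq K L]
          golomb_equivalence_finite_subring[OF golomb_equivalence_sym[OF eq] L]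
          golomb_equivalence_finite_subring[OF eq K] that])
qed

text \<open>The distinct units 1 and c go to two distinct nonzero constants, at least one of which
  is not 1.\<close>

lemma golomb_homeomorphism_two_elements:
  fixes h :: "'a::field poly \<Rightarrow> 'b::field poly"
  assumes hom: "homeomorphic_maps golomb golomb h g" and c: "(c :: 'a) \<noteq> 0" "c \<noteq> 1"
  obtains d :: 'b where "d \<noteq> 0" "d \<noteq> 1"
proof -
  have u: "[:c:] dvd 1" "[:c:] \<noteq> 0" "[:c:] \<noteq> 1" using c is_unit_iff_degree[of "[:c:]"] by (simp_all add: one_pCons)
  have h: "h w \<noteq> 0" "g (h w) = w" if "w \<noteq> 0" for w
    using hom that unfolding homeomorphic_maps_def continuous_map_def
    by (auto simp: topspace_golomb_topology Pi_iff)
  have "h [:c:] dvd 1" "h 1 dvd 1"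
    using golomb_homeomorphism_units[OF hom c u(2,1)] golomb_homeomorphism_units[OF hom c, of 1] by simp_all
  then have "degree (h [:c:]) = 0" "degree (h 1) = 0"
    using is_unit_iff_degree h(1)[OF u(2)] h(1)[of 1] by auto
  then obtain x y where xy: "h [:c:] = [:x:]" "h 1 = [:y:]" by (metis degree_eq_zeroE)
  have "h [:c:] \<noteq> h 1" using h(2)[OF u(2)] h(2)[of 1] u(3) by fastforce
  then have "x \<noteq> y" "x \<noteq> 0" "y \<noteq> 0" using xy h(1)[OF u(2)] h(1)[of 1] by auto
  then show thesis using that by metis
qed

lemma two_element_fields_iso:
  assumes "\<And>c :: 'a::field. c = 0 \<or> c = 1" and "\<And>d :: 'b::field. d = 0 \<or> d = 1"
  shows "field_iso (\<lambda>x :: 'a::field. if x = 0 then 0 else 1 :: 'b::field)"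
proof -
  let ?f = "\<lambda>x :: 'a. if x = 0 then 0 else 1 :: 'b"
  have two: "1 + 1 = (0 :: 'a)" "1 + 1 = (0 :: 'b)"
    by (metis assms(1) add_cancel_right_right one_neq_zero, metis assms(2) add_cancel_right_right one_neq_zero)
  have "inj ?f" unfolding inj_def using assms(1) by (metis zero_neq_one)
  moreover have "surj ?f" unfolding surj_def using assms(2) by (metis zero_neq_one)
  moreover have "?f (x + y) = ?f x + ?f y" for x y using assms(1)[of x] assms(1)[of y] two by auto
  ultimately show ?thesis unfolding field_iso_def bij_def by simp
qed

theorem theorem2p7:
  fixes p :: nat
  assumes "prime p"
    and "algebraic_over_GF p TYPE('a::field)"
    and "(golomb_topology :: 'a poly topology) homeomorphic_space
         (golomb_topology :: 'b::field poly topology)"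
  shows "\<exists>f :: 'a \<Rightarrow> 'b. field_iso f"
proof -
  have K: "torsion_field TYPE('a)" by (rule algebraic_over_GF_torsion[OF assms(2) prime_gt_0_nat[OF assms(1)]])
  obtain h :: "'a poly \<Rightarrow> 'b poly" and g where hom: "homeomorphic_maps golomb golomb h g"
    using assms(3) unfolding homeomorphic_space_def by blast
  have sym: "homeomorphic_maps golomb golomb g h" using hom homeomorphic_maps_sym by blast
  show ?thesis
  \<comment> \<open>If K has only the elements 0 and 1, a further element of K' would yield one in K
    through the inverse homeomorphism.\<close>
  proof (cases "\<exists>c :: 'a. c \<noteq> 0 \<and> c \<noteq> 1")
    case True
    then obtain c :: 'a where c: "c \<noteq> 0" "c \<noteq> 1" by blast
    obtain d :: 'b where d: "d \<noteq> 0" "d \<noteq> 1" by (rule golomb_homeomorphism_two_elements[OF hom c])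
    show ?thesis by (rule golomb_equivalence_field_iso[OF golomb_homeomorphism_equivalence[OF hom c d] K]) blast
  next
    case False
    have "d = 0 \<or> d = 1" for d :: 'b
    proof (rule ccontr)
      assume "\<not> (d = 0 \<or> d = 1)"
      then have d: "d \<noteq> 0" "d \<noteq> 1" by simp_all
      show False by (rule golomb_homeomorphism_two_elements[OF sym d]) (use False in blast)
    qed
    with False show ?thesis using two_element_fields_iso by blast
  qed
qed

end
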